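(* (i) Let $B$ be a stationary ordered Bratteli diagram such that the tail equivalence relation $\mathcal R$ is aperiodic and the incidence matrix $F$ satisfies condition (P), let $\varphi$ be its Vershik map, and let $\mu_\alpha$ be the ergodic $\mathcal R$-invariant probability measure determined by a distinguished vertex $\alpha$ of $R(A)$, $A=F^T$. Then the measure-preserving system $(X_B,\varphi,\mu_\alpha)$ is not strongly mixing. (ii) For any aperiodic substitution $\sigma$ on a finite alphabet $\mathcal A$ such that $|\sigma^n(a)|\to\infty$ as $n\to\infty$ for all $a\in\mathcal A$, the substitution dynamical system $(X_\sigma,T_\sigma,\nu)$ is not strongly mixing for any ergodic $T_\sigma$-invariant probability measure $\nu$.
   Context: A Bratteli diagram $B=(V,E)$ is an infinite graph with $V=\bigsqcup_{i\ge 0}V_i$, $E=\bigsqcup_{i\ge1}E_i$, all $V_i,E_i$ finite, $V_0=\{v_0\}$, with range and source maps $r,s$ such that $r(E_i)=V_i$, $s(E_i)=V_{i-1}$, $s^{-1}(v)\ne\emptyset$ for all $v\in V$, $r^{-1}(v')\neq\emptyset$ for all $v'\ne v_0$. $X_B$ is the space of infinite paths $x=(x_i)_{i\ge1}$, $x_i\in E_i$, $r(x_i)=s(x_{i+1})$, with the cylinder topology; it is assumed to have no isolated points. For a finite path $\overline e$ from $v_0$, $[\overline e]$ is the cylinder set of infinite paths starting with $\overline e$. $F_n$ ($n\ge1$) is the matrix whose $(v,w)$ entry, $v\in V_{n+1},w\in V_n$, is the number of edges from $w$ to $v$. $B$ is stationary if $F_n=F$ for all $n\ge1$; then $V_n$,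 $n\ge1$, is identified with $\{1,\dots,N\}$. $h^{(1)}_w$ is the number of edges from $v_0$ to $w\in V_1$. $B$ is ordered if each $r^{-1}(v)$, $v\ne v_0$, is linearly ordered; stationary ordered if it is stationary and the order on $E_n$, $n\ge 2$, does not depend on $n$. A path is maximal (minimal) if all its edges are maximal (minimal) in $r^{-1}(r(x_i))$. $\mathcal R$: $x,y$ are tail equivalent if $x_i=y_i$ for all large $i$; $\mathcal R$ is aperiodic if all classes are infinite. Vershik map $\varphi$ (defined outside the paths tail equivalent to maximal or minimal infinite paths, a countable null set): if $k$ is the least index with $x_k$ not maximal, $\varphi(x)=(x^0_1,\dots,x^0_{k-1},\overline{x_k},x_{k+1},\dots)$ where $\overline{x_k}$ is the successor of $x_k$ in $r^{-1}(r(x_k))$ and $(x^0_1,\dots,x^0_{k-1})$ is the minimal path from $v_0$ to $s(\overline{x_k})$. Let $G(A)$ be the directed graph on $\{1,\dots,N\}$ with $i\to j$ iff $A_{ij}>0$; vertices $i,j$ are equivalent if $i=j$ or there are paths both ways; $\mathcal E_1,\dots,\mathcal E_m$ are the classes (vertices of the reduced graph $R(A)$), $F_\alpha$ is $F$ restricted to $\mathcal E_\alpha$, $A_\alpha=F_\alpha^T$, $\rho_\alpha$ its spectral radius. $\beta$ has access to $\alpha$ in $R(A)$ if $\beta=\alpha$ or there is a path in $G(A)$ from $\mathcal E_\beta$ to $\mathcal E_\alpha$; $\alpha$ is distinguished if $\rho_\alpha>\rho_\beta$ for every $\beta\ne\alpha$ with access to $\alpha$. Condition (P): vertices and classes are numbered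 so that $F$ is block lower triangular with diagonal blocks $F_1,\dots,F_m$, exactly the first $s$ classes being those to which no other class has access in $R(A)$, and every nonzero $F_\alpha$ is primitive. For $\alpha$ distinguished, $\lambda_\alpha:=\rho_\alpha$ and $\xi_\alpha$ is the unique non-negative eigenvector of $A$ for $\lambda_\alpha$ with $\xi_\alpha(i)>0$ iff the class of $i$ has access to $\alpha$, normalized by $\sum_{w\in V_1}h^{(1)}_w\xi_\alpha(w)=1$; $\mu_\alpha$ is the ($\mathcal R$-invariant, ergodic) probability measure with $\mu_\alpha([\overline e])=\xi_\alpha(v)/\lambda_\alpha^{n-1}$ for every path $\overline e$ of length $n$ from $v_0$ to $v\in V_n$. Substitutions: $\sigma:\mathcal A\to\mathcal A^+$ ($\mathcal A^+$ the non-empty words), extended by concatenation; $\mathcal L(\sigma)$ is the set of factors of $\sigma^n(a)$, $a\in\mathcal A$, $n\ge1$; $X_\sigma=\{x\in\mathcal A^{\mathbb Z}:x[-n,n]\in\mathcal L(\sigma)\ \forall n\}$, $T_\sigma$ the left shift; $\sigma$ is aperiodic if $(X_\sigma,T_\sigma)$ has no periodic points. *)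

theory Defs
  imports
    "HOL-Probability.Probability"
    "HOL-Library.Sublist"
    "Jordan_Normal_Form.Spectral_Radius"
    "Jordan_Normal_Form.DL_Submatrix"
begin

definition borel_of_top :: "'a topology \<Rightarrow> 'a measure" where
  "borel_of_top X = sigma (topspace X) {U. openin X U}"

definition preserves_measure :: "'a measure \<Rightarrow> ('a \<Rightarrow> 'a) \<Rightarrow> bool" where
  "preserves_measure M T \<longleftrightarrow> T \<in> measurable M M \<and> distr M M T = M"

definition ergodic :: "'a measure \<Rightarrow> ('a \<Rightarrow> 'a) \<Rightarrow> bool" where
  "ergodic M T \<longleftrightarrow>
     (\<forall>S\<in>sets M. T -` S \<inter> space M = S \<longrightarrow> measure M S = 0 \<or> measure M S = 1)"

text \<open>Invariance of \<open>M\<close> is not part of the definition, so that denying strong mixing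
  denies exactly the limit relation.\<close>

definition strongly_mixing :: "'a measure \<Rightarrow> ('a \<Rightarrow> 'a) \<Rightarrow> bool" where
  "strongly_mixing M T \<longleftrightarrow>
     (\<forall>S\<in>sets M. \<forall>R\<in>sets M.
        (\<lambda>n. measure M (((T ^^ n) -` S \<inter> space M) \<inter> R)) \<longlonglongrightarrow> measure M S * measure M R)"

text \<open>
  The disjoint unions of the vertex sets and of the edge sets are kept as families
  indexed by the level, so that one name may occur on several levels; hence the source and range
  maps take the level of the edge as an argument. The field \<open>edge_ord\<close> at level \<open>n\<close>
  and vertex \<open>v\<close> is the order on the set of edges of level \<open>n\<close> with range \<open>v\<close>.
\<close>

record ('v, 'e) bratteli =
  vtx :: "nat \<Rightarrow> 'v set"
  edg :: "nat \<Rightarrow> 'e set"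
  src :: "nat \<Rightarrow> 'e \<Rightarrow> 'v"
  rng :: "nat \<Rightarrow> 'e \<Rightarrow> 'v"
  edge_ord :: "nat \<Rightarrow> 'v \<Rightarrow> 'e rel"

definition edges_into :: "('v, 'e) bratteli \<Rightarrow> nat \<Rightarrow> 'v \<Rightarrow> 'e set" where
  "edges_into B n v = {e \<in> edg B n. rng B n e = v}"

definition edges_from :: "('v, 'e) bratteli \<Rightarrow> nat \<Rightarrow> 'v \<Rightarrow> 'e set" where
  "edges_from B n v = {e \<in> edg B (Suc n). src B (Suc n) e = v}"

definition bratteli_diagram :: "('v, 'e) bratteli \<Rightarrow> bool" where
  "bratteli_diagram B \<longleftrightarrow>
     (\<forall>n. finite (vtx B n)) \<and>
     (\<forall>n\<ge>1. finite (edg B n)) \<and>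
     (\<exists>v0. vtx B 0 = {v0}) \<and>
     (\<forall>n\<ge>1. rng B n ` edg B n = vtx B n \<and> src B n ` edg B n = vtx B (n - 1)) \<and>
     (\<forall>n. \<forall>v\<in>vtx B n. edges_from B n v \<noteq> {}) \<and>
     (\<forall>n\<ge>1. \<forall>v\<in>vtx B n. edges_into B n v \<noteq> {})"

definition ordered_diagram :: "('v, 'e) bratteli \<Rightarrow> bool" where
  "ordered_diagram B \<longleftrightarrow> bratteli_diagram B \<and>
     (\<forall>n\<ge>1. \<forall>v\<in>vtx B n. linear_order_on (edges_into B n v) (edge_ord B n v))"

text \<open>Paths are indexed from \<open>0\<close>: the entry with index \<open>i\<close> is an edge of level \<open>Suc i\<close>.
  They start at the root because the root is the only vertex of level \<open>0\<close>.\<close>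

definition inf_paths :: "('v, 'e) bratteli \<Rightarrow> (nat \<Rightarrow> 'e) set" where
  "inf_paths B = {x. \<forall>i. x i \<in> edg B (Suc i) \<and>
                         rng B (Suc i) (x i) = src B (Suc (Suc i)) (x (Suc i))}"

definition fin_path :: "('v, 'e) bratteli \<Rightarrow> 'e list \<Rightarrow> bool" where
  "fin_path B p \<longleftrightarrow>
     (\<forall>i<length p. p ! i \<in> edg B (Suc i)) \<and>
     (\<forall>i. Suc i < length p \<longrightarrow> rng B (Suc i) (p ! i) = src B (Suc (Suc i)) (p ! Suc i))"

definition cylinder :: "('v, 'e) bratteli \<Rightarrow> 'e list \<Rightarrow> (nat \<Rightarrow> 'e) set" where
  "cylinder B p = {x \<in> inf_paths B. \<forall>i<length p. x i = p ! i}"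

definition path_topology :: "('v, 'e) bratteli \<Rightarrow> (nat \<Rightarrow> 'e) topology" where
  "path_topology B = topology_generated_by {cylinder B p | p. fin_path B p}"

definition no_isolated_points :: "'a topology \<Rightarrow> bool" where
  "no_isolated_points X \<longleftrightarrow> (\<forall>x\<in>topspace X. \<not> openin X {x})"

definition tail_equivalent :: "(nat \<Rightarrow> 'e) \<Rightarrow> (nat \<Rightarrow> 'e) \<Rightarrow> bool" where
  "tail_equivalent x y \<longleftrightarrow> (\<forall>\<^sub>F i in sequentially. x i = y i)"

definition aperiodic_tail_relation :: "('v, 'e) bratteli \<Rightarrow> bool" where
  "aperiodic_tail_relation B \<longleftrightarrow>
     (\<forall>x\<in>inf_paths B. infinite {y \<in> inf_paths B. tail_equivalent x y})"

definition max_edge :: "('v, 'e) bratteli \<Rightarrow> nat \<Rightarrow> 'e \<Rightarrow> bool" where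
  "max_edge B n e \<longleftrightarrow> e \<in> edg B n \<and>
     (\<forall>f\<in>edges_into B n (rng B n e). (f, e) \<in> edge_ord B n (rng B n e))"

definition min_edge :: "('v, 'e) bratteli \<Rightarrow> nat \<Rightarrow> 'e \<Rightarrow> bool" where
  "min_edge B n e \<longleftrightarrow> e \<in> edg B n \<and>
     (\<forall>f\<in>edges_into B n (rng B n e). (e, f) \<in> edge_ord B n (rng B n e))"

definition succ_edge :: "('v, 'e) bratteli \<Rightarrow> nat \<Rightarrow> 'e \<Rightarrow> 'e \<Rightarrow> bool" where
  "succ_edge B n e e' \<longleftrightarrow>
     (let S = {f \<in> edges_into B n (rng B n e). (e, f) \<in> edge_ord B n (rng B n e) \<and> f \<noteq> e}
      in e' \<in> S \<and> (\<forall>f\<in>S. (e', f) \<in> edge_ord B n (rng B n e)))"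

definition max_path :: "('v, 'e) bratteli \<Rightarrow> (nat \<Rightarrow> 'e) \<Rightarrow> bool" where
  "max_path B x \<longleftrightarrow> x \<in> inf_paths B \<and> (\<forall>i. max_edge B (Suc i) (x i))"

definition min_path :: "('v, 'e) bratteli \<Rightarrow> (nat \<Rightarrow> 'e) \<Rightarrow> bool" where
  "min_path B x \<longleftrightarrow> x \<in> inf_paths B \<and> (\<forall>i. min_edge B (Suc i) (x i))"

definition vershik_domain :: "('v, 'e) bratteli \<Rightarrow> (nat \<Rightarrow> 'e) set" where
  "vershik_domain B =
     {x \<in> inf_paths B. \<not> (\<exists>y. (max_path B y \<or> min_path B y) \<and> tail_equivalent x y)}"

text \<open>Only meaningful on \<open>vershik_domain\<close>. The conditions determine \<open>y\<close>: since \<open>y\<close> is a path,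
  its entries below \<open>k\<close> form the minimal path from the root to the source of \<open>y k\<close>.\<close>

definition vershik :: "('v, 'e) bratteli \<Rightarrow> (nat \<Rightarrow> 'e) \<Rightarrow> (nat \<Rightarrow> 'e)" where
  "vershik B x =
     (let k = (LEAST k. \<not> max_edge B (Suc k) (x k))
      in THE y. y \<in> inf_paths B \<and> (\<forall>i<k. min_edge B (Suc i) (y i)) \<and>
                succ_edge B (Suc k) (x k) (y k) \<and> (\<forall>i>k. y i = x i))"

definition incidence_mat :: "(nat, 'e) bratteli \<Rightarrow> nat \<Rightarrow> nat \<Rightarrow> nat mat" where
  "incidence_mat B N n =
     mat N N (\<lambda>(v, w). card {e \<in> edg B (Suc n). src B (Suc n) e = w \<and> rng B (Suc n) e = v})"

text \<open>For matrix indexing, the vertices of every level \<open>n \<ge> 1\<close> are numbered \<open>0, \<dots>, N - 1\<close>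
  instead of \<open>1, \<dots>, N\<close>.\<close>

definition stationary_diagram :: "(nat, 'e) bratteli \<Rightarrow> nat \<Rightarrow> nat mat \<Rightarrow> bool" where
  "stationary_diagram B N F \<longleftrightarrow> bratteli_diagram B \<and>
     (\<forall>n\<ge>1. vtx B n = {..<N}) \<and> (\<forall>n\<ge>1. incidence_mat B N n = F)"

text \<open>That the order does not depend on the level means that the edge sets of the levels
  \<open>n \<ge> 2\<close> can be identified compatibly with sources, ranges and orders.\<close>

definition stationary_ordered :: "(nat, 'e) bratteli \<Rightarrow> nat \<Rightarrow> nat mat \<Rightarrow> bool" where
  "stationary_ordered B N F \<longleftrightarrow> stationary_diagram B N F \<and> ordered_diagram B \<and>
     (\<forall>n\<ge>2. \<exists>\<theta>. bij_betw \<theta> (edg B 2) (edg B n) \<and>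
        (\<forall>e\<in>edg B 2. src B n (\<theta> e) = src B 2 e \<and> rng B n (\<theta> e) = rng B 2 e) \<and>
        (\<forall>v<N. \<forall>e\<in>edges_into B 2 v. \<forall>f\<in>edges_into B 2 v.
           (e, f) \<in> edge_ord B 2 v \<longleftrightarrow> (\<theta> e, \<theta> f) \<in> edge_ord B n v))"

definition root_edges :: "(nat, 'e) bratteli \<Rightarrow> nat \<Rightarrow> nat" where
  "root_edges B w = card (edges_into B 1 w)"

definition graph_of :: "nat mat \<Rightarrow> nat rel" where
  "graph_of A = {(i, j). i < dim_row A \<and> j < dim_col A \<and> A $$ (i, j) > 0}"

definition same_class :: "nat mat \<Rightarrow> nat rel" where
  "same_class A = {(i, j). i < dim_row A \<and> j < dim_row A \<and>
     (i = j \<or> (i, j) \<in> (graph_of A)\<^sup>+ \<and> (j, i) \<in> (graph_of A)\<^sup>+)}"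

definition comm_classes :: "nat mat \<Rightarrow> nat set set" where
  "comm_classes A = {..<dim_row A} // same_class A"

definition has_access :: "nat mat \<Rightarrow> nat set \<Rightarrow> nat set \<Rightarrow> bool" where
  "has_access A \<beta> \<alpha> \<longleftrightarrow> \<beta> = \<alpha> \<or> (\<exists>i\<in>\<beta>. \<exists>j\<in>\<alpha>. (i, j) \<in> (graph_of A)\<^sup>+)"

definition class_radius :: "nat mat \<Rightarrow> nat set \<Rightarrow> real" where
  "class_radius F \<alpha> = spectral_radius (map_mat of_nat (transpose_mat (submatrix F \<alpha> \<alpha>)))"

definition distinguished :: "nat mat \<Rightarrow> nat set \<Rightarrow> bool" where
  "distinguished F \<alpha> \<longleftrightarrow> \<alpha> \<in> comm_classes (transpose_mat F) \<and>
     (\<forall>\<beta>\<in>comm_classes (transpose_mat F).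
        \<beta> \<noteq> \<alpha> \<and> has_access (transpose_mat F) \<beta> \<alpha> \<longrightarrow> class_radius F \<beta> < class_radius F \<alpha>)"

definition primitive_mat :: "nat mat \<Rightarrow> bool" where
  "primitive_mat M \<longleftrightarrow> square_mat M \<and>
     (\<exists>k\<ge>1. \<forall>i<dim_row M. \<forall>j<dim_col M. (M ^\<^sub>m k) $$ (i, j) > 0)"

text \<open>\<open>cs\<close> is the numbering of the classes. The third conjunct says that the classes are
  consecutive blocks of vertices in this order, the fourth that the blocks of \<open>F\<close> above the
  diagonal vanish.\<close>

definition condition_P :: "nat mat \<Rightarrow> bool" where
  "condition_P F \<longleftrightarrow>
     (\<exists>cs s. distinct cs \<and> set cs = comm_classes (transpose_mat F) \<and>
        (\<forall>a b. a < b \<and> b < length cs \<longrightarrow> (\<forall>i\<in>cs ! a. \<forall>j\<in>cs ! b. i < j)) \<and>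
        (\<forall>a b. a < b \<and> b < length cs \<longrightarrow> (\<forall>i\<in>cs ! a. \<forall>j\<in>cs ! b. F $$ (i, j) = 0)) \<and>
        s \<le> length cs \<and>
        (\<forall>a<length cs. a < s \<longleftrightarrow>
           \<not> (\<exists>\<beta>\<in>comm_classes (transpose_mat F). \<beta> \<noteq> cs ! a \<and> has_access (transpose_mat F) \<beta> (cs ! a))) \<and>
        (\<forall>\<alpha>\<in>set cs. submatrix F \<alpha> \<alpha> \<noteq> 0\<^sub>m (card \<alpha>) (card \<alpha>) \<longrightarrow>
           primitive_mat (submatrix F \<alpha> \<alpha>)))"

definition distinguished_vector ::
  "(nat, 'e) bratteli \<Rightarrow> nat mat \<Rightarrow> nat set \<Rightarrow> real vec \<Rightarrow> bool" where
  "distinguished_vector B F \<alpha> \<xi> \<longleftrightarrow>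
     eigenvector (map_mat real (transpose_mat F)) \<xi> (class_radius F \<alpha>) \<and>
     (\<forall>i<dim_row F. vec_index \<xi> i \<ge> 0) \<and>
     (\<forall>i<dim_row F. vec_index \<xi> i > 0 \<longleftrightarrow>
        has_access (transpose_mat F) (same_class (transpose_mat F) `` {i}) \<alpha>) \<and>
     (\<Sum>w<dim_row F. real (root_edges B w) * vec_index \<xi> w) = 1"

text \<open>The cylinders generate the topology and are, up to the empty set, closed under intersection,
  so at most one Borel probability measure has the prescribed values. Invariance under the tail
  equivalence relation and ergodicity are consequences and are not assumed.\<close>

definition distinguished_measure ::
  "(nat, 'e) bratteli \<Rightarrow> nat mat \<Rightarrow> nat set \<Rightarrow> (nat \<Rightarrow> 'e) measure \<Rightarrow> bool" where
  "distinguished_measure B F \<alpha> M \<longleftrightarrow>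
     prob_space M \<and> sets M = sets (borel_of_top (path_topology B)) \<and>
     (\<exists>\<xi>. distinguished_vector B F \<alpha> \<xi> \<and>
        (\<forall>p. fin_path B p \<and> p \<noteq> [] \<longrightarrow>
           measure M (cylinder B p) =
             vec_index \<xi> (rng B (length p) (last p)) / class_radius F \<alpha> ^ (length p - 1)))"

definition subst_ext :: "('a \<Rightarrow> 'a list) \<Rightarrow> 'a list \<Rightarrow> 'a list" where
  "subst_ext \<sigma> w = concat (map \<sigma> w)"

definition substitution :: "('a \<Rightarrow> 'a list) \<Rightarrow> bool" where
  "substitution \<sigma> \<longleftrightarrow> (\<forall>a. \<sigma> a \<noteq> [])"

definition subst_language :: "('a \<Rightarrow> 'a list) \<Rightarrow> 'a list set" where
  "subst_language \<sigma> = {w. \<exists>a. \<exists>n\<ge>1. sublist w ((subst_ext \<sigma> ^^ n) [a])}"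

definition subst_space :: "('a \<Rightarrow> 'a list) \<Rightarrow> (int \<Rightarrow> 'a) set" where
  "subst_space \<sigma> = {x. \<forall>n::nat. map x [- int n..int n] \<in> subst_language \<sigma>}"

definition left_shift :: "(int \<Rightarrow> 'a) \<Rightarrow> (int \<Rightarrow> 'a)" where
  "left_shift x = (\<lambda>i. x (i + 1))"

definition subst_topology :: "('a \<Rightarrow> 'a list) \<Rightarrow> (int \<Rightarrow> 'a) topology" where
  "subst_topology \<sigma> =
     subtopology (product_topology (\<lambda>_. discrete_topology UNIV) UNIV) (subst_space \<sigma>)"

definition aperiodic_subst :: "('a \<Rightarrow> 'a list) \<Rightarrow> bool" where
  "aperiodic_subst \<sigma> \<longleftrightarrow> \<not> (\<exists>x\<in>subst_space \<sigma>. \<exists>p\<ge>1. (left_shift ^^ p) x = x)"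

end

(*
  Strong mixing forces \<mu>(E \<inter> T^-D E) to tend to \<mu>(E)^2. In both parts there is a constant c > 0 such that
  for cylinders E of arbitrarily small positive measure, E meets one of its translates by
  arbitrarily large D in measure at least c \<mu>(E), and hence \<mu>(E) \<ge> c, which is absurd.

  For the Vershik map, the radius of a distinguished class exceeds 1, so two different segments of
  the same length lead from a vertex a of the class back to a, starting at any level n. Replacing one
  by the other is a power D of the Vershik map that does not depend on what comes before the segment,
  and D is at least the number of paths from the root to a at level n. A definite proportion of every
  cylinder that ends in the class passes through the first segment.

  For a substitution, the origin of a point lies in blocks \<sigma>^n(v_n). If some letter y = v_n = v_n' with
  n' - n bounded occurs twice in \<sigma>^(n' - n)(y), then the block has a second copy at the distance
  |\<sigma>^n(w)|, where w is one of boundedly many words, and every word in the block is repeated at that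
  distance. Otherwise a letter recurs at two levels n << n' and occurs only once in \<sigma>^(n' - n)(y), so the
  origin is confined to |\<sigma>^n(y)| positions of the long block \<sigma>^n'(y); such points have small measure
  because aperiodicity makes the cylinders of long words uniformly small.
*)

theory Submission
  imports Defs
begin

section \<open>Substitution words and blocks\<close>

text \<open>For substitutions the obstacle is that the displacement and the block in question vary
  with the point, while mixing speaks of one cylinder and one displacement at a time. A union bound
  copes with this if the constants are chosen in the right order. The number M of words that can
  give a displacement, over all levels used, depends on the substitution alone; the word u is chosen
  with measure below 1/(16 M); only then come the levels, so high that at each displacement mixing
  bounds the overlap by twice the squared measure, and so sparse that the confined points have
  little measure. A point may sit in blocks in several ways, so points are covered by sets and
  counted, not sorted into classes. For diagrams a single displacement serves a whole cylinder. The
  measure of a cylinder depends only on its length and its last vertex, so the constant c is a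
  quotient of eigenvector entries divided by a fixed power of the radius. Aperiodicity of the tail
  relation is what makes this radius exceed 1.\<close>

lemma subst_ext_append [simp]: "subst_ext \<sigma> (u @ v) = subst_ext \<sigma> u @ subst_ext \<sigma> v"
  by (simp add: subst_ext_def)

lemma subst_ext_Nil [simp]: "subst_ext \<sigma> [] = []"
  by (simp add: subst_ext_def)

lemma subst_ext_pow_append [simp]:
  "(subst_ext \<sigma> ^^ n) (u @ v) = (subst_ext \<sigma> ^^ n) u @ (subst_ext \<sigma> ^^ n) v"
  by (induction n) auto

lemma subst_ext_pow_Nil [simp]: "(subst_ext \<sigma> ^^ n) [] = []"
  by (induction n) auto

lemma subst_ext_pow_Cons:
  "(subst_ext \<sigma> ^^ n) (a # v) = (subst_ext \<sigma> ^^ n) [a] @ (subst_ext \<sigma> ^^ n) v"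
  using subst_ext_pow_append[of n \<sigma> "[a]" v] by simp

lemma subst_ext_pow_concat:
  "(subst_ext \<sigma> ^^ n) w = concat (map (\<lambda>a. (subst_ext \<sigma> ^^ n) [a]) w)"
proof (induction w)
  case (Cons a w)
  then show ?case by (subst subst_ext_pow_Cons) simp
qed simp

lemma subst_ext_pow_Suc_single:
  "(subst_ext \<sigma> ^^ Suc n) [a] = (subst_ext \<sigma> ^^ n) (\<sigma> a)"
  by (simp only: funpow_Suc_right o_apply) (simp add: subst_ext_def)

lemma subst_ext_pow_add:
  "(subst_ext \<sigma> ^^ (m + n)) w = (subst_ext \<sigma> ^^ m) ((subst_ext \<sigma> ^^ n) w)"
  by (simp add: funpow_add)

lemma concat_map_locate:
  assumes "k < length (concat (map f xs))"
  shows "\<exists>l b r. xs = l @ b # r \<and> length (concat (map f l)) \<le> k \<and>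
           k < length (concat (map f l)) + length (f b)"
  using assms
proof (induction xs arbitrary: k)
  case (Cons x xs)
  show ?case
  proof (cases "k < length (f x)")
    case True
    then show ?thesis by (intro exI[of _ "[]"] exI[of _ x] exI[of _ xs]) simp
  next
    case False
    then have "k - length (f x) < length (concat (map f xs))" using Cons.prems by simp
    from Cons.IH[OF this] obtain l b r where "xs = l @ b # r"
      "length (concat (map f l)) \<le> k - length (f x)"
      "k - length (f x) < length (concat (map f l)) + length (f b)" by blast
    then show ?thesis using False
      by (intro exI[of _ "x # l"] exI[of _ b] exI[of _ r]) auto
  qed
qed simp

section \<open>Nested blocks around a position\<close>

definition occurs_at :: "(int \<Rightarrow> 'a) \<Rightarrow> int \<Rightarrow> 'a list \<Rightarrow> bool" where
  "occurs_at x j w \<longleftrightarrow> (\<forall>i<length w. x (j + int i) = w ! i)"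

lemma occurs_at_append:
  "occurs_at x j (u @ v) \<longleftrightarrow> occurs_at x j u \<and> occurs_at x (j + int (length u)) v"
proof -
  have "occurs_at x j v'" if "occurs_at x j (u @ v)" "v' = u" for v'
    using that by (auto simp: occurs_at_def nth_append)
  moreover have "occurs_at x (j + int (length u)) v" if "occurs_at x j (u @ v)"
    unfolding occurs_at_def
  proof (intro allI impI)
    fix i assume "i < length v"
    with that[unfolded occurs_at_def, rule_format, of "length u + i"]
    show "x (j + int (length u) + int i) = v ! i" by (simp add: add.assoc)
  qed
  moreover have "occurs_at x j (u @ v)"
    if a: "occurs_at x j u" and b: "occurs_at x (j + int (length u)) v"
    unfolding occurs_at_def
  proof (intro allI impI)
    fix i assume i: "i < length (u @ v)"
    show "x (j + int i) = (u @ v) ! i"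
    proof (cases "i < length u")
      case True then show ?thesis using a by (simp add: occurs_at_def nth_append)
    next
      case False
      then have "x (j + int (length u) + int (i - length u)) = v ! (i - length u)"
        using b i False by (simp add: occurs_at_def del: of_nat_diff)
      then show ?thesis using False by (simp add: nth_append of_nat_diff)
    qed
  qed
  ultimately show ?thesis by blast
qed

text \<open>Position \<open>k\<close> falls into the image of exactly one letter of
  \<open>\<sigma> a\<close>. The chain of that letter, shifted by the length of what precedes its
  image, is continued upwards by \<open>a\<close>.\<close>

lemma word_chain:
  assumes "k < length ((subst_ext \<sigma> ^^ N) [a])"
  shows "\<exists>v s. v N = a \<and> s N = 0 \<and>
     (\<forall>m\<le>N. s m \<le> k \<and> k < s m + length ((subst_ext \<sigma> ^^ m) [v m])) \<and>
     (\<forall>m<N. \<exists>l r. \<sigma> (v (Suc m)) = l @ v m # r \<and> s m = s (Suc m) + length ((subst_ext \<sigma> ^^ m) l))"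
  using assms
proof (induction N arbitrary: a k)
  case 0
  then show ?case by (intro exI[of _ "\<lambda>_. a"] exI[of _ "\<lambda>_. 0"]) simp
next
  case (Suc N)
  let ?S = "subst_ext \<sigma>"
  have "k < length (concat (map (\<lambda>a. (?S ^^ N) [a]) (\<sigma> a)))"
    using Suc.prems unfolding subst_ext_pow_Suc_single by (simp only: subst_ext_pow_concat[symmetric])
  from concat_map_locate[OF this] obtain l b r where lbr: "\<sigma> a = l @ b # r"
    "length ((?S ^^ N) l) \<le> k" "k < length ((?S ^^ N) l) + length ((?S ^^ N) [b])"
    unfolding subst_ext_pow_concat[symmetric] by blast
  then have "k - length ((?S ^^ N) l) < length ((?S ^^ N) [b])" by simp
  from Suc.IH[OF this] obtain v s where vs: "v N = b" "s N = (0::nat)"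
    "\<And>m. m \<le> N \<Longrightarrow> s m \<le> k - length ((?S ^^ N) l) \<and> k - length ((?S ^^ N) l) < s m + length ((?S ^^ m) [v m])"
    "\<And>m. m < N \<Longrightarrow> \<exists>l r. \<sigma> (v (Suc m)) = l @ v m # r \<and> s m = s (Suc m) + length ((?S ^^ m) l)"
    by blast
  let ?v = "\<lambda>m. if m \<le> N then v m else a" and ?s = "\<lambda>m. if m \<le> N then s m + length ((?S ^^ N) l) else 0"
  show ?case
  proof (intro exI[of _ ?v] exI[of _ ?s] conjI allI impI)
    fix m assume m: "m \<le> Suc N"
    show "?s m \<le> k" 
      using vs(3)[of m] lbr(2) m by (cases "m \<le> N") auto
    show "k < ?s m + length ((?S ^^ m) [?v m])"
    proof (cases "m \<le> N")
      case True then show ?thesis using vs(3)[OF True] lbr(2) by simp linarith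
    next
      case False
      then have "m = Suc N" using m by simp
      then show ?thesis using Suc.prems by simp
    qed
  next
    fix m assume m: "m < Suc N"
    show "\<exists>l r. \<sigma> (?v (Suc m)) = l @ ?v m # r \<and> ?s m = ?s (Suc m) + length ((?S ^^ m) l)"
    proof (cases "m = N")
      case True
      then show ?thesis using lbr vs(1,2) by auto
    next
      case False
      then have "m < N" using m by simp
      from vs(4)[OF this] show ?thesis using \<open>m < N\<close> by auto
    qed
  qed simp_all
qed

text \<open>The starts of two blocks differ by the length of the image of a word under the lower
  power. This is why all displacements have the form
  \<open>length ((subst_ext \<sigma> ^^ m) w)\<close>.\<close>

lemma chain_link:
  fixes s :: "nat \<Rightarrow> nat"
  assumes link: "\<And>m. m < N \<Longrightarrow> \<exists>l r. \<sigma> (v (Suc m)) = l @ v m # r \<and>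
      s m = s (Suc m) + length ((subst_ext \<sigma> ^^ m) l)"
    and "m + d \<le> N"
  shows "\<exists>l r. (subst_ext \<sigma> ^^ d) [v (m + d)] = l @ v m # r \<and>
      s m = s (m + d) + length ((subst_ext \<sigma> ^^ m) l)"
  using assms(2)
proof (induction d)
  case 0
  show ?case by (intro exI[of _ "[]"]) auto
next
  case (Suc d)
  let ?S = "subst_ext \<sigma>"
  from Suc obtain l r where lr: "(?S ^^ d) [v (m + d)] = l @ v m # r"
    "s m = s (m + d) + length ((?S ^^ m) l)" by auto
  from link[of "m + d"] Suc.prems obtain l' r' where
    lr': "\<sigma> (v (Suc (m + d))) = l' @ v (m + d) # r'"
    "s (m + d) = s (Suc (m + d)) + length ((?S ^^ (m + d)) l')" by auto
  have "(?S ^^ Suc d) [v (m + Suc d)] = (?S ^^ d) (l' @ [v (m + d)] @ r')"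
    using lr'(1) by (simp only: subst_ext_pow_Suc_single) simp
  also have "\<dots> = ((?S ^^ d) l' @ l) @ v m # (r @ (?S ^^ d) r')"
    by (simp only: subst_ext_pow_append lr(1)) simp
  finally have "(?S ^^ Suc d) [v (m + Suc d)] = ((?S ^^ d) l' @ l) @ v m # (r @ (?S ^^ d) r')" .
  moreover have "s m = s (m + Suc d) + length ((?S ^^ m) ((?S ^^ d) l' @ l))"
    using lr(2) lr'(2) by (simp add: subst_ext_pow_add)
  ultimately show ?case by blast
qed

text \<open>A sufficiently long window of \<open>x\<close> around the origin is a factor of some
  iterated image of a letter, and the chain is taken there. Only levels up to \<open>n\<close> are
  kept: their blocks through the origin fit inside the window, so they can be read in
  \<open>x\<close> itself.\<close>

lemma point_chain:
  fixes \<sigma> :: "'a::finite \<Rightarrow> 'a list"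
  assumes x: "x \<in> subst_space \<sigma>" 
  shows "\<exists>v s. (\<forall>m\<le>n. occurs_at x (s m) ((subst_ext \<sigma> ^^ m) [v m]) \<and> s m \<le> 0 \<and>
            0 < s m + int (length ((subst_ext \<sigma> ^^ m) [v m]))) \<and>
          (\<forall>m d. m + d \<le> n \<longrightarrow> (\<exists>l r. (subst_ext \<sigma> ^^ d) [v (m + d)] = l @ v m # r \<and>
            s m = s (m + d) + int (length ((subst_ext \<sigma> ^^ m) l))))"
proof -
  let ?S = "subst_ext \<sigma>"
  \<comment> \<open>\<open>K\<close> exceeds no less than every block length of level at most
    \<open>n\<close>, so a block through the centre of the window from \<open>- K\<close> to
    \<open>K\<close> stays inside it. A word of length \<open>2 * K + 1\<close> also forces the
    level \<open>N\<close> below to be larger than \<open>n\<close>.\<close>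
  define K where "K = (\<Sum>m\<le>n. \<Sum>b\<in>UNIV. length ((?S ^^ m) [b]))"
  have K: "length ((?S ^^ m) [b]) \<le> K" if "m \<le> n" for m b
  proof -
    have "length ((?S ^^ m) [b]) \<le> (\<Sum>b\<in>UNIV. length ((?S ^^ m) [b]))"
      by (rule member_le_sum) auto
    also have "\<dots> \<le> K" unfolding K_def
      by (rule member_le_sum[of m "{..n}" "\<lambda>m. \<Sum>b\<in>UNIV. length ((?S ^^ m) [b])"]) (use that in auto)
    finally show ?thesis .
  qed
  have "map x [- int K..int K] \<in> subst_language \<sigma>"
    using x by (simp add: subst_space_def)
  then obtain a N p q where N: "(?S ^^ N) [a] = p @ map x [- int K..int K] @ q"
    by (auto simp: subst_language_def sublist_def)
  have len: "length (map x [- int K..int K]) = 2 * K + 1" by simp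
  have "n < N"
  proof (rule ccontr)
    assume "\<not> n < N"
    then have "length ((?S ^^ N) [a]) \<le> K" using K by simp
    then show False using N len by simp
  qed
  \<comment> \<open>The place in the long word of the letter that \<open>x\<close> has at the
    origin.\<close>
  define k where "k = length p + K"
  have "k < length ((?S ^^ N) [a])" using N len by (simp add: k_def)
  from word_chain[OF this] obtain v s where vs: "v N = a" "s N = (0::nat)"
    "\<And>m. m \<le> N \<Longrightarrow> s m \<le> k \<and> k < s m + length ((?S ^^ m) [v m])"
    "\<And>m. m < N \<Longrightarrow> \<exists>l r. \<sigma> (v (Suc m)) = l @ v m # r \<and> s m = s (Suc m) + length ((?S ^^ m) l)"
    by blast
  have link: "\<exists>l r. (?S ^^ d) [v (m + d)] = l @ v m # r \<and> s m = s (m + d) + length ((?S ^^ m) l)"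
    if "m + d \<le> N" for m d by (rule chain_link[of N, OF vs(4) that])
  have word: "x (int i - int k) = ((?S ^^ N) [a]) ! i" if "i \<ge> length p" "i < length p + 2 * K + 1" for i
  proof -
    have "((?S ^^ N) [a]) ! i = (map x [- int K..int K] @ q) ! (i - length p)"
      using that N by (simp add: nth_append)
    also have "\<dots> = map x [- int K..int K] ! (i - length p)"
      using that len by (auto simp add: nth_append simp del: length_map nth_map)
    also have "\<dots> = x (- int K + int (i - length p))"
      using that by (subst nth_map) (simp_all)
    also have "- int K + int (i - length p) = int i - int k" using that by (simp add: k_def)
    finally show ?thesis by simp
  qed
  show ?thesis
  proof (intro exI[of _ v] exI[of _ "\<lambda>m. int (s m) - int k"] conjI allI impI)
    fix m assume m: "m \<le> n"
    have eqN: "m + (N - m) = N" using m \<open>n < N\<close> by simp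
    from link[of m "N - m", unfolded eqN, OF order_refl] vs(1,2)
    obtain l r where lr: "(?S ^^ (N - m)) [a] = l @ v m # r" "s m = length ((?S ^^ m) l)"
      by auto
    have "(?S ^^ N) [a] = (?S ^^ m) ((?S ^^ (N - m)) [a])"
      using subst_ext_pow_add[of m "N - m" \<sigma> "[a]"] m \<open>n < N\<close> by simp
    also have "\<dots> = (?S ^^ m) (l @ [v m] @ r)" using lr(1) by simp
    also have "\<dots> = (?S ^^ m) l @ (?S ^^ m) [v m] @ (?S ^^ m) r" by (simp only: subst_ext_pow_append)
    finally have dec: "(?S ^^ N) [a] = (?S ^^ m) l @ (?S ^^ m) [v m] @ (?S ^^ m) r" .
    have b: "s m \<le> k" "k < s m + length ((?S ^^ m) [v m])" using vs(3)[of m] m \<open>n < N\<close> by auto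
    have Km: "length ((?S ^^ m) [v m]) \<le> K" using K m by simp
    show "occurs_at x (int (s m) - int k) ((?S ^^ m) [v m])"
      unfolding occurs_at_def
    proof (intro allI impI)
      fix i assume i: "i < length ((?S ^^ m) [v m])"
      have "x (int (s m + i) - int k) = ((?S ^^ N) [a]) ! (s m + i)"
        by (rule word) (use b Km i in \<open>auto simp: k_def\<close>)
      also have "\<dots> = ((?S ^^ m) [v m]) ! i"
        unfolding dec lr(2) using i by (simp add: nth_append)
      finally show "x (int (s m) - int k + int i) = ((?S ^^ m) [v m]) ! i" by (simp add: algebra_simps)
    qed
    show "int (s m) - int k \<le> 0" "0 < int (s m) - int k + int (length ((?S ^^ m) [v m]))"
      using b by auto
  next
    fix m d assume md: "m + d \<le> n"
    with link[of m d] \<open>n < N\<close> obtain l r where "(?S ^^ d) [v (m + d)] = l @ v m # r"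
      "s m = s (m + d) + length ((?S ^^ m) l)" by auto
    then show "\<exists>l r. (?S ^^ d) [v (m + d)] = l @ v m # r \<and>
       int (s m) - int k = int (s (m + d)) - int k + int (length ((?S ^^ m) l))" by auto
  qed
qed

section \<open>Letters with several copies in their own images\<close>

definition expanding_letter :: "('a \<Rightarrow> 'a list) \<Rightarrow> 'a \<Rightarrow> bool" where
  "expanding_letter \<sigma> y \<longleftrightarrow> (\<exists>k\<ge>1. count_list ((subst_ext \<sigma> ^^ k) [y]) y \<ge> 2)"

lemma count_list_subst_ext_pow_ge:
  "count_list w y * count_list ((subst_ext \<sigma> ^^ k) [y]) y \<le> count_list ((subst_ext \<sigma> ^^ k) w) y"
proof (induction w)
  case (Cons b w)
  have "count_list ((subst_ext \<sigma> ^^ k) (b # w)) y =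
    count_list ((subst_ext \<sigma> ^^ k) [b]) y + count_list ((subst_ext \<sigma> ^^ k) w) y"
    by (subst subst_ext_pow_Cons) simp
  then show ?case using Cons by (auto simp: algebra_simps)
qed simp

lemma expanding_power:
  assumes "count_list ((subst_ext \<sigma> ^^ k) [y]) y \<ge> 2" "t \<ge> 1"
  shows "count_list ((subst_ext \<sigma> ^^ (k * t)) [y]) y \<ge> 2"
  using assms(2)
proof (induction t rule: dec_induct)
  case (step t)
  have "2 * 2 \<le> count_list ((subst_ext \<sigma> ^^ (k * t)) [y]) y * count_list ((subst_ext \<sigma> ^^ k) [y]) y"
    by (rule mult_le_mono) (use step assms in auto)
  also have "\<dots> \<le> count_list ((subst_ext \<sigma> ^^ k) ((subst_ext \<sigma> ^^ (k * t)) [y])) y"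
    by (rule count_list_subst_ext_pow_ge)
  finally show ?case by (simp add: subst_ext_pow_add)
qed (use assms in simp)

text \<open>The product of the individual periods is a multiple of each of them. Within a row,
  levels are later compared at distances that are multiples of \<open>per\<close>, so an expanding
  letter that recurs there always brings a second copy of itself.\<close>

lemma uniform_expanding_period:
  fixes \<sigma> :: "'a::finite \<Rightarrow> 'a list"
  shows "\<exists>per. \<forall>y t. expanding_letter \<sigma> y \<longrightarrow> t \<ge> 1 \<longrightarrow> count_list ((subst_ext \<sigma> ^^ (per * t)) [y]) y \<ge> 2"
proof -
  have "\<forall>y. \<exists>k\<ge>1. expanding_letter \<sigma> y \<longrightarrow> count_list ((subst_ext \<sigma> ^^ k) [y]) y \<ge> 2"
    by (auto simp: expanding_letter_def)
  then obtain k where k: "\<And>y. k y \<ge> 1" "\<And>y. expanding_letter \<sigma> y \<Longrightarrow> count_list ((subst_ext \<sigma> ^^ k y) [y]) y \<ge> 2"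
    by metis
  define per where "per = (\<Prod>y\<in>UNIV. k y)"
  have "per \<ge> 1" unfolding per_def by (rule prod_ge_1) (use k(1) in auto)
  moreover have "count_list ((subst_ext \<sigma> ^^ (per * t)) [y]) y \<ge> 2"
    if "expanding_letter \<sigma> y" "t \<ge> 1" for y t
  proof -
    have "k y dvd per" unfolding per_def by (rule dvd_prodI) auto
    then obtain q where q: "per = k y * q" by blast
    then have "q * t \<ge> 1" using \<open>per \<ge> 1\<close> that by (cases "q = 0") auto
    then show ?thesis using expanding_power[OF k(2)[OF that(1)]] q by (simp add: mult.assoc)
  qed
  ultimately show ?thesis by blast
qed

lemma second_occurrence:
  assumes "count_list (l @ y # r) y \<ge> 2"
  shows "(\<exists>l' t. l = l' @ y # t) \<or> (\<exists>t r'. r = t @ y # r')"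
proof -
  have "y \<in> set l \<or> y \<in> set r"
    using assms count_notin[of y l] count_notin[of y r] by fastforce
  then show ?thesis by (meson split_list)
qed

text \<open>Either \<open>u\<close> sticks out of the block of level \<open>m 0\<close> that covers the origin; or it occurs again at
  a distance that is the length of the image of one of boundedly many words, since that block
  descends from two levels showing the same expanding letter; or two levels \<open>m i + a * per\<close> and
  \<open>m i' + a' * per\<close> show the same letter \<open>y\<close> that is not expanding, and the single occurrence of \<open>y\<close> in
  its own image leaves few positions for the larger block.\<close>

lemma block_alternatives:
  fixes \<sigma> :: "'a::finite \<Rightarrow> 'a list"
  assumes x: "x \<in> subst_space \<sigma>" and u: "occurs_at x 0 u"
    and per_all: "\<forall>y t. expanding_letter \<sigma> y \<longrightarrow> t \<ge> 1 \<longrightarrow> count_list ((subst_ext \<sigma> ^^ (per * t)) [y]) y \<ge> 2"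
    and A: "A = CARD('a)" and m_all: "\<forall>i i'. i < i' \<longrightarrow> m i + A * per < m i'"
    and C_all: "\<forall>y t. t \<le> A \<longrightarrow> length ((subst_ext \<sigma> ^^ (per * t)) [y]) \<le> C"
  shows "(\<exists>v j. j < length ((subst_ext \<sigma> ^^ m 0) [v]) \<and> length ((subst_ext \<sigma> ^^ m 0) [v]) < j + length u \<and>
             occurs_at x (- int j) ((subst_ext \<sigma> ^^ m 0) [v])) \<or>
    (\<exists>i a w. i \<le> A \<and> a \<le> A \<and> w \<noteq> [] \<and> length w \<le> C \<and>
       (occurs_at x (int (length ((subst_ext \<sigma> ^^ (m i + a * per)) w))) u \<or>
        occurs_at x (- int (length ((subst_ext \<sigma> ^^ (m i + a * per)) w))) u)) \<or>
    (\<exists>i i' a a' y j. i < i' \<and> i' \<le> A \<and> a \<le> A \<and> a' \<le> A \<and> j < length ((subst_ext \<sigma> ^^ (m i + a * per)) [y]) \<and>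
       occurs_at x (- int (j + length ((subst_ext \<sigma> ^^ (m i + a * per))
           (takeWhile (\<lambda>b. b \<noteq> y) ((subst_ext \<sigma> ^^ (m i' + a' * per - (m i + a * per))) [y])))))
         ((subst_ext \<sigma> ^^ (m i' + a' * per)) [y]))"
proof -
  note per = per_all[rule_format] and m = m_all[rule_format] and C = C_all[rule_format]
  let ?S = "subst_ext \<sigma>"
  define n where "n = m A + A * per"
  obtain v s where occ: "\<And>k. k \<le> n \<Longrightarrow> occurs_at x (s k) ((?S ^^ k) [v k]) \<and> s k \<le> 0 \<and>
            0 < s k + int (length ((?S ^^ k) [v k]))"
    and link: "\<And>k d. k + d \<le> n \<Longrightarrow> (\<exists>l r. (?S ^^ d) [v (k + d)] = l @ v k # r \<and>
            s k = s (k + d) + int (length ((?S ^^ k) l)))"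
    using point_chain[OF x, of n] by metis
  have mn: "m i + a * per \<le> n" if "i \<le> A" "a \<le> A" for i a
  proof -
    have "m i \<le> m A" using m[of i A] that by (cases "i = A") auto
    then show ?thesis unfolding n_def using that by (intro add_mono mult_le_mono) auto
  qed
  have pig: "\<exists>a b. a < b \<and> b \<le> A \<and> f a = f b" for f :: "nat \<Rightarrow> 'a"
  proof -
    have "\<not> inj_on f {..A}"
    proof
      assume "inj_on f {..A}"
      then have "card {..A} \<le> CARD('a)" by (metis card_image card_mono finite_class.finite_UNIV subset_UNIV)
      then show False by (simp add: A)
    qed
    then obtain a b where "a \<le> A" "b \<le> A" "a \<noteq> b" "f a = f b" by (auto simp: inj_on_def)
    then show ?thesis by (metis linorder_neqE_nat)
  qed
  \<comment> \<open>Row \<open>i\<close> consists of the \<open>A + 1\<close> levels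
    \<open>m i + a * per\<close> with \<open>a \<le> A\<close>, so one of the \<open>A\<close>
    letters recurs in it. If no recurring letter \<open>y i\<close> is expanding, the same count
    over the rows \<open>i \<le> A\<close> yields two rows with the same letter.\<close>
  have "\<forall>i. \<exists>a b. a < b \<and> b \<le> A \<and> v (m i + a * per) = v (m i + b * per)"
    using pig[of "\<lambda>a. v (m _ + a * per)"] by blast
  then obtain a b where ab: "\<And>i. a i < b i" "\<And>i. b i \<le> A" "\<And>i. v (m i + a i * per) = v (m i + b i * per)"
    by metis
  define y where "y = (\<lambda>i. v (m i + a i * per))"
  define L where "L = (\<lambda>i. m i + a i * per)"
  have aA: "a i \<le> A" for i using ab(1,2)[of i] by simp
  have Ln: "L i \<le> n" if "i \<le> A" for i unfolding L_def using mn that aA by blast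
  show ?thesis
  proof (cases "length ((?S ^^ m 0) [v (m 0)]) < nat (- s (m 0)) + length u")
    case True
    have "m 0 \<le> n" using mn[of 0 0] by simp
    from occ[OF this] show ?thesis using True
      by (intro disjI1 exI[of _ "v (m 0)"] exI[of _ "nat (- s (m 0))"]) auto
  next
    case inside: False
    show ?thesis
    proof (cases "\<exists>i\<le>A. expanding_letter \<sigma> (y i)")
      case True
      then obtain i where i: "i \<le> A" "expanding_letter \<sigma> (y i)" by blast
      define d where "d = b i - a i"
      have d: "1 \<le> d" "d \<le> A" using ab(1,2)[of i] by (auto simp: d_def)
      have Lb: "L i + per * d = m i + b i * per"
        using ab(1)[of i] by (simp add: L_def d_def algebra_simps diff_mult_distrib2)
      with link[of "L i" "per * d"] mn[OF i(1) ab(2)[of i]] ab(3)[of i] obtain l r where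
        lr: "(?S ^^ (per * d)) [y i] = l @ y i # r" 
        "s (L i) = s (L i + per * d) + int (length ((?S ^^ L i) l))"
        unfolding y_def L_def by auto
      have occ_big: "occurs_at x (s (L i + per * d)) ((?S ^^ (L i + per * d)) [y i])"
        using occ[OF mn[OF i(1) ab(2)[of i]]] ab(3)[of i] unfolding Lb y_def by simp
      then have occ_l: "occurs_at x (s (L i + per * d)) ((?S ^^ L i) (l @ y i # r))"
        by (simp add: subst_ext_pow_add lr(1))
      have len: "length (l @ y i # r) \<le> C" using C[OF d(2)] lr(1) by metis
      have m0: "m 0 \<le> L i" using m[of 0 i] unfolding L_def by (cases "i = 0") auto
      \<comment> \<open>The block of level \<open>m 0\<close> contains \<open>u\<close> entirely,
        and the block of level \<open>L i\<close> contains that block. So \<open>u\<close> sits in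
        the image of \<open>y i\<close> behind a prefix \<open>p\<close> that ends at the origin,
        and every other copy of this image carries a copy of \<open>u\<close> at the same
        place.\<close>
      obtain p q where pq: "(?S ^^ L i) [y i] = p @ u @ q" "s (L i) = - int (length p)"
      proof -
        obtain l0 r0 where l0: "(?S ^^ (L i - m 0)) [y i] = l0 @ v (m 0) # r0"
          "s (m 0) = s (L i) + int (length ((?S ^^ m 0) l0))"
          using link[of "m 0" "L i - m 0"] m0 Ln[OF i(1)] unfolding y_def L_def by auto
        have Seq: "(?S ^^ L i) [y i] = (?S ^^ m 0) (l0 @ [v (m 0)] @ r0)"
          using subst_ext_pow_add[of "m 0" "L i - m 0" \<sigma> "[y i]"] m0 l0(1) by simp
        define P where "P = nat (- s (L i))"
        have sL: "s (L i) \<le> 0" "occurs_at x (s (L i)) ((?S ^^ L i) [y i])"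
          using occ[OF Ln[OF i(1)]] unfolding y_def L_def by auto
        have bnd: "P + length u \<le> length ((?S ^^ L i) [y i])"
          unfolding Seq using inside l0(2) sL(1) occ[of "m 0"] mn[of 0 0]
          by (simp only: subst_ext_pow_append length_append) (simp add: P_def)
        have "take (length u) (drop P ((?S ^^ L i) [y i])) = u"
        proof (rule nth_equalityI)
          show "length (take (length u) (drop P ((?S ^^ L i) [y i]))) = length u" using bnd by simp
          fix k assume "k < length (take (length u) (drop P ((?S ^^ L i) [y i])))"
          then have k: "k < length u" by simp
          have "take (length u) (drop P ((?S ^^ L i) [y i])) ! k = ((?S ^^ L i) [y i]) ! (P + k)"
            using k bnd by simp
          also have "\<dots> = x (s (L i) + int (P + k))"
            using sL(2)[unfolded occurs_at_def, rule_format, of "P + k"] k bnd by simp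
          also have "s (L i) + int (P + k) = int k" using sL(1) by (simp add: P_def)
          also have "x (int k) = u ! k" using u k by (simp add: occurs_at_def)
          finally show "take (length u) (drop P ((?S ^^ L i) [y i])) ! k = u ! k" .
        qed
        moreover have "(?S ^^ L i) [y i] = take P ((?S ^^ L i) [y i]) @
            (take (length u) (drop P ((?S ^^ L i) [y i])) @ drop (length u) (drop P ((?S ^^ L i) [y i])))"
          by (simp only: append_take_drop_id)
        ultimately have "(?S ^^ L i) [y i] = take P ((?S ^^ L i) [y i]) @ u @ drop (length u) (drop P ((?S ^^ L i) [y i]))"
          by simp
        moreover have "s (L i) = - int (length (take P ((?S ^^ L i) [y i])))"
          using bnd sL(1) by (simp add: P_def)
        ultimately show ?thesis using that by blast
      qed
      have "count_list (l @ y i # r) (y i) \<ge> 2" using per[OF i(2) d(1)] lr(1) by simp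
      from second_occurrence[OF this] show ?thesis
      proof (elim disjE exE)
        \<comment> \<open>The second copy lies to the left: \<open>y i # t\<close> leads from it to
          the block of the origin. In the other case the same kind of word leads from the block of
          the origin to a copy on the right.\<close>
        fix l' t assume l: "l = l' @ y i # t"
        let ?D = "length ((?S ^^ L i) (y i # t))"
        have "occurs_at x (s (L i + per * d)) ((?S ^^ L i) (l' @ [y i] @ t @ y i # r))"
          using occ_l l by simp
        then have "occurs_at x (s (L i + per * d) + int (length ((?S ^^ L i) l'))) (p @ u @ q)"
          unfolding subst_ext_pow_append occurs_at_append pq(1) by blast
        then have "occurs_at x (s (L i + per * d) + int (length ((?S ^^ L i) l')) + int (length p)) u"
          unfolding occurs_at_append by blast
        moreover have "s (L i + per * d) + int (length ((?S ^^ L i) l')) + int (length p) = - int ?D"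
          using lr(2) pq(2) l by simp
        ultimately have "occurs_at x (- int ?D) u" by simp
        moreover have "length (y i # t) \<le> C" using len l by simp
        ultimately show ?thesis using i(1) aA[of i]
          by (intro disjI2 disjI1 exI[of _ i] exI[of _ "a i"] exI[of _ "y i # t"]) (auto simp: L_def)
      next
        fix t r' assume r: "r = t @ y i # r'"
        let ?D = "length ((?S ^^ L i) (y i # t))"
        have "occurs_at x (s (L i + per * d)) ((?S ^^ L i) (l @ (y i # t) @ [y i] @ r'))"
          using occ_l r by simp
        then have "occurs_at x (s (L i + per * d) + int (length ((?S ^^ L i) l)) + int ?D) (p @ u @ q)"
          unfolding subst_ext_pow_append occurs_at_append pq(1) by blast
        then have "occurs_at x (s (L i + per * d) + int (length ((?S ^^ L i) l)) + int ?D + int (length p)) u"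
          unfolding occurs_at_append by blast
        moreover have "s (L i + per * d) + int (length ((?S ^^ L i) l)) + int ?D + int (length p) = int ?D"
          using lr(2) pq(2) by simp
        ultimately have "occurs_at x (int ?D) u" by simp
        moreover have "length (y i # t) \<le> C" using len r by simp
        ultimately show ?thesis using i(1) aA[of i]
          by (intro disjI2 disjI1 exI[of _ i] exI[of _ "a i"] exI[of _ "y i # t"]) (auto simp: L_def)
      qed
    next
      case False
      obtain i i' where ii: "i < i'" "i' \<le> A" "y i = y i'" using pig[of y] by blast
      have nex: "\<not> expanding_letter \<sigma> (y i)" using False ii by auto
      have lt: "L i < L i'"
      proof -
        have "L i \<le> m i + A * per" unfolding L_def using aA[of i] by simp
        also have "\<dots> < m i'" using m ii by simp
        finally show ?thesis by (simp add: L_def)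
      qed
      obtain l r where lr: "(?S ^^ (L i' - L i)) [y i] = l @ y i # r"
        "s (L i) = s (L i') + int (length ((?S ^^ L i) l))"
        using link[of "L i" "L i' - L i"] lt Ln[OF ii(2)] ii(3) unfolding y_def L_def by auto
      have "count_list ((?S ^^ (L i' - L i)) [y i]) (y i) < 2"
        using nex lt unfolding expanding_letter_def
        by (metis One_nat_def Suc_leI linorder_not_le zero_less_diff)
      \<comment> \<open>Since \<open>y i\<close> occurs only once, the prefix \<open>l\<close> is a
        function of the letter and the two levels. The start of the large block is thereby known up
        to the position of the origin in the small one.\<close>
      then have "y i \<notin> set l" using lr(1) count_list_0_iff[of l "y i"] by simp
      then have tw: "takeWhile (\<lambda>c. c \<noteq> y i) ((?S ^^ (L i' - L i)) [y i]) = l"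
        unfolding lr(1) by (subst takeWhile_append2) auto
      have o: "occurs_at x (s (L i')) ((?S ^^ L i') [y i])"
        using occ[OF Ln[OF ii(2)]] ii(3) unfolding y_def L_def by auto
      have o': "s (L i) \<le> 0" "0 < s (L i) + int (length ((?S ^^ L i) [y i]))"
        using occ[OF Ln, of i] ii unfolding y_def L_def by auto
      have "s (L i') = - int (nat (- s (L i)) + length ((?S ^^ L i) l))"
        using lr(2) o'(1) by simp
      with o tw have "occurs_at x (- int (nat (- s (L i)) + length ((?S ^^ L i) (takeWhile (\<lambda>c. c \<noteq> y i) ((?S ^^ (L i' - L i)) [y i])))))
           ((?S ^^ L i') [y i])" by simp
      moreover have "nat (- s (L i)) < length ((?S ^^ L i) [y i])" using o' by simp
      ultimately show ?thesis using ii aA unfolding L_def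
        by (intro disjI2 exI[of _ i] exI[of _ i'] exI[of _ "a i"] exI[of _ "a i'"] exI[of _ "y i"]
             exI[of _ "nat (- s (m i + a i * per))"]) auto
    qed
  qed
qed

section \<open>Invariant measures of substitution subshifts\<close>

lemma left_shift_pow: "(left_shift ^^ n) x i = x (i + int n)"
  by (induction n arbitrary: i) (simp_all add: left_shift_def algebra_simps)

lemma topspace_subst_topology: "topspace (subst_topology \<sigma>) = subst_space \<sigma>"
  by (auto simp: subst_topology_def)

lemma openin_letter: "openin (subst_topology \<sigma>) {x \<in> subst_space \<sigma>. x i = a}"
proof -
  have "openin (product_topology (\<lambda>_::int. discrete_topology (UNIV::'a set)) UNIV) {x. x i = a}"
    using openin_continuous_map_preimage[OF continuous_map_product_projection,
        of i UNIV "\<lambda>_. discrete_topology (UNIV::'a set)" "{a}"] by simp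
  then have "openin (subst_topology \<sigma>) ({x. x i = a} \<inter> subst_space \<sigma>)"
    unfolding subst_topology_def by (rule openin_subtopology_Int)
  also have "{x. x i = a} \<inter> subst_space \<sigma> = {x \<in> subst_space \<sigma>. x i = a}" by blast
  finally show ?thesis .
qed

locale shift_invariant_measure =
  fixes \<sigma> :: "'a::finite \<Rightarrow> 'a list" and \<nu> :: "(int \<Rightarrow> 'a) measure"
  assumes aper: "aperiodic_subst \<sigma>"
    and growth: "\<And>a. filterlim (\<lambda>n. length ((subst_ext \<sigma> ^^ n) [a])) at_top sequentially"
    and prob: "prob_space \<nu>"
    and sets_nu: "sets \<nu> = sets (borel_of_top (subst_topology \<sigma>))"
    and inv: "preserves_measure \<nu> left_shift"
begin

sublocale prob_space \<nu> by (rule prob)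

lemma space_nu: "space \<nu> = subst_space \<sigma>"
  using sets_eq_imp_space_eq[OF sets_nu]
  by (simp add: borel_of_top_def space_measure_of_conv topspace_subst_topology)

lemma open_sets: "openin (subst_topology \<sigma>) U \<Longrightarrow> U \<in> sets \<nu>"
  unfolding sets_nu borel_of_top_def
  by (subst sets_measure_of) (auto dest: openin_subset)

definition cyl :: "int \<Rightarrow> 'a list \<Rightarrow> (int \<Rightarrow> 'a) set" where
  "cyl j w = {x \<in> subst_space \<sigma>. occurs_at x j w}"

lemma cyl_sets [measurable]: "cyl j w \<in> sets \<nu>"
proof -
  have "cyl j w = space \<nu> \<inter> (\<Inter>i<length w. {x \<in> subst_space \<sigma>. x (j + int i) = w ! i})"
    by (auto simp: cyl_def occurs_at_def space_nu)
  also have "\<dots> \<in> sets \<nu>"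
  proof (cases "length w = 0")
    case False
    then show ?thesis
      by (intro sets.Int sets.top sets.finite_INT open_sets openin_letter) auto
  qed simp
  finally show ?thesis .
qed

lemma shift_meas: "left_shift ^^ n \<in> measurable \<nu> \<nu>"
  using inv by (intro measurable_compose_n) (simp add: preserves_measure_def)

lemma shift_space: "x \<in> subst_space \<sigma> \<Longrightarrow> (left_shift ^^ n) x \<in> subst_space \<sigma>"
  using measurable_space[OF shift_meas] by (simp add: space_nu)

lemma measure_shift:
  assumes "A \<in> sets \<nu>"
  shows "measure \<nu> ((left_shift ^^ n) -` A \<inter> space \<nu>) = measure \<nu> A"
proof (induction n)
  case 0
  then show ?case using assms by (simp add: sets.Int_space_eq2)
next
  case (Suc n)
  have T: "left_shift \<in> measurable \<nu> \<nu>" "distr \<nu> \<nu> left_shift = \<nu>"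
    using inv by (auto simp: preserves_measure_def)
  let ?A = "(left_shift ^^ n) -` A \<inter> space \<nu>"
  have A: "?A \<in> sets \<nu>" using shift_meas assms by (rule measurable_sets)
  have "(left_shift ^^ Suc n) -` A \<inter> space \<nu> = left_shift -` ?A \<inter> space \<nu>"
    using measurable_space[OF T(1)] by (auto simp: funpow_Suc_right simp del: funpow.simps)
  also have "measure \<nu> \<dots> = measure (distr \<nu> \<nu> left_shift) ?A"
    by (rule measure_distr[symmetric, OF T(1) A])
  finally show ?case using Suc T(2) by (simp del: funpow.simps)
qed

lemma shift_cyl: "(left_shift ^^ n) -` cyl j w \<inter> space \<nu> = cyl (j + int n) w"
  using shift_space by (auto simp: cyl_def occurs_at_def left_shift_pow space_nu algebra_simps)

lemma measure_cyl: "measure \<nu> (cyl j w) = measure \<nu> (cyl 0 w)"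
proof (cases "j \<ge> 0")
  case True
  then show ?thesis using measure_shift[OF cyl_sets, of "nat j" 0 w] by (simp add: shift_cyl)
next
  case False
  then show ?thesis using measure_shift[OF cyl_sets, of "nat (- j)" j w] by (simp add: shift_cyl)
qed

text \<open>Mixing concerns preimages under positive powers, hence copies to the right. Shifting by
  \<open>D\<close> turns a copy on the left into one on the right.\<close>

lemma measure_two_cyl:
  "measure \<nu> (cyl (- int D) u \<inter> cyl 0 u) = measure \<nu> ((left_shift ^^ D) -` cyl 0 u \<inter> space \<nu> \<inter> cyl 0 u)"
proof -
  have "(left_shift ^^ D) -` (cyl (- int D) u \<inter> cyl 0 u) \<inter> space \<nu> =
     ((left_shift ^^ D) -` cyl (- int D) u \<inter> space \<nu>) \<inter> ((left_shift ^^ D) -` cyl 0 u \<inter> space \<nu>)"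
    by blast
  also have "\<dots> = ((left_shift ^^ D) -` cyl 0 u \<inter> space \<nu>) \<inter> cyl 0 u"
    by (simp only: shift_cyl) auto
  finally show ?thesis using measure_shift[of "cyl (- int D) u \<inter> cyl 0 u" D] by simp
qed

lemma shift_inj: "(left_shift ^^ n) x = (left_shift ^^ n) y \<Longrightarrow> x = y"
proof
  fix i assume "(left_shift ^^ n) x = (left_shift ^^ n) y"
  then have "(left_shift ^^ n) x (i - int n) = (left_shift ^^ n) y (i - int n)" by simp
  then show "x i = y i" by (simp add: left_shift_pow)
qed

section \<open>Points are null sets and long words are light\<close>

definition window :: "nat \<Rightarrow> (int \<Rightarrow> 'a) \<Rightarrow> (int \<Rightarrow> 'a) set" where
  "window n y = cyl (- int n) (map y [- int n..int n])"

lemma window_eq: "window n y = {x \<in> subst_space \<sigma>. \<forall>i. \<bar>i\<bar> \<le> int n \<longrightarrow> x i = y i}"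
proof -
  have "occurs_at x (- int n) (map y [- int n..int n]) \<longleftrightarrow> (\<forall>i. \<bar>i\<bar> \<le> int n \<longrightarrow> x i = y i)" for x
  proof
    assume h: "occurs_at x (- int n) (map y [- int n..int n])"
    show "\<forall>i. \<bar>i\<bar> \<le> int n \<longrightarrow> x i = y i"
    proof (intro allI impI)
      fix i :: int assume "\<bar>i\<bar> \<le> int n"
      then have "- int n + int (nat (i + int n)) = i" "nat (i + int n) < nat (2 * int n + 1)" by auto
      with h[unfolded occurs_at_def, rule_format, of "nat (i + int n)"] show "x i = y i" by simp
    qed
  qed (auto simp: occurs_at_def)
  then show ?thesis by (simp add: window_def cyl_def)
qed

lemma singleton_window: "y \<in> subst_space \<sigma> \<Longrightarrow> {y} = (\<Inter>n. window n y)"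
proof (intro Set.set_eqI iffI)
  fix x assume y: "y \<in> subst_space \<sigma>" and x: "x \<in> (\<Inter>n. window n y)"
  have "x i = y i" for i
  proof -
    have "x \<in> window (nat \<bar>i\<bar>) y" using x by blast
    then show ?thesis by (simp add: window_eq)
  qed
  then show "x \<in> {y}" by auto
qed (auto simp: window_eq)

text \<open>Without periodic points the orbit of \<open>y\<close> is infinite, and by invariance its
  points all have the same mass.\<close>

lemma measure_singleton:
  assumes y: "y \<in> subst_space \<sigma>"
  shows "{y} \<in> sets \<nu>" "measure \<nu> {y} = 0"
proof -
  have sing: "{z} \<in> sets \<nu>" if "z \<in> subst_space \<sigma>" for z
    unfolding singleton_window[OF that] window_def by measurable
  show "{y} \<in> sets \<nu>" using sing[OF y] .
  have orb: "measure \<nu> {(left_shift ^^ k) y} = measure \<nu> {y}" for k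
  proof -
    have "(left_shift ^^ k) -` {(left_shift ^^ k) y} \<inter> space \<nu> = {y}"
      using shift_inj y by (auto simp: space_nu)
    then show ?thesis using measure_shift[OF sing[OF shift_space[OF y]], of k k] by simp
  qed
  have inj: "inj (\<lambda>k. (left_shift ^^ k) y)"
  proof -
    have False if "i < j" "(left_shift ^^ i) y = (left_shift ^^ j) y" for i j
    proof -
      have "(left_shift ^^ j) y = (left_shift ^^ i) ((left_shift ^^ (j - i)) y)"
        using that(1) by (metis add_diff_inverse_nat funpow_add less_imp_not_less o_apply)
      then have "(left_shift ^^ (j - i)) y = y" using that(2) shift_inj by metis
      moreover have "1 \<le> j - i" using that(1) by simp
      ultimately show False using aper y unfolding aperiodic_subst_def by blast
    qed
    then show ?thesis by (metis (no_types, lifting) injI linorder_neqE_nat)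
  qed
  have "real n * measure \<nu> {y} \<le> 1" for n
  proof -
    have "real n * measure \<nu> {y} = (\<Sum>k<n. measure \<nu> {(left_shift ^^ k) y})" by (simp add: orb)
    also have "\<dots> = measure \<nu> (\<Union>k<n. {(left_shift ^^ k) y})"
      by (rule finite_measure_finite_Union[symmetric])
         (use sing[OF shift_space[OF y]] inj in \<open>auto simp: disjoint_family_on_def inj_def\<close>)
    also have "\<dots> \<le> 1" by (rule prob_le_1)
    finally show ?thesis .
  qed
  then have "\<not> measure \<nu> {y} > 0"
    by (metis less_le_not_le mult.commute reals_Archimedean3)
  then show "measure \<nu> {y} = 0" using measure_nonneg[of \<nu> "{y}"] by linarith
qed

text \<open>Were the sets \<open>?U n\<close> of points with heavy windows all nonempty, their intersection would have
  positive measure, and its points would be atoms, hence periodic.\<close>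

lemma long_words_light:
  assumes e: "\<epsilon> > 0"
  shows "\<exists>L. \<forall>w. length w \<ge> L \<longrightarrow> measure \<nu> (cyl 0 w) < \<epsilon>"
proof (rule ccontr)
  assume "\<not> ?thesis"
  then have ex: "\<exists>w. length w \<ge> L \<and> measure \<nu> (cyl 0 w) \<ge> \<epsilon>" for L by (meson not_le)
  let ?U = "\<lambda>n. {y \<in> subst_space \<sigma>. measure \<nu> (window n y) \<ge> \<epsilon>}"
  have U_sets: "?U n \<in> sets \<nu>" for n
  proof -
    have "?U n = (\<Union>w\<in>{w. length w = nat (2 * int n + 1) \<and> measure \<nu> (cyl (- int n) w) \<ge> \<epsilon>}. cyl (- int n) w)"
    proof (intro Set.set_eqI iffI)
      fix y assume y: "y \<in> ?U n"
      have "y \<in> window n y" using y by (simp add: window_eq)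
      then show "y \<in> (\<Union>w\<in>{w. length w = nat (2 * int n + 1) \<and> measure \<nu> (cyl (- int n) w) \<ge> \<epsilon>}. cyl (- int n) w)"
        using y unfolding window_def by (intro UN_I[of "map y [- int n..int n]"]) simp_all
    next
      fix y assume "y \<in> (\<Union>w\<in>{w. length w = nat (2 * int n + 1) \<and> measure \<nu> (cyl (- int n) w) \<ge> \<epsilon>}. cyl (- int n) w)"
      then obtain w where w: "length w = nat (2 * int n + 1)" "measure \<nu> (cyl (- int n) w) \<ge> \<epsilon>" "y \<in> cyl (- int n) w"
        by blast
      have "map y [- int n..int n] = w"
        by (rule nth_equalityI) (use w in \<open>auto simp: cyl_def occurs_at_def\<close>)
      then show "y \<in> ?U n" using w by (auto simp: window_def cyl_def)
    qed
    also have "\<dots> \<in> sets \<nu>"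
    proof (rule sets.finite_UN)
      show "finite {w :: 'a list. length w = nat (2 * int n + 1) \<and> measure \<nu> (cyl (- int n) w) \<ge> \<epsilon>}"
        by (rule finite_subset[OF _ finite_lists_length_eq[of UNIV "nat (2 * int n + 1)"]]) auto
    qed measurable
    finally show ?thesis .
  qed
  have U_ge: "measure \<nu> (?U n) \<ge> \<epsilon>" for n
  proof -
    \<comment> \<open>Invariance lets the heavy word start at \<open>- n\<close>, where it covers
      the window from \<open>- n\<close> to \<open>n\<close>. All points of its cylinder then share
      one window, which is at least as heavy as the word.\<close>
    obtain w where w: "length w \<ge> 2 * n + 1" "measure \<nu> (cyl 0 w) \<ge> \<epsilon>" using ex by blast
    then have w': "measure \<nu> (cyl (- int n) w) \<ge> \<epsilon>" by (subst measure_cyl)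
    have "cyl (- int n) w \<subseteq> ?U n"
    proof
      fix y assume y: "y \<in> cyl (- int n) w"
      have "cyl (- int n) w \<subseteq> window n y"
      proof
        fix x assume x: "x \<in> cyl (- int n) w"
        have "x i = y i" if "\<bar>i\<bar> \<le> int n" for i
        proof -
          have "nat (i + int n) < length w" using that w(1) by simp
          then have "x (- int n + int (nat (i + int n))) = y (- int n + int (nat (i + int n)))"
            using x y by (simp add: cyl_def occurs_at_def del: int_nat_eq)
          moreover have "- int n + int (nat (i + int n)) = i" using that by simp
          ultimately show ?thesis by metis
        qed
        then show "x \<in> window n y" using x by (simp add: window_eq cyl_def)
      qed
      then have "measure \<nu> (cyl (- int n) w) \<le> measure \<nu> (window n y)"
        by (intro finite_measure_mono) (auto simp: window_def)
      then show "y \<in> ?U n" using y w' by (simp add: cyl_def)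
    qed
    then have "measure \<nu> (cyl (- int n) w) \<le> measure \<nu> (?U n)"
      by (intro finite_measure_mono U_sets)
    then show ?thesis using w' by simp
  qed
  have win_dec: "window (Suc n) y \<subseteq> window n y" for n y by (auto simp: window_eq)
  have "decseq ?U"
  proof (rule decseq_SucI, rule subsetI)
    fix n y assume y: "y \<in> ?U (Suc n)"
    have "measure \<nu> (window (Suc n) y) \<le> measure \<nu> (window n y)"
      by (intro finite_measure_mono win_dec) (auto simp: window_def)
    then show "y \<in> ?U n" using y by auto
  qed
  then have "(\<lambda>n. measure \<nu> (?U n)) \<longlonglongrightarrow> measure \<nu> (\<Inter>n. ?U n)"
    using U_sets by (intro finite_Lim_measure_decseq) auto
  then have "measure \<nu> (\<Inter>n. ?U n) \<ge> \<epsilon>"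
    using U_ge by (intro LIMSEQ_le_const) auto
  then have "(\<Inter>n. ?U n) \<noteq> {}" using e by force
  then obtain y where y: "y \<in> subst_space \<sigma>" "\<And>n. measure \<nu> (window n y) \<ge> \<epsilon>" by auto
  have "(\<lambda>n. measure \<nu> (window n y)) \<longlonglongrightarrow> measure \<nu> (\<Inter>n. window n y)"
    using win_dec by (intro finite_Lim_measure_decseq decseq_SucI) (auto simp: window_def)
  then have "measure \<nu> {y} \<ge> \<epsilon>"
    unfolding singleton_window[OF y(1)] using y(2) by (intro LIMSEQ_le_const) auto
  then show False using measure_singleton(2)[OF y(1)] e by simp
qed

lemma length_growth: "\<exists>n0. \<forall>n\<ge>n0. \<forall>w. w \<noteq> [] \<longrightarrow> length ((subst_ext \<sigma> ^^ n) w) \<ge> L"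
proof -
  have "\<forall>\<^sub>F n in sequentially. \<forall>a. L \<le> length ((subst_ext \<sigma> ^^ n) [a])"
    by (rule eventually_all_finite) (use growth in \<open>simp add: filterlim_at_top\<close>)
  then obtain n0 where n0: "\<And>n a. n \<ge> n0 \<Longrightarrow> L \<le> length ((subst_ext \<sigma> ^^ n) [a])"
    by (auto simp: eventually_sequentially)
  have "L \<le> length ((subst_ext \<sigma> ^^ n) w)" if n: "n \<ge> n0" and w: "w \<noteq> []" for n w
  proof -
    obtain a v where "w = a # v" using w by (meson neq_Nil_conv)
    show ?thesis unfolding \<open>w = a # v\<close> subst_ext_pow_Cons[of n \<sigma> a v] using n0[OF n, of a] by simp
  qed
  then show ?thesis by blast
qed

lemma measure_UN_le:
  assumes "finite I" "\<And>i. i \<in> I \<Longrightarrow> A i \<in> sets \<nu>" "\<And>i. i \<in> I \<Longrightarrow> measure \<nu> (A i) \<le> c"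
    "card I \<le> k" "0 \<le> c"
  shows "measure \<nu> (\<Union>i\<in>I. A i) \<le> real k * c"
proof -
  have "measure \<nu> (\<Union>i\<in>I. A i) \<le> (\<Sum>i\<in>I. measure \<nu> (A i))"
    using assms by (intro finite_measure_subadditive_finite) auto
  also have "\<dots> \<le> real (card I) * c" using assms by (intro sum_bounded_above) auto
  also have "\<dots> \<le> real k * c" using assms by (intro mult_right_mono) auto
  finally show ?thesis .
qed

end

section \<open>Failure of mixing for substitution subshifts\<close>

context shift_invariant_measure begin

theorem not_strongly_mixing: "\<not> strongly_mixing \<nu> left_shift"
proof
  assume mix: "strongly_mixing \<nu> left_shift"
  let ?S = "subst_ext \<sigma>"
  obtain per where
    per: "\<And>y t. expanding_letter \<sigma> y \<Longrightarrow> t \<ge> 1 \<Longrightarrow> count_list ((?S ^^ (per * t)) [y]) y \<ge> 2"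
    using uniform_expanding_period[of \<sigma>] by blast
  define A where "A = CARD('a)"
  have A1: "A \<ge> 1" unfolding A_def using zero_less_card_finite[where 'a='a] by linarith
  \<comment> \<open>A word joining two copies of a letter inside its image over at most
    \<open>A\<close> periods has length at most \<open>C\<close>, so it belongs to the finite set
    \<open>W\<close>.\<close>
  define C where "C = (\<Sum>t\<le>A. \<Sum>y\<in>UNIV. length ((?S ^^ (per * t)) [y]))"
  have C: "length ((?S ^^ (per * t)) [y]) \<le> C" if "t \<le> A" for t y
  proof -
    have "length ((?S ^^ (per * t)) [y]) \<le> (\<Sum>y\<in>UNIV. length ((?S ^^ (per * t)) [y]))"
      by (rule member_le_sum) auto
    also have "\<dots> \<le> C" unfolding C_def
      by (rule member_le_sum[of t "{..A}" "\<lambda>t. \<Sum>y\<in>UNIV. length ((?S ^^ (per * t)) [y])"]) (use that in auto)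
    finally show ?thesis .
  qed
  define W where "W = {w :: 'a list. length w \<le> C}"
  have finW: "finite W" unfolding W_def using finite_lists_length_le[of "UNIV :: 'a set" C] by simp
  \<comment> \<open>A bound for the number of triples \<open>(i, a, w)\<close> that produce a
    displacement; it does not involve \<open>u\<close>.\<close>
  define M where "M = (A + 1) * ((A + 1) * card W)"
  have "[] \<in> W" by (simp add: W_def)
  then have "card W > 0" using finW card_gt_0_iff by blast
  then have M: "M > 0" by (simp add: M_def)
  \<comment> \<open>The factor 16: overlaps to the right and to the left contribute at most
    \<open>2 * M * e * e\<close> each, and their sum must stay below \<open>e / 4\<close>.\<close>
  obtain L where L: "\<And>w. length w \<ge> L \<Longrightarrow> prob (cyl 0 w) < 1 / (16 * real M)"
    using long_words_light[of "1 / (16 * real M)"] M by auto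
  obtain u where u: "length u = L" "prob (cyl 0 u) > 0"
  proof -
    have "\<exists>u. length u = L \<and> prob (cyl 0 u) > 0"
    proof (rule ccontr)
      assume none: "\<not> ?thesis"
      have z: "prob (cyl 0 w) \<le> 0" if "length w = L" for w
        using none that not_le by blast
      have fin: "finite {w :: 'a list. length w = L}"
        using finite_lists_length_eq[of "UNIV :: 'a set" L] by simp
      have "prob (\<Union>w\<in>{w. length w = L}. cyl 0 w) \<le> real (card {w :: 'a list. length w = L}) * 0"
        by (rule measure_UN_le) (use fin z in auto)
      moreover have "(\<Union>w\<in>{w. length w = L}. cyl 0 w) = space \<nu>"
      proof (rule subset_antisym; rule subsetI)
        fix x assume "x \<in> space \<nu>"
        then have "x \<in> cyl 0 (map (\<lambda>i. x (int i)) [0..<L])"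
          by (auto simp: cyl_def space_nu occurs_at_def)
        then show "x \<in> (\<Union>w\<in>{w. length w = L}. cyl 0 w)"
          by (intro UN_I[of "map (\<lambda>i. x (int i)) [0..<L]"]) auto
      qed (auto simp: cyl_def space_nu)
      ultimately show False using prob_space by simp
    qed
    then show ?thesis using that by blast
  qed
  define e where "e = prob (cyl 0 u)"
  have e: "0 < e" "e < 1 / (16 * real M)" using u L[of u] by (auto simp: e_def)
  have "(\<lambda>n. prob ((left_shift ^^ n) -` cyl 0 u \<inter> space \<nu> \<inter> cyl 0 u)) \<longlonglongrightarrow> e * e"
    using mix cyl_sets unfolding strongly_mixing_def e_def by blast
  then have "\<forall>\<^sub>F n in sequentially. prob ((left_shift ^^ n) -` cyl 0 u \<inter> space \<nu> \<inter> cyl 0 u) < 2 * (e * e)"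
    using e(1) by (intro order_tendstoD(2)) auto
  then obtain D0 where D0: "\<And>n. n \<ge> D0 \<Longrightarrow> prob ((left_shift ^^ n) -` cyl 0 u \<inter> space \<nu> \<inter> cyl 0 u) < 2 * (e * e)"
    by (auto simp: eventually_sequentially)
  \<comment> \<open>Chosen so that the points whose block of level \<open>m 0\<close> does not
    contain \<open>u\<close> have measure at most \<open>e / 4\<close>: there are \<open>A\<close>
    letters and at most \<open>length u\<close> positions for each. The summand 1 keeps the
    denominator positive.\<close>
  define \<epsilon>1 where "\<epsilon>1 = e / (4 * (real A * real (length u + 1)))"
  have "\<epsilon>1 > 0" using e A1 by (simp add: \<epsilon>1_def)
  then obtain L1 where L1: "\<And>w. length w \<ge> L1 \<Longrightarrow> prob (cyl 0 w) < \<epsilon>1" using long_words_light by blast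
  \<comment> \<open>From level \<open>n0\<close> on, images are long enough both to have cylinders
    lighter than \<open>\<epsilon>1\<close> and to give displacements of at least
    \<open>D0\<close>.\<close>
  obtain n0 where n0: "\<And>n w. n \<ge> n0 \<Longrightarrow> w \<noteq> [] \<Longrightarrow> length ((?S ^^ n) w) \<ge> max L1 D0"
    using length_growth by metis
  \<comment> \<open>A bound for the number of tuples \<open>(i, i', a, a', y)\<close>: four indices
    up to \<open>A\<close> and a letter.\<close>
  define K where "K = (A + 1) * ((A + 1) * ((A + 1) * ((A + 1) * A)))"
  define \<epsilon>2 where "\<epsilon>2 = e / (4 * real K)"
  have "K > 0" unfolding K_def using A1 by simp
  then have K0: "real K > 0" by simp
  then have \<epsilon>2: "\<epsilon>2 > 0" using e by (simp add: \<epsilon>2_def)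
  \<comment> \<open>This makes the levels sparse. The lengths of all blocks up to level
    \<open>k + A * per\<close> are bounded by some \<open>R\<close>, and beyond a suitable
    \<open>k'\<close> blocks weigh less than \<open>\<epsilon>2 / R\<close>. Confining the origin to
    a small block inside a large one then costs at most \<open>\<epsilon>2\<close> per
    tuple.\<close>
  have "\<exists>k'. k + A * per < k' \<and> (\<forall>n\<le>k + A * per. \<forall>y. \<forall>n'\<ge>k'.
          real (length ((?S ^^ n) [y])) * prob (cyl 0 ((?S ^^ n') [y])) \<le> \<epsilon>2)" for k
  proof -
    define R where "R = (\<Sum>n\<le>k + A * per. \<Sum>y\<in>UNIV. length ((?S ^^ n) [y])) + 1"
    have R: "length ((?S ^^ n) [y]) \<le> R" if "n \<le> k + A * per" for n y
    proof -
      have "length ((?S ^^ n) [y]) \<le> (\<Sum>y\<in>UNIV. length ((?S ^^ n) [y]))"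
        by (rule member_le_sum) auto
      also have "\<dots> \<le> (\<Sum>n\<le>k + A * per. \<Sum>y\<in>UNIV. length ((?S ^^ n) [y]))"
        by (rule member_le_sum[of n "{..k + A * per}" "\<lambda>n. \<Sum>y\<in>UNIV. length ((?S ^^ n) [y])"]) (use that in auto)
      finally show ?thesis by (simp add: R_def)
    qed
    have "R > 0" by (simp add: R_def)
    then obtain L2 where L2: "\<And>w. length w \<ge> L2 \<Longrightarrow> prob (cyl 0 w) < \<epsilon>2 / real R"
      using long_words_light[of "\<epsilon>2 / real R"] \<epsilon>2 by auto
    obtain n2 where n2: "\<And>n w. n \<ge> n2 \<Longrightarrow> w \<noteq> [] \<Longrightarrow> length ((?S ^^ n) w) \<ge> L2"
      using length_growth by metis
    have "real (length ((?S ^^ n) [y])) * prob (cyl 0 ((?S ^^ n') [y])) \<le> \<epsilon>2"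
      if "n \<le> k + A * per" "n' \<ge> max n2 (k + A * per + 1)" for n y n'
    proof -
      have "prob (cyl 0 ((?S ^^ n') [y])) \<le> \<epsilon>2 / real R"
        using L2[OF n2[of n' "[y]"]] that by simp
      then have "real (length ((?S ^^ n) [y])) * prob (cyl 0 ((?S ^^ n') [y])) \<le> real R * (\<epsilon>2 / real R)"
        using R[OF that(1)] by (intro mult_mono) auto
      then show ?thesis using \<open>R > 0\<close> by simp
    qed
    then show ?thesis by (intro exI[of _ "max n2 (k + A * per + 1)"]) auto
  qed
  then obtain f where f: "\<And>k. k + A * per < f k" "\<And>k n y n'. n \<le> k + A * per \<Longrightarrow> n' \<ge> f k \<Longrightarrow>
          real (length ((?S ^^ n) [y])) * prob (cyl 0 ((?S ^^ n') [y])) \<le> \<epsilon>2"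
    by metis
  define m where "m i = (f ^^ i) n0" for i
  have m0: "m 0 = n0" and mS: "m (Suc i) = f (m i)" for i by (simp_all add: m_def)
  have mmono: "m i \<le> m i'" if "i \<le> i'" for i i'
    using that
  proof (induction i' rule: dec_induct)
    case (step i')
    then show ?case using f(1)[of "m i'"] by (simp add: mS)
  qed simp
  have mlt: "m i + A * per < m i'" if "i < i'" for i i'
    using f(1)[of "m i"] mmono[of "Suc i" i'] that by (simp add: mS)
  have small: "real (length ((?S ^^ n) [y])) * prob (cyl 0 ((?S ^^ n') [y])) \<le> \<epsilon>2"
    if "i < i'" "n \<le> m i + A * per" "n' \<ge> m i'" for i i' n n' y
    using f(2)[OF that(2)] mmono[of "Suc i" i'] that by (simp add: mS)
  \<comment> \<open>The four covering sets match the alternatives for a point of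
    \<open>cyl 0 u\<close>: \<open>O1\<close> when \<open>u\<close> sticks out of its block,
    \<open>O2\<close> and \<open>O2'\<close> for a copy on the right or on the left,
    \<open>O3\<close> when the origin is confined.\<close>
  define O1 where "O1 = (\<Union>v. \<Union>j\<in>{j. j < length ((?S ^^ m 0) [v]) \<and> length ((?S ^^ m 0) [v]) < j + length u}.
       cyl (- int j) ((?S ^^ m 0) [v]))"
  define DD where "DD = (\<lambda>(i, a, w). length ((?S ^^ (m i + a * per)) w))"
  define I1 where "I1 = {..A} \<times> {..A} \<times> (W - {[]})"
  define O2 where "O2 = (\<Union>t\<in>I1. (left_shift ^^ DD t) -` cyl 0 u \<inter> space \<nu> \<inter> cyl 0 u)"
  define O2' where "O2' = (\<Union>t\<in>I1. cyl (- int (DD t)) u \<inter> cyl 0 u)"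
  define I2 where "I2 = {(i, i', a, a', y :: 'a). i < i' \<and> i' \<le> A \<and> a \<le> A \<and> a' \<le> A}"
  define off where "off = (\<lambda>(i, i', a, a', y). length ((?S ^^ (m i + a * per))
           (takeWhile (\<lambda>b. b \<noteq> y) ((?S ^^ (m i' + a' * per - (m i + a * per))) [y]))))"
  define O3 where "O3 = (\<Union>t\<in>I2. case t of (i, i', a, a', y) \<Rightarrow> (\<Union>j<length ((?S ^^ (m i + a * per)) [y]).
       cyl (- int (j + off t)) ((?S ^^ (m i' + a' * per)) [y])))"
  have m_ge: "m i + a * per \<ge> n0" for i a using mmono[of 0 i] m0 by simp
  have cover: "cyl 0 u \<subseteq> O1 \<union> (O2 \<union> (O2' \<union> O3))"
  proof
    fix x assume x: "x \<in> cyl 0 u"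
    then have xs: "x \<in> subst_space \<sigma>" "occurs_at x 0 u" by (auto simp: cyl_def)
    have "\<forall>y t. expanding_letter \<sigma> y \<longrightarrow> t \<ge> 1 \<longrightarrow> count_list ((?S ^^ (per * t)) [y]) y \<ge> 2"
      "\<forall>i i'. i < i' \<longrightarrow> m i + A * per < m i'"
      "\<forall>y t. t \<le> A \<longrightarrow> length ((?S ^^ (per * t)) [y]) \<le> C"
      using per mlt C by blast+
    from block_alternatives[OF xs this(1) A_def this(2,3)]
    show "x \<in> O1 \<union> (O2 \<union> (O2' \<union> O3))"
    proof (elim disjE exE conjE)
      fix v j assume "j < length ((?S ^^ m 0) [v])" "length ((?S ^^ m 0) [v]) < j + length u"
        "occurs_at x (- int j) ((?S ^^ m 0) [v])"
      then have "x \<in> O1" unfolding O1_def using xs(1)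
        by (intro UN_I[of v] UN_I[of j]) (auto simp: cyl_def)
      then show ?thesis by simp
    next
      fix i a w assume h: "i \<le> A" "a \<le> A" "w \<noteq> []" "length w \<le> C"
        "occurs_at x (int (length ((?S ^^ (m i + a * per)) w))) u"
      then have "x \<in> O2" unfolding O2_def shift_cyl using x xs
        by (intro UN_I[of "(i, a, w)"]) (auto simp: cyl_def I1_def DD_def W_def)
      then show ?thesis by simp
    next
      fix i a w assume h: "i \<le> A" "a \<le> A" "w \<noteq> []" "length w \<le> C"
        "occurs_at x (- int (length ((?S ^^ (m i + a * per)) w))) u"
      then have "x \<in> O2'" unfolding O2'_def using x xs
        by (intro UN_I[of "(i, a, w)"]) (auto simp: cyl_def I1_def DD_def W_def)
      then show ?thesis by simp
    next
      fix i i' a a' y j assume h: "i < i'" "i' \<le> A" "a \<le> A" "a' \<le> A"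
        "j < length ((?S ^^ (m i + a * per)) [y])"
        "occurs_at x (- int (j + length ((?S ^^ (m i + a * per))
           (takeWhile (\<lambda>b. b \<noteq> y) ((?S ^^ (m i' + a' * per - (m i + a * per))) [y])))))
         ((?S ^^ (m i' + a' * per)) [y])"
      have "x \<in> O3" unfolding O3_def 
        by (rule UN_I[of "(i, i', a, a', y)"])
          (use xs(1) h in \<open>auto simp: I2_def cyl_def off_def simp del: of_nat_add\<close>)
      then show ?thesis by simp
    qed
  qed
  have O1_sets: "O1 \<in> sets \<nu>" and O1: "prob O1 \<le> e / 4"
  proof -
    have fin: "finite {j. j < l \<and> l < j + length u}" and crd: "card {j. j < l \<and> l < j + length u} \<le> length u" for l
    proof -
      have "{j. j < l \<and> l < j + length u} \<subseteq> {l - length u..<l}" by auto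
      from card_mono[OF _ this] finite_subset[OF this]
      show "finite {j. j < l \<and> l < j + length u}" "card {j. j < l \<and> l < j + length u} \<le> length u" by auto
    qed
    show "O1 \<in> sets \<nu>" unfolding O1_def using fin by (intro sets.finite_UN) auto
    have "prob O1 \<le> real A * (real (length u) * \<epsilon>1)"
      unfolding O1_def
    proof (intro measure_UN_le sets.finite_UN cyl_sets)
      fix v j assume "j \<in> {j. j < length ((?S ^^ m 0) [v]) \<and> length ((?S ^^ m 0) [v]) < j + length u}"
      show "prob (cyl (- int j) ((?S ^^ m 0) [v])) \<le> \<epsilon>1"
        using L1[of "(?S ^^ m 0) [v]"] n0[of "m 0" "[v]"] m0 by (subst measure_cyl) simp
    qed (use fin crd \<open>\<epsilon>1 > 0\<close> in \<open>auto simp: A_def\<close>)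
    also have "\<dots> \<le> real A * (real (length u + 1) * \<epsilon>1)"
      using \<open>\<epsilon>1 > 0\<close> by (intro mult_left_mono mult_right_mono) auto
    also have "\<dots> = real A * real (length u + 1) * \<epsilon>1" by (simp only: mult.assoc)
    also have "b * (e / (4 * b)) = e / 4" if "b > 0" for b using that by simp
    then have "real A * real (length u + 1) * \<epsilon>1 = e / 4" unfolding \<epsilon>1_def using A1 by force
    finally show "prob O1 \<le> e / 4" .
  qed
  have I1_sub: "I1 \<subseteq> {..A} \<times> {..A} \<times> W" by (auto simp: I1_def)
  have finI1: "finite I1" "card I1 \<le> M"
    using finW finite_subset[OF I1_sub] card_mono[OF _ I1_sub] by (auto simp: M_def card_cartesian_product)
  have DD: "DD t \<ge> D0" if "t \<in> I1" for t
    using that n0[OF m_ge] by (auto simp: I1_def DD_def)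
  have shift_sets: "(left_shift ^^ n) -` cyl 0 u \<inter> space \<nu> \<inter> cyl 0 u \<in> sets \<nu>" for n
    by (simp add: shift_cyl)
  have O2_sets: "O2 \<in> sets \<nu>"
    unfolding O2_def by (rule sets.finite_UN) (use finI1 shift_sets in blast)+
  have O2'_sets: "O2' \<in> sets \<nu>"
    unfolding O2'_def by (rule sets.finite_UN) (use finI1 cyl_sets in blast)+
  have O2: "prob O2 \<le> real M * (2 * (e * e))" unfolding O2_def
    by (rule measure_UN_le) (use finI1 shift_sets D0[OF DD] e in \<open>auto intro: less_imp_le\<close>)
  have O2': "prob O2' \<le> real M * (2 * (e * e))" unfolding O2'_def
    by (rule measure_UN_le) (use finI1 D0[OF DD] e in \<open>auto simp: measure_two_cyl intro: less_imp_le\<close>)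
  have I2_sub: "I2 \<subseteq> {..A} \<times> {..A} \<times> {..A} \<times> {..A} \<times> UNIV" by (auto simp: I2_def)
  have finI2: "finite I2" "card I2 \<le> K"
    using finite_subset[OF I2_sub] card_mono[OF _ I2_sub]
    by (auto simp: K_def A_def card_cartesian_product)
  have O3_sets: "O3 \<in> sets \<nu>" unfolding O3_def using finI2
    by (intro sets.finite_UN) (auto split: prod.split)
  have O3: "prob O3 \<le> real K * \<epsilon>2" unfolding O3_def
  proof (rule measure_UN_le)
    fix t assume t: "t \<in> I2"
    obtain i i' a a' y where teq: "t = (i, i', a, a', y)" by (metis prod_cases5)
    have h: "i < i'" "a \<le> A" using t by (auto simp: teq I2_def)
    let ?len = "length ((?S ^^ (m i + a * per)) [y])"
    have "prob (\<Union>j<?len. cyl (- int (j + off t)) ((?S ^^ (m i' + a' * per)) [y]))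
      \<le> real ?len * prob (cyl 0 ((?S ^^ (m i' + a' * per)) [y]))"
    proof (rule measure_UN_le)
      fix j
      show "prob (cyl (- int (j + off t)) ((?S ^^ (m i' + a' * per)) [y]))
          \<le> prob (cyl 0 ((?S ^^ (m i' + a' * per)) [y]))"
        by (rule eq_refl, rule measure_cyl)
    qed auto
    also have "\<dots> \<le> \<epsilon>2"
      by (rule small[OF h(1)]) (use h in \<open>auto intro: mult_le_mono1\<close>)
    finally show "prob (case t of (i, i', a, a', y) \<Rightarrow> (\<Union>j<length ((?S ^^ (m i + a * per)) [y]).
       cyl (- int (j + off t)) ((?S ^^ (m i' + a' * per)) [y]))) \<le> \<epsilon>2" by (simp add: teq)
  qed (use finI2 \<epsilon>2 in \<open>auto split: prod.split\<close>)
  have "e \<le> prob (O1 \<union> (O2 \<union> (O2' \<union> O3)))" unfolding e_def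
    using cover O1_sets O2_sets O2'_sets O3_sets by (intro finite_measure_mono) auto
  also have "\<dots> \<le> prob O1 + (prob O2 + (prob O2' + prob O3))"
    using measure_Un_le[of O1 \<nu> "O2 \<union> (O2' \<union> O3)"] measure_Un_le[of O2 \<nu> "O2' \<union> O3"]
      measure_Un_le[of O2' \<nu> O3] O1_sets O2_sets O2'_sets O3_sets by simp
  also have "\<dots> \<le> e / 4 + (real M * (2 * (e * e)) + (real M * (2 * (e * e)) + e / 4))"
  proof -
    have "real K * \<epsilon>2 = e / 4" using K0 by (simp add: \<epsilon>2_def)
    then show ?thesis using O1 O2 O2' O3 by linarith
  qed
  finally have "e \<le> e / 2 + 4 * (real M * e) * e" by (simp add: algebra_simps)
  moreover have "real M * e < 1 / 16" using e M by (simp add: field_simps)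
  then have "4 * (real M * e) * e < e / 4" using e(1) by simp
  ultimately show False using e(1) by linarith
qed

end

section \<open>Ordered diagrams and the Vershik map\<close>

lemma linear_order_on_ex_least:
  assumes lo: "linear_order_on A r" and fin: "finite S" and ne: "S \<noteq> {}" and sub: "S \<subseteq> A"
  shows "\<exists>m\<in>S. \<forall>f\<in>S. (m, f) \<in> r"
  using fin ne sub
proof (induction S rule: finite_ne_induct)
  case (singleton x)
  then show ?case using lo
    by (auto simp: linear_order_on_def partial_order_on_def preorder_on_def refl_on_def)
next
  case (insert x S)
  then obtain m where m: "m \<in> S" "\<forall>f\<in>S. (m, f) \<in> r" by auto
  have tr: "trans r" and refl: "refl_on A r" and tot: "total_on A r"
    using lo by (auto simp: linear_order_on_def partial_order_on_def preorder_on_def)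
  have "(x, x) \<in> r" using refl insert.prems by (auto simp: refl_on_def)
  show ?case
  proof (cases "(m, x) \<in> r")
    case True then show ?thesis using m by auto
  next
    case False
    moreover have "x \<in> A" "m \<in> A" "x \<noteq> m" using insert.prems insert.hyps m(1) by auto
    ultimately have xm: "(x, m) \<in> r" using tot unfolding total_on_def by blast
    then have "\<forall>f\<in>S. (x, f) \<in> r" using m(2) transD[OF tr xm] by blast
    then show ?thesis using \<open>(x, x) \<in> r\<close> by auto
  qed
qed

locale ordered_bratteli =
  fixes B :: "('v, 'e) bratteli"
  assumes ordered: "ordered_diagram B"
begin

lemma finite_edg: "n \<ge> 1 \<Longrightarrow> finite (edg B n)"
  using ordered by (auto simp: ordered_diagram_def bratteli_diagram_def)

lemma finite_edges_into: "finite (edges_into B (Suc n) v)"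
  using finite_edg[of "Suc n"] by (auto simp: edges_into_def)

lemma edg_rng: "e \<in> edg B (Suc n) \<Longrightarrow> rng B (Suc n) e \<in> vtx B (Suc n)"
  and edg_src: "e \<in> edg B (Suc n) \<Longrightarrow> src B (Suc n) e \<in> vtx B n"
  using ordered unfolding ordered_diagram_def bratteli_diagram_def
  by (metis One_nat_def Suc_leI diff_Suc_1 imageI zero_less_Suc)+

lemma edges_into_ne: "v \<in> vtx B (Suc n) \<Longrightarrow> edges_into B (Suc n) v \<noteq> {}"
  using ordered by (auto simp: ordered_diagram_def bratteli_diagram_def)

lemma edges_from_ne: "v \<in> vtx B n \<Longrightarrow> \<exists>e\<in>edg B (Suc n). src B (Suc n) e = v"
proof -
  assume "v \<in> vtx B n"
  then have "edges_from B n v \<noteq> {}"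
    using ordered unfolding ordered_diagram_def bratteli_diagram_def by blast
  then show ?thesis by (auto simp: edges_from_def)
qed

lemma lin: "v \<in> vtx B (Suc n) \<Longrightarrow> linear_order_on (edges_into B (Suc n) v) (edge_ord B (Suc n) v)"
  using ordered by (auto simp: ordered_diagram_def)

lemma ord_trans:
  "v \<in> vtx B (Suc n) \<Longrightarrow> (e, f) \<in> edge_ord B (Suc n) v \<Longrightarrow> (f, g) \<in> edge_ord B (Suc n) v \<Longrightarrow>
     (e, g) \<in> edge_ord B (Suc n) v"
  using lin[of v n] unfolding linear_order_on_def partial_order_on_def preorder_on_def by (blast dest: transD)

lemma ord_antisym:
  "v \<in> vtx B (Suc n) \<Longrightarrow> (e, f) \<in> edge_ord B (Suc n) v \<Longrightarrow> (f, e) \<in> edge_ord B (Suc n) v \<Longrightarrow> e = f"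
  using lin[of v n] unfolding linear_order_on_def partial_order_on_def by (blast dest: antisymD)

lemma ord_total:
  "v \<in> vtx B (Suc n) \<Longrightarrow> e \<in> edges_into B (Suc n) v \<Longrightarrow> f \<in> edges_into B (Suc n) v \<Longrightarrow> e \<noteq> f \<Longrightarrow>
     (e, f) \<in> edge_ord B (Suc n) v \<or> (f, e) \<in> edge_ord B (Suc n) v"
  using lin[of v n] unfolding linear_order_on_def total_on_def by blast

lemma ord_refl:
  "v \<in> vtx B (Suc n) \<Longrightarrow> e \<in> edges_into B (Suc n) v \<Longrightarrow> (e, e) \<in> edge_ord B (Suc n) v"
  using lin[of v n] unfolding linear_order_on_def partial_order_on_def preorder_on_def
  by (auto simp: refl_on_def)

lemma ord_least:
  assumes "v \<in> vtx B (Suc n)" "S \<noteq> {}" "S \<subseteq> edges_into B (Suc n) v"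
  shows "\<exists>m\<in>S. \<forall>f\<in>S. (m, f) \<in> edge_ord B (Suc n) v"
  by (rule linear_order_on_ex_least[OF lin[OF assms(1)] finite_subset[OF assms(3) finite_edges_into] assms(2,3)])

lemma ord_greatest:
  assumes "v \<in> vtx B (Suc n)" "S \<noteq> {}" "S \<subseteq> edges_into B (Suc n) v"
  shows "\<exists>m\<in>S. \<forall>f\<in>S. (f, m) \<in> edge_ord B (Suc n) v"
proof -
  have "linear_order_on (edges_into B (Suc n) v) ((edge_ord B (Suc n) v)\<inverse>)"
    using lin[OF assms(1)] by simp
  from linear_order_on_ex_least[OF this finite_subset[OF assms(3) finite_edges_into] assms(2,3)]
  show ?thesis by simp
qed

lemma inf_pathD:
  assumes "x \<in> inf_paths B"
  shows "x i \<in> edg B (Suc i)" "rng B (Suc i) (x i) = src B (Suc (Suc i)) (x (Suc i))"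
    "src B (Suc i) (x i) \<in> vtx B i" "rng B (Suc i) (x i) \<in> vtx B (Suc i)"
    "x i \<in> edges_into B (Suc i) (rng B (Suc i) (x i))"
  using assms edg_src[of "x i" i] edg_rng[of "x i" i] by (auto simp: inf_paths_def edges_into_def)

section \<open>Completing tails to infinite paths\<close>

definition tail_path :: "nat \<Rightarrow> (nat \<Rightarrow> 'e) \<Rightarrow> bool" where
  "tail_path n z \<longleftrightarrow> (\<forall>i\<ge>n. z i \<in> edg B (Suc i) \<and> rng B (Suc i) (z i) = src B (Suc (Suc i)) (z (Suc i)))"

lemma inf_path_tail: "x \<in> inf_paths B \<Longrightarrow> tail_path n x"
  by (simp add: inf_paths_def tail_path_def)

text \<open>Edges are chosen backwards from level \<open>n\<close>, each one ending at the source of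
  the edge after it. Applied with minimal and with maximal edges as \<open>P\<close>.\<close>

lemma completion:
  assumes P: "\<And>n v. v \<in> vtx B (Suc n) \<Longrightarrow> \<exists>f\<in>edges_into B (Suc n) v. P (Suc n) f"
    and "tail_path n z"
  shows "\<exists>y\<in>inf_paths B. (\<forall>i\<ge>n. y i = z i) \<and> (\<forall>i<n. P (Suc i) (y i))"
  using assms(2)
proof (induction n arbitrary: z)
  case 0
  then show ?case by (auto simp: tail_path_def inf_paths_def)
next
  case (Suc n)
  have "src B (Suc (Suc n)) (z (Suc n)) \<in> vtx B (Suc n)"
    using Suc.prems edg_src[of "z (Suc n)" "Suc n"] by (auto simp: tail_path_def)
  from P[OF this] obtain f where f: "f \<in> edges_into B (Suc n) (src B (Suc (Suc n)) (z (Suc n)))" "P (Suc n) f"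
    by blast
  have "tail_path n (z(n := f))"
    unfolding tail_path_def
  proof (intro allI impI)
    fix i assume "n \<le> i"
    show "(z(n := f)) i \<in> edg B (Suc i) \<and>
         rng B (Suc i) ((z(n := f)) i) = src B (Suc (Suc i)) ((z(n := f)) (Suc i))"
      using Suc.prems f(1) \<open>n \<le> i\<close> by (cases "i = n") (auto simp: tail_path_def edges_into_def)
  qed
  from Suc.IH[OF this] obtain y where y: "y \<in> inf_paths B" "\<forall>i\<ge>n. y i = (z(n := f)) i" "\<forall>i<n. P (Suc i) (y i)"
    by blast
  have "\<forall>i\<ge>Suc n. y i = z i" using y(2) by auto
  moreover have "\<forall>i<Suc n. P (Suc i) (y i)" using y(2,3) f(2) by (auto simp: less_Suc_eq)
  ultimately show ?case using y(1) by blast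
qed

lemma ex_min_edge: "v \<in> vtx B (Suc n) \<Longrightarrow> \<exists>f\<in>edges_into B (Suc n) v. min_edge B (Suc n) f"
  using ord_least[of v n "edges_into B (Suc n) v"] edges_into_ne[of v n]
  by (auto simp: min_edge_def edges_into_def)

lemma ex_max_edge: "v \<in> vtx B (Suc n) \<Longrightarrow> \<exists>f\<in>edges_into B (Suc n) v. max_edge B (Suc n) f"
  using ord_greatest[of v n "edges_into B (Suc n) v"] edges_into_ne[of v n]
  by (auto simp: max_edge_def edges_into_def)

lemma min_completion:
  "tail_path n z \<Longrightarrow> \<exists>y\<in>inf_paths B. (\<forall>i\<ge>n. y i = z i) \<and> (\<forall>i<n. min_edge B (Suc i) (y i))"
  by (rule completion[OF ex_min_edge])

lemma max_completion:
  "tail_path n z \<Longrightarrow> \<exists>y\<in>inf_paths B. (\<forall>i\<ge>n. y i = z i) \<and> (\<forall>i<n. max_edge B (Suc i) (y i))"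
  by (rule completion[OF ex_max_edge])

lemma ex_tail_path:
  assumes "v \<in> vtx B n"
  shows "\<exists>z. tail_path n z \<and> src B (Suc n) (z n) = v"
proof -
  have "\<exists>f. \<forall>k. (f k \<in> edg B (Suc (n + k)) \<and> (k = 0 \<longrightarrow> src B (Suc n) (f k) = v)) \<and>
      rng B (Suc (n + k)) (f k) = src B (Suc (Suc (n + k))) (f (Suc k))"
  proof (rule dependent_nat_choice)
    show "\<exists>x. x \<in> edg B (Suc (n + 0)) \<and> ((0::nat) = 0 \<longrightarrow> src B (Suc n) x = v)"
      using edges_from_ne[OF assms] by auto
  next
    fix x k assume "x \<in> edg B (Suc (n + k)) \<and> (k = 0 \<longrightarrow> src B (Suc n) x = v)"
    then show "\<exists>y. (y \<in> edg B (Suc (n + Suc k)) \<and> (Suc k = 0 \<longrightarrow> src B (Suc n) y = v)) \<and>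
       rng B (Suc (n + k)) x = src B (Suc (Suc (n + k))) y"
      using edges_from_ne[OF edg_rng] by fastforce
  qed
  then obtain f where f: "\<And>k. f k \<in> edg B (Suc (n + k))" "src B (Suc n) (f 0) = v"
    "\<And>k. rng B (Suc (n + k)) (f k) = src B (Suc (Suc (n + k))) (f (Suc k))" by blast
  have "tail_path n (\<lambda>i. f (i - n))"
    unfolding tail_path_def
  proof (intro allI impI)
    fix i assume "n \<le> i"
    then show "f (i - n) \<in> edg B (Suc i) \<and>
       rng B (Suc i) (f (i - n)) = src B (Suc (Suc i)) (f (Suc i - n))"
      using f(1)[of "i - n"] f(3)[of "i - n"] by (simp add: Suc_diff_le)
  qed
  then show ?thesis using f(2) by (intro exI[of _ "\<lambda>i. f (i - n)"]) simp
qed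

lemma ex_path_through:
  assumes "v \<in> vtx B n"
  shows "\<exists>x\<in>inf_paths B. src B (Suc n) (x n) = v"
proof -
  obtain z where z: "tail_path n z" "src B (Suc n) (z n) = v" using ex_tail_path[OF assms] by blast
  obtain y where "y \<in> inf_paths B" "\<forall>i\<ge>n. y i = z i" using min_completion[OF z(1)] by blast
  then show ?thesis using z(2) by (intro bexI[of _ y]) auto
qed

section \<open>Heights of vertices and positions of finite paths\<close>

primrec hgt :: "nat \<Rightarrow> 'v \<Rightarrow> nat" where
  "hgt 0 v = 1"
| "hgt (Suc n) v = (\<Sum>f\<in>edges_into B (Suc n) v. hgt n (src B (Suc n) f))"

definition below :: "nat \<Rightarrow> 'e \<Rightarrow> 'e set" where
  "below n e = {f \<in> edges_into B n (rng B n e). (f, e) \<in> edge_ord B n (rng B n e) \<and> f \<noteq> e}"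

text \<open>\<open>hgt n v\<close> is the number of paths from the root to a vertex \<open>v\<close>
  of level \<open>n\<close>. So this counts the paths to the range of \<open>e\<close> whose last
  edge is smaller than \<open>e\<close>; the paths through \<open>e\<close> occupy the positions
  directly after them.\<close>

definition jump :: "nat \<Rightarrow> 'e \<Rightarrow> nat" where
  "jump n e = (\<Sum>f\<in>below (Suc n) e. hgt n (src B (Suc n) f))"

text \<open>The number of paths from the root that end in the same vertex as the first \<open>n\<close> edges of \<open>x\<close>
  and precede them in the order in which the last differing edge decides.\<close>

definition pos :: "nat \<Rightarrow> (nat \<Rightarrow> 'e) \<Rightarrow> nat" where
  "pos n x = (\<Sum>i<n. jump i (x i))"

lemma finite_below: "finite (below (Suc n) e)"
  using finite_edges_into[of n] by (auto simp: below_def)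

lemma jump_insert:
  "(\<Sum>f\<in>insert e (below (Suc n) e). hgt n (src B (Suc n) f)) = hgt n (src B (Suc n) e) + jump n e"
  unfolding jump_def by (subst sum.insert) (use finite_below in \<open>auto simp: below_def\<close>)

lemma jump_hgt_le:
  assumes "e \<in> edges_into B (Suc n) v"
  shows "hgt n (src B (Suc n) e) + jump n e \<le> hgt (Suc n) v"
  unfolding jump_insert[symmetric] hgt.simps
  by (rule sum_mono2) (use assms finite_edges_into in \<open>auto simp: below_def edges_into_def\<close>)

lemma jump_max:
  assumes "max_edge B (Suc n) e"
  shows "hgt n (src B (Suc n) e) + jump n e = hgt (Suc n) (rng B (Suc n) e)"
proof -
  have "insert e (below (Suc n) e) = edges_into B (Suc n) (rng B (Suc n) e)"
    using assms by (auto simp: max_edge_def below_def edges_into_def)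
  then show ?thesis unfolding jump_insert[symmetric] hgt.simps by simp
qed

lemma jump_min:
  assumes "min_edge B (Suc n) e"
  shows "jump n e = 0"
proof -
  have "e \<in> edg B (Suc n)" using assms by (simp add: min_edge_def)
  then have "below (Suc n) e = {}"
    using assms ord_antisym[OF edg_rng] by (fastforce simp: min_edge_def below_def)
  then show ?thesis by (simp add: jump_def)
qed

lemma jump_less:
  assumes e: "e \<in> edg B (Suc n)" and f: "f \<in> edg B (Suc n)" and r: "rng B (Suc n) e = rng B (Suc n) f"
    and o: "(e, f) \<in> edge_ord B (Suc n) (rng B (Suc n) f)" and ne: "e \<noteq> f"
  shows "hgt n (src B (Suc n) e) + jump n e \<le> jump n f"
proof -
  let ?v = "rng B (Suc n) f"
  have v: "?v \<in> vtx B (Suc n)" using edg_rng[OF f] .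
  have "insert e (below (Suc n) e) \<subseteq> below (Suc n) f"
  proof
    fix g assume "g \<in> insert e (below (Suc n) e)"
    then consider "g = e" | "g \<in> below (Suc n) e" by blast
    then show "g \<in> below (Suc n) f"
    proof cases
      case 1
      then show ?thesis using e o ne r by (auto simp: below_def edges_into_def)
    next
      case 2
      then have g: "g \<in> edges_into B (Suc n) ?v" "(g, e) \<in> edge_ord B (Suc n) ?v" "g \<noteq> e"
        using r by (auto simp: below_def)
      have "(g, f) \<in> edge_ord B (Suc n) ?v" using ord_trans[OF v g(2) o] .
      moreover have "g \<noteq> f" using ord_antisym[OF v g(2)] g(3) o by blast
      ultimately show ?thesis using g(1) by (simp add: below_def)
    qed
  qed
  then show ?thesis unfolding jump_insert[symmetric] unfolding jump_def
    by (rule sum_mono2[OF finite_below]) simp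
qed

lemma jump_succ:
  assumes e: "e \<in> edg B (Suc n)" and s: "succ_edge B (Suc n) e f"
  shows "jump n f = hgt n (src B (Suc n) e) + jump n e"
    "f \<in> edg B (Suc n)" "rng B (Suc n) f = rng B (Suc n) e"
proof -
  let ?v = "rng B (Suc n) e"
  have v: "?v \<in> vtx B (Suc n)" using edg_rng[OF e] .
  have f: "f \<in> edges_into B (Suc n) ?v" "(e, f) \<in> edge_ord B (Suc n) ?v" "f \<noteq> e"
    and least: "\<And>g. g \<in> edges_into B (Suc n) ?v \<Longrightarrow> (e, g) \<in> edge_ord B (Suc n) ?v \<Longrightarrow> g \<noteq> e \<Longrightarrow>
       (f, g) \<in> edge_ord B (Suc n) ?v"
    using s by (auto simp: succ_edge_def Let_def)
  show fe: "f \<in> edg B (Suc n)" and r: "rng B (Suc n) f = ?v" using f(1) by (auto simp: edges_into_def)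
  have "below (Suc n) f \<subseteq> insert e (below (Suc n) e)"
  proof
    fix g assume "g \<in> below (Suc n) f"
    then have g: "g \<in> edges_into B (Suc n) ?v" "(g, f) \<in> edge_ord B (Suc n) ?v" "g \<noteq> f"
      using r by (auto simp: below_def)
    have "e \<in> edges_into B (Suc n) ?v" using e by (simp add: edges_into_def)
    have "g = e \<or> (g, e) \<in> edge_ord B (Suc n) ?v"
    proof (rule ccontr)
      assume h: "\<not> ?thesis"
      then have "(e, g) \<in> edge_ord B (Suc n) ?v"
        using ord_total[OF v g(1) \<open>e \<in> edges_into B (Suc n) ?v\<close>] by blast
      then have "(f, g) \<in> edge_ord B (Suc n) ?v" using least[OF g(1)] h by blast
      then show False using ord_antisym[OF v g(2)] g(3) by blast
    qed
    then show "g \<in> insert e (below (Suc n) e)" using g(1) by (auto simp: below_def)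
  qed
  then have "jump n f \<le> hgt n (src B (Suc n) e) + jump n e"
    unfolding jump_insert[symmetric] unfolding jump_def
    by (intro sum_mono2) (use finite_below in auto)
  moreover have "hgt n (src B (Suc n) e) + jump n e \<le> jump n f"
    using jump_less[OF e fe] r f by simp
  ultimately show "jump n f = hgt n (src B (Suc n) e) + jump n e" by simp
qed

lemma pos_Suc: "pos (Suc n) x = pos n x + jump n (x n)"
  by (simp add: pos_def)

lemma pos_less:
  assumes "x \<in> inf_paths B"
  shows "pos n x < hgt n (src B (Suc n) (x n))"
proof (induction n)
  case (Suc n)
  have "pos (Suc n) x < hgt n (src B (Suc n) (x n)) + jump n (x n)" using Suc by (simp add: pos_Suc)
  also have "\<dots> \<le> hgt (Suc n) (rng B (Suc n) (x n))"
    by (rule jump_hgt_le) (rule inf_pathD(5)[OF assms])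
  finally show ?case by (simp add: inf_pathD(2)[OF assms] del: hgt.simps)
qed (simp add: pos_def)

text \<open>Paths into one vertex through different last edges occupy disjoint intervals of
  positions. The position therefore determines the last edge, and by induction the remaining
  ones.\<close>

lemma pos_inj:
  assumes x: "x \<in> inf_paths B" and y: "y \<in> inf_paths B"
    and "src B (Suc n) (x n) = src B (Suc n) (y n)" "pos n x = pos n y"
  shows "\<forall>i<n. x i = y i"
  using assms(3,4)
proof (induction n)
  case (Suc n)
  have less: False
    if x: "x \<in> inf_paths B" and y: "y \<in> inf_paths B" and "pos (Suc n) x = pos (Suc n) y"
      and "rng B (Suc n) (x n) = rng B (Suc n) (y n)"
      and "(x n, y n) \<in> edge_ord B (Suc n) (rng B (Suc n) (y n))" "x n \<noteq> y n" for x y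
  proof -
    have "pos (Suc n) x < hgt n (src B (Suc n) (x n)) + jump n (x n)"
      using pos_less[OF x, of n] by (simp add: pos_Suc)
    also have "\<dots> \<le> jump n (y n)"
      using jump_less[of "x n" n "y n"] that inf_pathD(1)[OF x, of n] inf_pathD(1)[OF y, of n] by simp
    also have "\<dots> \<le> pos (Suc n) y" by (simp add: pos_Suc)
    finally show False using that by simp
  qed
  have r: "rng B (Suc n) (x n) = rng B (Suc n) (y n)"
    using Suc.prems by (simp add: inf_pathD(2)[OF x] inf_pathD(2)[OF y])
  have "x n = y n"
  proof (rule ccontr)
    assume ne: "x n \<noteq> y n"
    from ord_total[OF inf_pathD(4)[OF x, of n] inf_pathD(5)[OF x, of n], of "y n"] inf_pathD(5)[OF y, of n] r ne
    show False using less[OF x y] less[OF y x] Suc.prems r by auto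
  qed
  moreover from this have "\<forall>i<n. x i = y i" using Suc by (simp add: pos_Suc)
  ultimately show ?case by (simp add: less_Suc_eq)
qed simp

lemma pos_min: "\<forall>i<n. min_edge B (Suc i) (x i) \<Longrightarrow> pos n x = 0"
  by (simp add: pos_def jump_min)

text \<open>The distance \<open>hgt - pos\<close> to the top does not change along maximal edges,
  since nothing is added above. At the root it equals 1, which gives the position of a maximal
  prefix.\<close>

lemma pos_max_from:
  assumes x: "x \<in> inf_paths B" and "m \<le> n" "\<forall>i. m \<le> i \<and> i < n \<longrightarrow> max_edge B (Suc i) (x i)"
  shows "pos n x + hgt m (src B (Suc m) (x m)) = pos m x + hgt n (src B (Suc n) (x n))"
  using assms(2,3)
proof (induction n rule: dec_induct)
  case (step n)
  have "hgt n (src B (Suc n) (x n)) + jump n (x n) = hgt (Suc n) (src B (Suc (Suc n)) (x (Suc n)))"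
    using jump_max[of n "x n"] step inf_pathD(2)[OF x, of n] by (simp del: hgt.simps)
  then show ?case using step by (simp add: pos_Suc del: hgt.simps)
qed simp

lemma pos_max:
  assumes "x \<in> inf_paths B" "\<forall>i<n. max_edge B (Suc i) (x i)"
  shows "pos n x + 1 = hgt n (src B (Suc n) (x n))"
  using pos_max_from[OF assms(1), of 0 n] assms(2) by (simp add: pos_def)

section \<open>The Vershik map raises positions by one\<close>

definition vershik_image :: "nat \<Rightarrow> (nat \<Rightarrow> 'e) \<Rightarrow> (nat \<Rightarrow> 'e) \<Rightarrow> bool" where
  "vershik_image k x y \<longleftrightarrow> y \<in> inf_paths B \<and> (\<forall>i<k. min_edge B (Suc i) (y i)) \<and>
     succ_edge B (Suc k) (x k) (y k) \<and> (\<forall>i>k. y i = x i)"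

text \<open>The successor edge is unique by antisymmetry, and a prefix of minimal edges has position
  0, so its end vertex determines it. This justifies the definite description in
  \<open>vershik\<close>.\<close>

lemma vershik_image_unique:
  assumes x: "x \<in> inf_paths B" and y: "vershik_image k x y" and z: "vershik_image k x z"
  shows "y = z"
proof -
  note Y = y[unfolded vershik_image_def] and Z = z[unfolded vershik_image_def]
  have "y k = z k"
  proof -
    have v: "rng B (Suc k) (x k) \<in> vtx B (Suc k)" using inf_pathD(4)[OF x] .
    have "succ_edge B (Suc k) (x k) (y k)" "succ_edge B (Suc k) (x k) (z k)" using Y Z by auto
    then show ?thesis unfolding succ_edge_def Let_def using ord_antisym[OF v] by blast
  qed
  moreover have "\<forall>i<k. y i = z i"
    by (rule pos_inj) (use Y Z \<open>y k = z k\<close> pos_min in auto)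
  ultimately show ?thesis using Y Z by (metis ext linorder_neqE_nat)
qed

lemma vershik_image_ex:
  assumes x: "x \<in> inf_paths B" and k: "\<not> max_edge B (Suc k) (x k)"
  shows "\<exists>y. vershik_image k x y"
proof -
  let ?v = "rng B (Suc k) (x k)"
  let ?S = "{f \<in> edges_into B (Suc k) ?v. (x k, f) \<in> edge_ord B (Suc k) ?v \<and> f \<noteq> x k}"
  have v: "?v \<in> vtx B (Suc k)" using inf_pathD(4)[OF x] .
  obtain f where f: "f \<in> edges_into B (Suc k) ?v" "(f, x k) \<notin> edge_ord B (Suc k) ?v"
    using k inf_pathD(1)[OF x, of k] by (auto simp: max_edge_def)
  then have "f \<in> ?S"
    using ord_total[OF v f(1) inf_pathD(5)[OF x]] ord_refl[OF v f(1)] by auto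
  then obtain g where g: "g \<in> ?S" "\<forall>f\<in>?S. (g, f) \<in> edge_ord B (Suc k) ?v"
    using ord_least[OF v, of ?S] by blast
  then have succ: "succ_edge B (Suc k) (x k) g" unfolding succ_edge_def Let_def by blast
  have "tail_path k (x(k := g))"
    unfolding tail_path_def
  proof (intro allI impI)
    fix i assume "k \<le> i"
    show "(x(k := g)) i \<in> edg B (Suc i) \<and>
         rng B (Suc i) ((x(k := g)) i) = src B (Suc (Suc i)) ((x(k := g)) (Suc i))"
      using inf_pathD(1,2)[OF x, of i] g(1) \<open>k \<le> i\<close> by (auto simp: edges_into_def)
  qed
  from min_completion[OF this] obtain y where "y \<in> inf_paths B" "\<forall>i\<ge>k. y i = (x(k := g)) i"
    "\<forall>i<k. min_edge B (Suc i) (y i)" by blast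
  then have "vershik_image k x y" unfolding vershik_image_def using succ by auto
  then show ?thesis by blast
qed

lemma vershik_eq:
  assumes x: "x \<in> inf_paths B" and k: "\<not> max_edge B (Suc k) (x k)" "\<forall>i<k. max_edge B (Suc i) (x i)"
    and y: "vershik_image k x y"
  shows "vershik B x = y"
proof -
  have L: "(LEAST k. \<not> max_edge B (Suc k) (x k)) = k"
  proof (rule Least_equality)
    fix j assume "\<not> max_edge B (Suc j) (x j)"
    then show "k \<le> j" using k(2) linorder_not_less by blast
  qed (rule k(1))
  show ?thesis unfolding vershik_def L Let_def vershik_image_def[symmetric]
    by (rule the_equality, rule y, rule vershik_image_unique[OF x _ y])
qed

lemma vershik_image_vershik:
  assumes x: "x \<in> inf_paths B" and n: "\<not> max_edge B (Suc n) (x n)"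
  shows "\<exists>k\<le>n. \<not> max_edge B (Suc k) (x k) \<and> (\<forall>i<k. max_edge B (Suc i) (x i)) \<and> vershik_image k x (vershik B x)"
proof -
  define k where "k = (LEAST k. \<not> max_edge B (Suc k) (x k))"
  have k: "\<not> max_edge B (Suc k) (x k)" unfolding k_def by (rule LeastI[of _ n]) (rule n)
  have k': "\<forall>i<k. max_edge B (Suc i) (x i)"
  proof (intro allI impI)
    fix i assume "i < k"
    then show "max_edge B (Suc i) (x i)" unfolding k_def by (blast dest: not_less_Least)
  qed
  have "k \<le> n" unfolding k_def by (rule Least_le) (rule n)
  moreover obtain y where y: "vershik_image k x y" using vershik_image_ex[OF x k] by blast
  moreover have "vershik B x = y" using vershik_eq[OF x k k' y] .
  ultimately show ?thesis using k k' by (intro exI[of _ k]) simp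
qed

text \<open>If the position is not the last one, the prefix is not maximal and the first non-maximal
  edge has an index \<open>k < n\<close>. The maximal prefix below \<open>k\<close> has position
  \<open>h - 1\<close>, with \<open>h\<close> the height of its end vertex, and is reset to position
  0; the successor edge contributes \<open>h\<close> more than before. The net gain is 1.\<close>

lemma vershik_step:
  assumes x: "x \<in> inf_paths B" and n: "pos n x + 1 < hgt n (src B (Suc n) (x n))"
  shows "vershik B x \<in> inf_paths B" "\<forall>i\<ge>n. vershik B x i = x i" "pos n (vershik B x) = pos n x + 1"
proof -
  obtain m where m: "m < n" "\<not> max_edge B (Suc m) (x m)" using pos_max[OF x, of n] n by force
  from vershik_image_vershik[OF x m(2)] obtain k where k: "k \<le> m" "\<forall>i<k. max_edge B (Suc i) (x i)"
    "vershik_image k x (vershik B x)" by blast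
  define y where "y = vershik B x"
  have y: "y \<in> inf_paths B" "\<forall>i<k. min_edge B (Suc i) (y i)" "succ_edge B (Suc k) (x k) (y k)" "\<forall>i>k. y i = x i"
    using k(3) by (auto simp: vershik_image_def y_def)
  have "pos j y = pos j x + 1" if "Suc k \<le> j" for j
    using that
  proof (induction j rule: dec_induct)
    case base
    have "pos (Suc k) y = hgt k (src B (Suc k) (x k)) + jump k (x k)"
      using pos_min[OF y(2)] jump_succ(1)[OF inf_pathD(1)[OF x] y(3)] by (simp add: pos_Suc)
    also have "\<dots> = pos (Suc k) x + 1" using pos_max[OF x k(2)] by (simp add: pos_Suc)
    finally show ?case .
  next
    case (step j)
    then show ?case using y(4) by (simp add: pos_Suc)
  qed
  then show "vershik B x \<in> inf_paths B" "\<forall>i\<ge>n. vershik B x i = x i" "pos n (vershik B x) = pos n x + 1"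
    using y k(1) m(1) unfolding y_def[symmetric] by auto
qed

lemma vershik_iterate:
  assumes x: "x \<in> inf_paths B" and "pos n x + j < hgt n (src B (Suc n) (x n))"
  shows "(vershik B ^^ j) x \<in> inf_paths B \<and> (\<forall>i\<ge>n. (vershik B ^^ j) x i = x i) \<and>
     pos n ((vershik B ^^ j) x) = pos n x + j"
  using assms(2)
proof (induction j)
  case (Suc j)
  then have IH: "(vershik B ^^ j) x \<in> inf_paths B" "\<forall>i\<ge>n. (vershik B ^^ j) x i = x i"
    "pos n ((vershik B ^^ j) x) = pos n x + j" by auto
  show ?case using vershik_step[OF IH(1), of n] IH Suc.prems by simp
qed (use x in simp)

text \<open>As \<open>z\<close> has the same tail as \<open>x\<close>, its position stays below the
  height, so \<open>j\<close> steps upwards are possible without touching the tail. The position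
  reached then identifies the prefix.\<close>

lemma vershik_iterate_eq:
  assumes x: "x \<in> inf_paths B" and z: "z \<in> inf_paths B" and "\<forall>i\<ge>n. z i = x i"
    and "pos n z = pos n x + j"
  shows "(vershik B ^^ j) x = z"
proof -
  have s: "src B (Suc n) (x n) = src B (Suc n) (z n)" using assms(3) by simp
  have it: "(vershik B ^^ j) x \<in> inf_paths B" "\<forall>i\<ge>n. (vershik B ^^ j) x i = x i"
    "pos n ((vershik B ^^ j) x) = pos n x + j"
    using vershik_iterate[OF x, of n j] pos_less[OF z, of n] assms(4) s by auto
  have "\<forall>i<n. (vershik B ^^ j) x i = z i"
    by (rule pos_inj[OF it(1) z]) (use it s assms(4) in auto)
  then show ?thesis using it(2) assms(3) by (metis ext not_le)
qed

text \<open>Two segments between the same vertices displace every path by the same amount, because the part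
  of the path before them contributes equally to both positions.\<close>

definition offset :: "nat \<Rightarrow> nat \<Rightarrow> (nat \<Rightarrow> 'e) \<Rightarrow> nat" where
  "offset n m x = (\<Sum>i=n..<m. jump i (x i))"

lemma pos_split: "n \<le> m \<Longrightarrow> pos m x = pos n x + offset n m x"
proof (induction m rule: dec_induct)
  case (step m)
  then show ?case by (simp add: pos_Suc offset_def)
qed (simp add: offset_def)

lemma offset_cong: "(\<And>i. n \<le> i \<Longrightarrow> i < m \<Longrightarrow> x i = y i) \<Longrightarrow> offset n m x = offset n m y"
  by (simp add: offset_def)

text \<open>The minimal prefix has position 0, and iterating the Vershik map from there runs through
  all positions below the height.\<close>

lemma ex_pos:
  assumes x: "x \<in> inf_paths B" and j: "j < hgt n (src B (Suc n) (x n))"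
  shows "\<exists>y\<in>inf_paths B. (\<forall>i\<ge>n. y i = x i) \<and> pos n y = j"
proof -
  from min_completion[OF inf_path_tail[OF x]] obtain y where y: "y \<in> inf_paths B" "\<forall>i\<ge>n. y i = x i"
    "\<forall>i<n. min_edge B (Suc i) (y i)" by blast
  have "(vershik B ^^ j) y \<in> inf_paths B \<and> (\<forall>i\<ge>n. (vershik B ^^ j) y i = y i) \<and>
     pos n ((vershik B ^^ j) y) = pos n y + j"
    by (rule vershik_iterate[OF y(1)]) (use y pos_min[OF y(3)] j in simp)
  then show ?thesis using y(2) pos_min[OF y(3)] by auto
qed

text \<open>If the offsets differed by less than the height at level \<open>n\<close>, a prefix
  whose position is that difference, followed by the segment of \<open>x\<close>, would have the
  same position as the first prefix followed by the segment of \<open>z\<close>, although the paths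
  differ. The gap bounds the displacement from below.\<close>

lemma offset_gap:
  assumes x: "x \<in> inf_paths B" and z: "z \<in> inf_paths B" and nm: "n \<le> m"
    and s: "src B (Suc n) (x n) = src B (Suc n) (z n)" and tl: "\<forall>i\<ge>m. x i = z i"
    and ne: "\<exists>i. n \<le> i \<and> i < m \<and> x i \<noteq> z i" and le: "offset n m x \<le> offset n m z"
  shows "offset n m x + hgt n (src B (Suc n) (x n)) \<le> offset n m z"
proof (rule ccontr)
  assume "\<not> ?thesis"
  then have "offset n m z - offset n m x < hgt n (src B (Suc n) (x n))" using le by linarith
  from ex_pos[OF x this] obtain x' where
    x': "x' \<in> inf_paths B" "\<forall>i\<ge>n. x' i = x i" "pos n x' = offset n m z - offset n m x"
    by blast
  have "\<exists>z'\<in>inf_paths B. (\<forall>i\<ge>n. z' i = z i) \<and> pos n z' = 0"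
    by (rule ex_pos[OF z]) (use pos_less[OF z, of n] in simp)
  then obtain z' where z': "z' \<in> inf_paths B" "\<forall>i\<ge>n. z' i = z i" "pos n z' = 0" by blast
  have "pos m x' = offset n m z - offset n m x + offset n m x"
    using pos_split[OF nm, of x'] x' offset_cong[of n m x' x] by simp
  moreover have "pos m z' = offset n m z"
    using pos_split[OF nm, of z'] z' offset_cong[of n m z' z] by simp
  ultimately have "pos m x' = pos m z'" using le by simp
  moreover have "src B (Suc m) (x' m) = src B (Suc m) (z' m)" using x' z' tl nm by simp
  ultimately have "\<forall>i<m. x' i = z' i" using pos_inj[OF x'(1) z'(1), of m] by blast
  then show False using ne x'(2) z'(2) by auto
qed

text \<open>The segment with the larger offset starts at least one height above the other and is
  itself preceded by a full height of prefixes. Its topmost prefix, at position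
  \<open>?h - 1\<close>, still lies below the height at level \<open>m\<close>.\<close>

lemma hgt_double:
  assumes x: "x \<in> inf_paths B" and z: "z \<in> inf_paths B" and nm: "n \<le> m"
    and s: "src B (Suc n) (x n) = src B (Suc n) (z n)" and tl: "\<forall>i\<ge>m. x i = z i"
    and ne: "\<exists>i. n \<le> i \<and> i < m \<and> x i \<noteq> z i" 
  shows "2 * hgt n (src B (Suc n) (x n)) \<le> hgt m (src B (Suc m) (x m))"
proof -
  let ?h = "hgt n (src B (Suc n) (x n))"
  have "2 * hgt n (src B (Suc n) (x n)) \<le> hgt m (src B (Suc m) (x m))"
    if z: "z \<in> inf_paths B" and s: "src B (Suc n) (x n) = src B (Suc n) (z n)" and tl: "\<forall>i\<ge>m. x i = z i"
    and "offset n m x + hgt n (src B (Suc n) (x n)) \<le> offset n m z" for x z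
  proof -
    let ?h = "hgt n (src B (Suc n) (x n))"
    have "\<exists>z'\<in>inf_paths B. (\<forall>i\<ge>n. z' i = z i) \<and> pos n z' = ?h - 1"
      by (rule ex_pos[OF z]) (use pos_less[OF z, of n] s in simp)
    then obtain z' where z': "z' \<in> inf_paths B" "\<forall>i\<ge>n. z' i = z i" "pos n z' = ?h - 1" by blast
    have "pos m z' = ?h - 1 + offset n m z"
      using pos_split[OF nm, of z'] z' offset_cong[of n m z' z] by simp
    moreover have "pos m z' < hgt m (src B (Suc m) (x m))"
      using pos_less[OF z'(1), of m] z'(2) tl nm by simp
    ultimately show ?thesis using that(4) by linarith
  qed note half = this
  show ?thesis
  proof (cases "offset n m x \<le> offset n m z")
    case True
    then show ?thesis using half[OF z s tl] offset_gap[OF x z nm s tl ne] by blast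
  next
    case False
    have "\<forall>i\<ge>m. z i = x i" "\<exists>i. n \<le> i \<and> i < m \<and> z i \<noteq> x i" using tl ne by auto
    from offset_gap[OF z x nm s[symmetric] this] half[OF x s[symmetric] this(1)] False
    show ?thesis using s tl nm by simp
  qed
qed

section \<open>Domain and continuity of the Vershik map\<close>

definition shared_prefix :: "nat \<Rightarrow> (nat \<Rightarrow> 'e) \<Rightarrow> (nat \<Rightarrow> 'e) set" where
  "shared_prefix n x = {y \<in> inf_paths B. \<forall>i<n. y i = x i}"

lemma vershik_domain_nonmax:
  assumes "x \<in> vershik_domain B"
  shows "x \<in> inf_paths B" "\<exists>n. \<not> max_edge B (Suc n) (x n)"
  using assms by (auto simp: vershik_domain_def max_path_def tail_equivalent_def)

text \<open>A path that is maximal from some level on becomes a maximal path when its beginning is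
  replaced by maximal edges, and likewise for minimal ones. In this form the complement of the
  domain is a countable union of sets that can be measured.\<close>

lemma vershik_domain_eq:
  "vershik_domain B = {x \<in> inf_paths B. (\<forall>n. \<exists>i\<ge>n. \<not> max_edge B (Suc i) (x i)) \<and> (\<forall>n. \<exists>i\<ge>n. \<not> min_edge B (Suc i) (x i))}"
proof (intro Set.set_eqI iffI)
  fix x assume x: "x \<in> vershik_domain B"
  then have xi: "x \<in> inf_paths B" using vershik_domain_nonmax by blast
  have False if "\<forall>i\<ge>n. max_edge B (Suc i) (x i)" for n
  proof -
    from max_completion[OF inf_path_tail[OF xi]] obtain y where y: "y \<in> inf_paths B" "\<forall>i\<ge>n. y i = x i"
      "\<forall>i<n. max_edge B (Suc i) (y i)" by blast
    then have "max_edge B (Suc i) (y i)" for i using that by (cases "i < n") auto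
    then have "max_path B y" using y(1) by (simp add: max_path_def)
    moreover have "tail_equivalent x y"
      unfolding tail_equivalent_def eventually_sequentially using y(2) by (intro exI[of _ n]) simp
    ultimately show False using x by (auto simp: vershik_domain_def)
  qed
  moreover have False if "\<forall>i\<ge>n. min_edge B (Suc i) (x i)" for n
  proof -
    from min_completion[OF inf_path_tail[OF xi]] obtain y where y: "y \<in> inf_paths B" "\<forall>i\<ge>n. y i = x i"
      "\<forall>i<n. min_edge B (Suc i) (y i)" by blast
    then have "min_edge B (Suc i) (y i)" for i using that by (cases "i < n") auto
    then have "min_path B y" using y(1) by (simp add: min_path_def)
    moreover have "tail_equivalent x y"
      unfolding tail_equivalent_def eventually_sequentially using y(2) by (intro exI[of _ n]) simp
    ultimately show False using x by (auto simp: vershik_domain_def)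
  qed
  ultimately show "x \<in> {x \<in> inf_paths B. (\<forall>n. \<exists>i\<ge>n. \<not> max_edge B (Suc i) (x i)) \<and> (\<forall>n. \<exists>i\<ge>n. \<not> min_edge B (Suc i) (x i))}"
    using xi by blast
next
  fix x assume x: "x \<in> {x \<in> inf_paths B. (\<forall>n. \<exists>i\<ge>n. \<not> max_edge B (Suc i) (x i)) \<and> (\<forall>n. \<exists>i\<ge>n. \<not> min_edge B (Suc i) (x i))}"
  have False if y: "max_path B y \<or> min_path B y" and t: "tail_equivalent x y" for y
  proof -
    obtain n where n: "\<forall>i\<ge>n. x i = y i" using t by (auto simp: tail_equivalent_def eventually_sequentially)
    obtain i i' where "i \<ge> n" "\<not> max_edge B (Suc i) (x i)" "i' \<ge> n" "\<not> min_edge B (Suc i') (x i')"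
      using x by blast
    then show False using y n by (auto simp: max_path_def min_path_def)
  qed
  then show "x \<in> vershik_domain B" using x by (auto simp: vershik_domain_def)
qed

lemma vershik_in_domain:
  assumes x: "x \<in> vershik_domain B"
  shows "vershik B x \<in> vershik_domain B"
proof -
  obtain n where n: "\<not> max_edge B (Suc n) (x n)" using vershik_domain_nonmax[OF x] by blast
  from vershik_image_vershik[OF vershik_domain_nonmax(1)[OF x] n] obtain k
    where k: "vershik_image k x (vershik B x)" by blast
  then have y: "vershik B x \<in> inf_paths B" and "\<forall>i>k. vershik B x i = x i" by (auto simp: vershik_image_def)
  then have "tail_equivalent x (vershik B x)"
    unfolding tail_equivalent_def eventually_sequentially by (intro exI[of _ "Suc k"]) auto
  then have "tail_equivalent x z" if "tail_equivalent (vershik B x) z" for z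
    using that unfolding tail_equivalent_def by (auto elim: eventually_elim2)
  then show ?thesis using x y by (auto simp: vershik_domain_def)
qed

text \<open>The first non-maximal edge and the new beginning are read off the first
  \<open>k + 1\<close> edges, and later edges are copied. This continuity makes the overlaps below
  measurable.\<close>

lemma vershik_local:
  assumes x: "x \<in> vershik_domain B"
  shows "\<exists>n'. \<forall>y\<in>vershik_domain B. (\<forall>i<n'. y i = x i) \<longrightarrow> (\<forall>i<n. vershik B y i = vershik B x i)"
proof -
  obtain n0 where n0: "\<not> max_edge B (Suc n0) (x n0)" and xi: "x \<in> inf_paths B"
    using vershik_domain_nonmax[OF x] by blast
  from vershik_image_vershik[OF xi n0] obtain k where k: "\<not> max_edge B (Suc k) (x k)" 
    "\<forall>i<k. max_edge B (Suc i) (x i)" "vershik_image k x (vershik B x)" by blast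
  define w where "w = vershik B x"
  have w: "w \<in> inf_paths B" "\<forall>i<k. min_edge B (Suc i) (w i)" "succ_edge B (Suc k) (x k) (w k)" "\<forall>i>k. w i = x i"
    using k(3) by (auto simp: vershik_image_def w_def)
  have "vershik B y i = w i" if y: "y \<in> vershik_domain B" and yx: "\<forall>i<max n (Suc k). y i = x i" and i: "i < n" for y i
  proof -
    have yi: "y \<in> inf_paths B" using vershik_domain_nonmax[OF y] by blast
    have yk: "\<And>i. i \<le> k \<Longrightarrow> y i = x i" using yx by auto
    \<comment> \<open>The new beginning computed for \<open>x\<close>, followed by the tail of
      \<open>y\<close>, is the image of \<open>y\<close>.\<close>
    define z where "z = (\<lambda>i. if i \<le> k then w i else y i)"
    have "z i \<in> edg B (Suc i) \<and> rng B (Suc i) (z i) = src B (Suc (Suc i)) (z (Suc i))" for i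
    proof -
      consider "i < k" | "i = k" | "i > k" by linarith
      then show ?thesis
      proof cases
        case 2
        have "rng B (Suc k) (w k) = rng B (Suc k) (y k)"
          using jump_succ(3)[OF inf_pathD(1)[OF xi] w(3)] yk by simp
        then show ?thesis using 2 inf_pathD(1)[OF w(1), of k] inf_pathD(2)[OF yi, of k] by (simp add: z_def)
      qed (use inf_pathD(1,2)[OF w(1), of i] inf_pathD(1,2)[OF yi, of i] in \<open>auto simp: z_def\<close>)
    qed
    then have "z \<in> inf_paths B" by (simp add: inf_paths_def)
    then have "vershik_image k y z"
      unfolding vershik_image_def using w(2,3) yk by (auto simp: z_def)
    then have "vershik B y = z"
      by (intro vershik_eq[OF yi]) (use k yk in auto)
    then show ?thesis using w(4) yx i by (auto simp: z_def)
  qed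
  then show ?thesis unfolding w_def by blast
qed

lemma vershik_pow_in_domain: "x \<in> vershik_domain B \<Longrightarrow> (vershik B ^^ D) x \<in> vershik_domain B"
  by (induction D) (auto intro: vershik_in_domain)

lemma vershik_pow_local:
  assumes x: "x \<in> vershik_domain B"
  shows "\<exists>n'. \<forall>y\<in>vershik_domain B. (\<forall>i<n'. y i = x i) \<longrightarrow> (\<forall>i<n. (vershik B ^^ D) y i = (vershik B ^^ D) x i)"
proof (induction D arbitrary: n)
  case 0
  show ?case by (intro exI[of _ n]) simp
next
  case (Suc D)
  from vershik_local[OF vershik_pow_in_domain[OF x, of D], of n] obtain n1 where
    n1: "\<And>y. y \<in> vershik_domain B \<Longrightarrow> \<forall>i<n1. y i = (vershik B ^^ D) x i \<Longrightarrow>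
      \<forall>i<n. vershik B y i = vershik B ((vershik B ^^ D) x) i" by blast
  from Suc.IH[of n1] obtain n2 where
    n2: "\<And>y. y \<in> vershik_domain B \<Longrightarrow> \<forall>i<n2. y i = x i \<Longrightarrow>
      \<forall>i<n1. (vershik B ^^ D) y i = (vershik B ^^ D) x i" by blast
  show ?case
    using n1[OF vershik_pow_in_domain n2] by (intro exI[of _ n2]) simp
qed

end

section \<open>Stationary diagrams\<close>

lemma spectral_radius_singleton:
  assumes A: "A \<in> carrier_mat 1 1"
  shows "spectral_radius A = cmod (A $$ (0, 0))"
proof -
  have "spectral_radius A \<in> norm ` spectrum A"
    by (rule spectral_radius_mem_max(1)[OF A]) simp
  then obtain k where k: "eigenvalue A k" "spectral_radius A = cmod k"
    by (auto simp: spectrum_def)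
  then obtain v where v: "v \<in> carrier_vec 1" "v \<noteq> 0\<^sub>v 1" "A *\<^sub>v v = k \<cdot>\<^sub>v v"
    using A by (auto simp: eigenvalue_def eigenvector_def)
  have "vec_index v 0 \<noteq> 0"
  proof
    assume "vec_index v 0 = 0"
    then have "v = 0\<^sub>v 1" using v(1) by (intro eq_vecI) auto
    then show False using v(2) by simp
  qed
  moreover have "vec_index (A *\<^sub>v v) 0 = A $$ (0, 0) * vec_index v 0"
    using A v(1) by (simp add: scalar_prod_def)
  then have "A $$ (0, 0) * vec_index v 0 = k * vec_index v 0" using v(1,3) by auto
  ultimately have "A $$ (0, 0) = k" using mult_right_cancel by blast
  then show ?thesis using k(2) by simp
qed

lemma equiv_same_class: "equiv {..<dim_row A} (same_class A)"
proof (rule equivI)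
  show "trans (same_class A)"
  proof (rule transI)
    fix x y z assume "(x, y) \<in> same_class A" "(y, z) \<in> same_class A"
    then show "(x, z) \<in> same_class A"
      unfolding same_class_def by (auto dest: trancl_trans)
  qed
qed (auto simp: same_class_def refl_on_def sym_def)

context ordered_bratteli begin

lemma splice_in_inf_paths:
  assumes x: "x \<in> inf_paths B" and y: "y \<in> inf_paths B" and s: "src B (Suc m) (x m) = src B (Suc m) (y m)"
  shows "(\<lambda>i. if i < m then x i else y i) \<in> inf_paths B"
  unfolding inf_paths_def mem_Collect_eq
proof (intro allI conjI)
  fix i
  show "(if i < m then x i else y i) \<in> edg B (Suc i)" using inf_pathD(1)[OF x] inf_pathD(1)[OF y] by simp
  consider "Suc i < m" | "Suc i = m" | "i \<ge> m" by linarith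
  then show "rng B (Suc i) (if i < m then x i else y i) =
      src B (Suc (Suc i)) (if Suc i < m then x (Suc i) else y (Suc i))"
    using inf_pathD(2)[OF x, of i] inf_pathD(2)[OF y, of i] s by cases auto
qed

lemma extend_by_edge:
  assumes x: "x \<in> inf_paths B" and e: "e \<in> edg B (Suc n)" "src B (Suc n) e = src B (Suc n) (x n)"
  shows "\<exists>y\<in>inf_paths B. (\<forall>i<n. y i = x i) \<and> y n = e"
proof -
  obtain z where z: "tail_path (Suc n) z" "src B (Suc (Suc n)) (z (Suc n)) = rng B (Suc n) e"
    using ex_tail_path[OF edg_rng[OF e(1)]] by blast
  let ?y = "\<lambda>i. if i < n then x i else if i = n then e else z i"
  have "?y i \<in> edg B (Suc i) \<and> rng B (Suc i) (?y i) = src B (Suc (Suc i)) (?y (Suc i))" for i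
  proof -
    consider "Suc i < n" | "Suc i = n" | "i = n" | "i > n" by linarith
    then show ?thesis
      using inf_pathD(1,2)[OF x, of i] z e unfolding tail_path_def by cases auto
  qed
  then have "?y \<in> inf_paths B" by (simp add: inf_paths_def)
  then show ?thesis by (rule bexI[rotated]) simp
qed

end

locale stationary_bratteli = ordered_bratteli B for B :: "(nat, 'e) bratteli" +
  fixes N :: nat and F :: "nat mat" and \<alpha> :: "nat set"
  assumes stationary: "stationary_diagram B N F"
    and condP: "condition_P F"
    and in_classes: "\<alpha> \<in> comm_classes (transpose_mat F)"
begin

text \<open>Because of the transpose, arrows run in the direction of paths: \<open>(i, j)\<close> is
  in \<open>G\<close> when edges lead from \<open>i\<close> to \<open>j\<close> on every level from
  2 on.\<close>

abbreviation G :: "nat rel" where "G \<equiv> graph_of (transpose_mat F)"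

lemma vtx_eq: "n \<ge> 1 \<Longrightarrow> vtx B n = {..<N}"
  using stationary by (simp add: stationary_diagram_def)

lemma F_eq: "n \<ge> 1 \<Longrightarrow> F = incidence_mat B N n"
  using stationary by (simp add: stationary_diagram_def)

lemma F_dim [simp]: "dim_row F = N" "dim_col F = N"
  using F_eq[of 1] by (simp_all add: incidence_mat_def)

lemma F_entry:
  "n \<ge> 1 \<Longrightarrow> v < N \<Longrightarrow> w < N \<Longrightarrow> F $$ (v, w) = card {e \<in> edg B (Suc n). src B (Suc n) e = w \<and> rng B (Suc n) e = v}"
  by (subst F_eq) (simp_all add: incidence_mat_def)

lemma G_iff: "(i, j) \<in> G \<longleftrightarrow> i < N \<and> j < N \<and> F $$ (j, i) > 0"
  by (auto simp: graph_of_def)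

lemma G_edge:
  assumes "(i, j) \<in> G" "n \<ge> 1"
  shows "\<exists>e\<in>edg B (Suc n). src B (Suc n) e = i \<and> rng B (Suc n) e = j"
proof -
  have "card {e \<in> edg B (Suc n). src B (Suc n) e = i \<and> rng B (Suc n) e = j} > 0"
    using assms F_entry[of n j i] by (simp add: G_iff)
  then show ?thesis by (auto simp: card_gt_0_iff)
qed

lemma src_less: "x \<in> inf_paths B \<Longrightarrow> n \<ge> 1 \<Longrightarrow> src B (Suc n) (x n) < N"
  using inf_pathD(3)[of x n] vtx_eq[of n] by simp

lemma path_step_G:
  assumes x: "x \<in> inf_paths B" and n: "n \<ge> 1"
  shows "(src B (Suc n) (x n), src B (Suc (Suc n)) (x (Suc n))) \<in> G"
proof -
  let ?i = "src B (Suc n) (x n)" and ?j = "src B (Suc (Suc n)) (x (Suc n))"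
  have "x n \<in> {e \<in> edg B (Suc n). src B (Suc n) e = ?i \<and> rng B (Suc n) e = ?j}"
    using inf_pathD(1,2)[OF x] by simp
  then have "card {e \<in> edg B (Suc n). src B (Suc n) e = ?i \<and> rng B (Suc n) e = ?j} > 0"
    using finite_edg[of "Suc n"] by (auto simp: card_gt_0_iff)
  then show ?thesis using F_entry[OF n, of ?j ?i] src_less[OF x] n by (simp add: G_iff)
qed

lemma path_reach:
  assumes x: "x \<in> inf_paths B" and "1 \<le> m" "m \<le> n"
  shows "(src B (Suc m) (x m), src B (Suc n) (x n)) \<in> G\<^sup>*"
  using assms(3)
proof (induction n rule: dec_induct)
  case (step n)
  then show ?case using path_step_G[OF x, of n] assms(2) by (meson le_trans rtrancl.rtrancl_into_rtrancl)
qed simp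

lemma extend_relpow:
  assumes "x \<in> inf_paths B" "n \<ge> 1" "(src B (Suc n) (x n), w) \<in> G ^^ k"
  shows "\<exists>y\<in>inf_paths B. (\<forall>i<n. y i = x i) \<and> src B (Suc (n + k)) (y (n + k)) = w"
  using assms(3)
proof (induction k arbitrary: w)
  case 0
  then show ?case using assms(1) by auto
next
  case (Suc k)
  then obtain u where u: "(src B (Suc n) (x n), u) \<in> G ^^ k" "(u, w) \<in> G" by auto
  from Suc.IH[OF u(1)] obtain y where y: "y \<in> inf_paths B" "\<forall>i<n. y i = x i" "src B (Suc (n + k)) (y (n + k)) = u"
    by blast
  from G_edge[OF u(2), of "n + k"] assms(2) obtain e where e: "e \<in> edg B (Suc (n + k))" "src B (Suc (n + k)) e = u"
    "rng B (Suc (n + k)) e = w" by auto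
  from extend_by_edge[OF y(1) e(1)] e(2) y(3) obtain z where z: "z \<in> inf_paths B" "\<forall>i<n + k. z i = y i" "z (n + k) = e"
    by auto
  have "src B (Suc (n + Suc k)) (z (n + Suc k)) = w" using inf_pathD(2)[OF z(1), of "n + k"] z(3) e(3) by simp
  then show ?case using z y(2) by (intro bexI[of _ z]) auto
qed

section \<open>The class and its diagonal block\<close>

lemma class_sub: "\<alpha> \<subseteq> {..<N}" and class_ne: "\<alpha> \<noteq> {}"
  using in_classes equiv_same_class[of "transpose_mat F"]
  by (auto simp: comm_classes_def dest: in_quotient_imp_subset in_quotient_imp_non_empty)

lemma finite_class: "finite \<alpha>"
  using class_sub finite_subset by blast

lemma class_eq:
  assumes "a \<in> \<alpha>"
  shows "same_class (transpose_mat F) `` {a} = \<alpha>"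
proof -
  obtain i where i: "\<alpha> = same_class (transpose_mat F) `` {i}"
    using in_classes unfolding comm_classes_def by (rule quotientE)
  then have "(i, a) \<in> same_class (transpose_mat F)" using assms by blast
  from equiv_class_eq[OF equiv_same_class this] show ?thesis using i by simp
qed

lemma class_connected: "a \<in> \<alpha> \<Longrightarrow> b \<in> \<alpha> \<Longrightarrow> a = b \<or> (a, b) \<in> G\<^sup>+ \<and> (b, a) \<in> G\<^sup>+"
  using class_eq[of a] by (auto simp: same_class_def)

lemma class_closed: "a \<in> \<alpha> \<Longrightarrow> (a, b) \<in> G\<^sup>+ \<Longrightarrow> (b, a) \<in> G\<^sup>+ \<Longrightarrow> b \<in> \<alpha>"
proof -
  assume a: "a \<in> \<alpha>" and ab: "(a, b) \<in> G\<^sup>+" and ba: "(b, a) \<in> G\<^sup>+"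
  have "b < N" using ba by (induction rule: converse_trancl_induct) (auto simp: G_iff)
  then have "(a, b) \<in> same_class (transpose_mat F)" using a ab ba class_sub by (auto simp: same_class_def)
  then show "b \<in> \<alpha>" using class_eq[OF a] by blast
qed

text \<open>A vertex that is reachable from \<open>\<alpha>\<close> and has access to
  \<open>\<alpha>\<close> lies on a closed walk through \<open>\<alpha>\<close>. Hence a path that
  has left \<open>\<alpha>\<close> ends in a vertex where the eigenvector vanishes, and its cylinder
  is null.\<close>

lemma has_access_class:
  assumes a: "a \<in> \<alpha>" and v: "v < N" "(a, v) \<in> G\<^sup>*" and acc: "has_access (transpose_mat F) (same_class (transpose_mat F) `` {v}) \<alpha>"
  shows "v \<in> \<alpha>"
proof -
  have vv: "(v, v) \<in> same_class (transpose_mat F)" using v by (simp add: same_class_def)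
  show ?thesis
  proof (cases "same_class (transpose_mat F) `` {v} = \<alpha>")
    case True then show ?thesis using vv by blast
  next
    case False
    then obtain i j where ij: "(v, i) \<in> same_class (transpose_mat F)" "j \<in> \<alpha>" "(i, j) \<in> G\<^sup>+"
      using acc by (auto simp: has_access_def)
    have "(v, i) \<in> G\<^sup>*" using ij(1) by (auto simp: same_class_def)
    moreover have "(j, a) \<in> G\<^sup>*" using class_connected[OF ij(2) a] by auto
    ultimately have va: "(v, a) \<in> G\<^sup>+" using ij(3) by (meson rtrancl_trancl_trancl trancl_rtrancl_trancl)
    then show ?thesis
    proof (cases "v = a")
      case False
      then have "(a, v) \<in> G\<^sup>+" using v(2) by (simp add: rtrancl_eq_or_trancl)
      then show ?thesis using class_closed[OF a _ va] by blast
    qed (use a in simp)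
  qed
qed

lemma submatrix_dim [simp]: "dim_row (submatrix F \<alpha> \<alpha>) = card \<alpha>" "dim_col (submatrix F \<alpha> \<alpha>) = card \<alpha>"
proof -
  have "{i. i < N \<and> i \<in> \<alpha>} = \<alpha>" using class_sub by auto
  then show "dim_row (submatrix F \<alpha> \<alpha>) = card \<alpha>" "dim_col (submatrix F \<alpha> \<alpha>) = card \<alpha>"
    by (simp_all add: dim_submatrix)
qed

lemma submatrix_entry:
  "i < card \<alpha> \<Longrightarrow> j < card \<alpha> \<Longrightarrow> submatrix F \<alpha> \<alpha> $$ (i, j) = F $$ (pick \<alpha> i, pick \<alpha> j)"
proof -
  have "{i. i < N \<and> i \<in> \<alpha>} = \<alpha>" using class_sub by auto
  then show "i < card \<alpha> \<Longrightarrow> j < card \<alpha> \<Longrightarrow> ?thesis" by (intro submatrix_index) simp_all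
qed

lemma pick_less: "i < card \<alpha> \<Longrightarrow> pick \<alpha> i < N"
  using pick_in_set_le[of i \<alpha>] class_sub by blast

lemma ex_pick:
  assumes "a \<in> \<alpha>"
  shows "\<exists>i<card \<alpha>. pick \<alpha> i = a"
proof -
  have "card {b \<in> \<alpha>. b < a} < card \<alpha>"
    by (rule psubset_card_mono) (use finite_class assms in auto)
  then show ?thesis using pick_card_in_set[OF assms] by blast
qed

lemma class_radius_singleton:
  assumes "\<alpha> = {a}"
  shows "class_radius F \<alpha> = real (F $$ (a, a))"
proof -
  have "pick \<alpha> 0 = a" using ex_pick[of a] assms by simp
  then have e: "submatrix F \<alpha> \<alpha> $$ (0, 0) = F $$ (a, a)" using submatrix_entry[of 0 0] assms by simp
  let ?M = "map_mat of_nat (transpose_mat (submatrix F \<alpha> \<alpha>)) :: complex mat"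
  have crd: "card \<alpha> = 1" using assms by simp
  then have "?M \<in> carrier_mat 1 1" by (intro carrier_matI) simp_all
  from spectral_radius_singleton[OF this] show ?thesis
    unfolding class_radius_def using e crd by simp
qed

lemma class_radius_nonneg: "class_radius F \<alpha> \<ge> 0"
proof -
  let ?M = "map_mat of_nat (transpose_mat (submatrix F \<alpha> \<alpha>)) :: complex mat"
  have "?M \<in> carrier_mat (card \<alpha>) (card \<alpha>)" by (rule carrier_matI) simp_all
  moreover have "card \<alpha> > 0" using finite_class class_ne by (simp add: card_gt_0_iff)
  ultimately have "class_radius F \<alpha> \<in> norm ` spectrum ?M"
    unfolding class_radius_def by (rule spectral_radius_mem_max(1))
  then show ?thesis by auto
qed

text \<open>Rows of \<open>F\<close> are targets and columns are sources, so an entry at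
  \<open>(i, j)\<close> is witnessed by a walk that starts at column \<open>j\<close>.\<close>

lemma submatrix_power_relpow:
  assumes "i < card \<alpha>" "j < card \<alpha>" "(submatrix F \<alpha> \<alpha> ^\<^sub>m k) $$ (i, j) > 0"
  shows "(pick \<alpha> j, pick \<alpha> i) \<in> G ^^ k"
  using assms
proof (induction k arbitrary: j)
  case 0
  then show ?case by (cases "i = j") (simp_all add: one_mat_def)
next
  case (Suc k)
  let ?M = "submatrix F \<alpha> \<alpha>"
  have c: "?M \<in> carrier_mat (card \<alpha>) (card \<alpha>)" by (rule carrier_matI) simp_all
  have ck: "?M ^\<^sub>m k \<in> carrier_mat (card \<alpha>) (card \<alpha>)" using pow_carrier_mat[OF c] .
  have "(?M ^\<^sub>m Suc k) $$ (i, j) = (\<Sum>l<card \<alpha>. (?M ^\<^sub>m k) $$ (i, l) * ?M $$ (l, j))"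
    using c ck Suc.prems by (simp add: scalar_prod_def atLeast0LessThan)
  then obtain l where l: "l < card \<alpha>" "(?M ^\<^sub>m k) $$ (i, l) * ?M $$ (l, j) > 0"
    using Suc.prems(3) by (metis (no_types, lifting) bot_nat_0.not_eq_extremum lessThan_iff sum.neutral)
  then have "(?M ^\<^sub>m k) $$ (i, l) > 0" "?M $$ (l, j) > 0" by auto
  then have "(pick \<alpha> l, pick \<alpha> i) \<in> G ^^ k" "(pick \<alpha> j, pick \<alpha> l) \<in> G"
    using Suc.IH[OF Suc.prems(1) l(1)] submatrix_entry[OF l(1) Suc.prems(2)] pick_less l(1) Suc.prems(2)
    by (auto simp: G_iff)
  then show ?case by (blast intro: relpow_Suc_I2)
qed

text \<open>An edge inside the class makes the diagonal block nonzero, hence primitive by condition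
  (P). One exponent then serves all pairs of vertices.\<close>

lemma class_uniform_relpow:
  assumes ac: "a \<in> \<alpha>" "c \<in> \<alpha>" "(a, c) \<in> G"
  shows "\<exists>k\<ge>1. \<forall>v\<in>\<alpha>. \<forall>w\<in>\<alpha>. (v, w) \<in> G ^^ k"
proof -
  obtain i j where ij: "i < card \<alpha>" "j < card \<alpha>" "pick \<alpha> i = c" "pick \<alpha> j = a"
    using ex_pick ac by metis
  have pos: "submatrix F \<alpha> \<alpha> $$ (i, j) > 0" using submatrix_entry[OF ij(1,2)] ij ac(3) by (simp add: G_iff)
  have "submatrix F \<alpha> \<alpha> \<noteq> 0\<^sub>m (card \<alpha>) (card \<alpha>)"
  proof
    assume "submatrix F \<alpha> \<alpha> = 0\<^sub>m (card \<alpha>) (card \<alpha>)"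
    then have "submatrix F \<alpha> \<alpha> $$ (i, j) = 0" using ij(1,2) by (simp only: index_zero_mat)
    then show False using pos by simp
  qed
  moreover have "\<alpha> \<in> comm_classes (transpose_mat F) \<longrightarrow>
      submatrix F \<alpha> \<alpha> \<noteq> 0\<^sub>m (card \<alpha>) (card \<alpha>) \<longrightarrow> primitive_mat (submatrix F \<alpha> \<alpha>)"
    using condP[unfolded condition_P_def]
  proof (elim exE conjE, goal_cases)
    case (1 cs s)
    show ?case using 1(7)[rule_format, of \<alpha>] unfolding 1(2) by blast
  qed
  ultimately have "primitive_mat (submatrix F \<alpha> \<alpha>)" using in_classes by blast
  then obtain k where k: "k \<ge> 1" "\<And>i j. i < card \<alpha> \<Longrightarrow> j < card \<alpha> \<Longrightarrow> (submatrix F \<alpha> \<alpha> ^\<^sub>m k) $$ (i, j) > 0"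
    by (auto simp: primitive_mat_def)
  have "(v, w) \<in> G ^^ k" if v: "v \<in> \<alpha>" and w: "w \<in> \<alpha>" for v w
  proof -
    obtain i j where "i < card \<alpha>" "pick \<alpha> i = w" "j < card \<alpha>" "pick \<alpha> j = v"
      using ex_pick[OF v] ex_pick[OF w] by blast
    then show ?thesis using submatrix_power_relpow[of i j k] k(2) by simp
  qed
  then show ?thesis using k(1) by blast
qed

text \<open>Only a single vertex without a loop could fail this, and its radius is 0. In a larger
  class the first step of a walk to another vertex stays in the class, because the walk
  returns.\<close>

lemma class_has_edge:
  assumes nz: "class_radius F \<alpha> \<noteq> 0" and a: "a \<in> \<alpha>"
  shows "\<exists>c\<in>\<alpha>. (a, c) \<in> G"
proof (cases "\<alpha> = {a}")
  case True
  then have "F $$ (a, a) > 0" using class_radius_singleton nz by simp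
  then show ?thesis using a class_sub by (auto simp: G_iff)
next
  case False
  then obtain b where b: "b \<in> \<alpha>" "b \<noteq> a" using a by blast
  then have ab: "(a, b) \<in> G\<^sup>+" "(b, a) \<in> G\<^sup>+" using class_connected[OF a b(1)] by auto
  then obtain c where c: "(a, c) \<in> G" "(c, b) \<in> G\<^sup>*" by (meson tranclD)
  then have "(c, a) \<in> G\<^sup>+" using ab(2) by simp
  then show ?thesis using class_closed[OF a] c(1) by blast
qed

text \<open>The radius of a one-vertex class is its number of loops, so there are at least two
  parallel edges and \<open>K\<close> is 1. In a larger class walks of a common length
  \<open>k\<close> join any two vertices; one segment passes through \<open>a\<close> halfway, the
  other through some \<open>b\<close> different from \<open>a\<close>, and \<open>K\<close> is
  \<open>2 * k\<close>.\<close>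

lemma two_segments:
  assumes r: "class_radius F \<alpha> > 1" and a: "a \<in> \<alpha>"
  shows "\<exists>K\<ge>1. \<forall>n\<ge>1. \<exists>x\<in>inf_paths B. \<exists>z\<in>inf_paths B. src B (Suc n) (x n) = a \<and> src B (Suc n) (z n) = a \<and>
    src B (Suc (n + K)) (x (n + K)) = a \<and> (\<forall>i\<ge>n + K. x i = z i) \<and> (\<exists>i. n \<le> i \<and> i < n + K \<and> x i \<noteq> z i)"
proof -
  have aN: "a < N" using a class_sub by blast
  have through: "\<exists>x\<in>inf_paths B. src B (Suc n) (x n) = a" if "n \<ge> 1" for n
    using ex_path_through[of a n] vtx_eq[OF that] aN by simp
  have src_cong: "src B (Suc n) (y n) = src B (Suc n) (x n)"
    if x: "x \<in> inf_paths B" and y: "y \<in> inf_paths B" and n: "n \<ge> 1" and "\<forall>i<n. y i = x i" for n x y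
    using inf_pathD(2)[OF x, of "n - 1"] inf_pathD(2)[OF y, of "n - 1"] that(4) n by simp
  show ?thesis
  proof (cases "\<alpha> = {a}")
    case True
    then have "F $$ (a, a) \<ge> 2" using r class_radius_singleton by simp
    have "\<exists>x\<in>inf_paths B. \<exists>z\<in>inf_paths B. src B (Suc n) (x n) = a \<and> src B (Suc n) (z n) = a \<and>
      src B (Suc (n + 1)) (x (n + 1)) = a \<and> (\<forall>i\<ge>n + 1. x i = z i) \<and> (\<exists>i. n \<le> i \<and> i < n + 1 \<and> x i \<noteq> z i)"
      if n: "n \<ge> 1" for n
    proof -
      have "card {e \<in> edg B (Suc n). src B (Suc n) e = a \<and> rng B (Suc n) e = a} \<ge> 2"
        using F_entry[OF n aN aN] \<open>F $$ (a, a) \<ge> 2\<close> by simp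
      then obtain e e' where e: "e \<in> edg B (Suc n)" "src B (Suc n) e = a" "rng B (Suc n) e = a"
         "e' \<in> edg B (Suc n)" "src B (Suc n) e' = a" "rng B (Suc n) e' = a" "e \<noteq> e'"
        by (smt (verit, best) card_le_Suc0_iff_eq card.infinite mem_Collect_eq not_less_eq_eq numeral_2_eq_2 zero_le)
      obtain x0 where x0: "x0 \<in> inf_paths B" "src B (Suc n) (x0 n) = a" using through[OF n] by blast
      obtain x where x: "x \<in> inf_paths B" "x n = e" using extend_by_edge[OF x0(1) e(1)] e(2) x0(2) by auto
      obtain z where z: "z \<in> inf_paths B" "z n = e'" using extend_by_edge[OF x0(1) e(4)] e(5) x0(2) by auto
      have sx: "src B (Suc (Suc n)) (x (Suc n)) = a" "src B (Suc (Suc n)) (z (Suc n)) = a"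
        using inf_pathD(2)[OF x(1), of n] inf_pathD(2)[OF z(1), of n] x z e by auto
      have "(\<lambda>i. if i < Suc n then z i else x i) \<in> inf_paths B"
        by (rule splice_in_inf_paths[OF z(1) x(1)]) (simp add: sx)
      moreover have "\<exists>i. n \<le> i \<and> i < n + 1 \<and> x i \<noteq> (if i < Suc n then z i else x i)"
        using x(2) z(2) e(7) by (intro exI[of _ n]) simp
      ultimately show ?thesis using x z e(2,5) sx
        by (intro bexI[of _ x] bexI[of _ "\<lambda>i. if i < Suc n then z i else x i"]) simp_all
    qed
    then show ?thesis by (intro exI[of _ 1]) auto
  next
    case False
    then obtain b where b: "b \<in> \<alpha>" "b \<noteq> a" using a by blast
    obtain c where "c \<in> \<alpha>" "(a, c) \<in> G" using class_has_edge[of a] r a by auto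
    from class_uniform_relpow[OF a this] obtain k where k: "k \<ge> 1" "\<forall>v\<in>\<alpha>. \<forall>w\<in>\<alpha>. (v, w) \<in> G ^^ k" by blast
    have "\<exists>x\<in>inf_paths B. \<exists>z\<in>inf_paths B. src B (Suc n) (x n) = a \<and> src B (Suc n) (z n) = a \<and>
      src B (Suc (n + 2 * k)) (x (n + 2 * k)) = a \<and> (\<forall>i\<ge>n + 2 * k. x i = z i) \<and> (\<exists>i. n \<le> i \<and> i < n + 2 * k \<and> x i \<noteq> z i)"
      if n: "n \<ge> 1" for n
    proof -
      obtain x0 where x0: "x0 \<in> inf_paths B" "src B (Suc n) (x0 n) = a" using through[OF n] by blast
      have via: "\<exists>y\<in>inf_paths B. src B (Suc n) (y n) = a \<and> src B (Suc (n + k)) (y (n + k)) = d \<and>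
          src B (Suc (n + 2 * k)) (y (n + 2 * k)) = a" if d: "d \<in> \<alpha>" for d
      proof -
        obtain y1 where y1: "y1 \<in> inf_paths B" "\<forall>i<n. y1 i = x0 i" "src B (Suc (n + k)) (y1 (n + k)) = d"
          using extend_relpow[OF x0(1) n, of d k] x0(2) k(2) a d by auto
        have "n + k \<ge> 1" using n by simp
        then obtain y2 where y2: "y2 \<in> inf_paths B" "\<forall>i<n + k. y2 i = y1 i" "src B (Suc (n + k + k)) (y2 (n + k + k)) = a"
          using extend_relpow[OF y1(1), of "n + k" a k] y1(3) k(2) a d by auto
        have "src B (Suc n) (y2 n) = src B (Suc n) (x0 n)"
          by (rule src_cong[OF x0(1) y2(1) n]) (use y1(2) y2(2) in auto)
        moreover have "src B (Suc (n + k)) (y2 (n + k)) = d"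
          using src_cong[OF y1(1) y2(1) \<open>n + k \<ge> 1\<close> y2(2)] y1(3) by simp
        moreover have "src B (Suc (n + 2 * k)) (y2 (n + 2 * k)) = a" using y2(3) by (simp add: mult_2 add.assoc)
        ultimately show ?thesis using y2 x0(2) by (intro bexI[of _ y2]) auto
      qed
      obtain x where x: "x \<in> inf_paths B" "src B (Suc n) (x n) = a" "src B (Suc (n + k)) (x (n + k)) = a"
        "src B (Suc (n + 2 * k)) (x (n + 2 * k)) = a" using via[OF a] by blast
      obtain z where z: "z \<in> inf_paths B" "src B (Suc n) (z n) = a" "src B (Suc (n + k)) (z (n + k)) = b"
        "src B (Suc (n + 2 * k)) (z (n + 2 * k)) = a" using via[OF b(1)] by blast
      let ?z = "\<lambda>i. if i < n + 2 * k then z i else x i"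
      have "?z \<in> inf_paths B"
        by (rule splice_in_inf_paths[OF z(1) x(1)]) (simp add: x z)
      moreover have "x (n + k) \<noteq> ?z (n + k)" using x(3) z(3) b(2) k(1) by auto
      then have "\<exists>i. n \<le> i \<and> i < n + 2 * k \<and> x i \<noteq> ?z i" using k(1) by (intro exI[of _ "n + k"]) simp
      ultimately show ?thesis using x z k(1)
        by (intro bexI[of _ x] bexI[of _ ?z]) simp_all
    qed
    then show ?thesis using k(1) by (intro exI[of _ "2 * k"]) auto
  qed
qed

end

section \<open>The measure of a distinguished class\<close>

locale distinguished_system = stationary_bratteli B N F \<alpha>
  for B :: "(nat, 'e) bratteli" and N F \<alpha> +
  fixes \<mu> :: "(nat \<Rightarrow> 'e) measure" and \<xi> :: "real vec"
  assumes aper: "aperiodic_tail_relation B"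
    and prob: "prob_space \<mu>"
    and sets_mu: "sets \<mu> = sets (borel_of_top (path_topology B))"
    and vector: "distinguished_vector B F \<alpha> \<xi>"
    and measure_cylinder: "\<And>p. fin_path B p \<Longrightarrow> p \<noteq> [] \<Longrightarrow> measure \<mu> (cylinder B p) =
       vec_index \<xi> (rng B (length p) (last p)) / class_radius F \<alpha> ^ (length p - 1)"
begin

sublocale prob_space \<mu> by (rule prob)

abbreviation "g v \<equiv> vec_index \<xi> v"
abbreviation "rad \<equiv> class_radius F \<alpha>"

lemma cylinder_sub: "cylinder B p \<subseteq> inf_paths B"
  by (auto simp: cylinder_def)

lemma topspace_paths: "topspace (path_topology B) = inf_paths B"
proof -
  have "cylinder B [] = inf_paths B" "fin_path B []" by (auto simp: cylinder_def fin_path_def)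
  then show ?thesis using cylinder_sub
    by (auto simp: path_topology_def intro!: exI[of _ "cylinder B []"] exI[of _ "[]"]) 
qed

lemma space_mu: "space \<mu> = inf_paths B"
  using sets_eq_imp_space_eq[OF sets_mu]
  by (simp add: borel_of_top_def space_measure_of_conv topspace_paths)

lemma open_sets: "openin (path_topology B) U \<Longrightarrow> U \<in> sets \<mu>"
  unfolding sets_mu borel_of_top_def
  by (subst sets_measure_of) (auto dest: openin_subset)

lemma prefix_fin_path: "x \<in> inf_paths B \<Longrightarrow> fin_path B (map x [0..<n])"
  using inf_pathD(1,2)[of x] by (auto simp: fin_path_def)

lemma shared_prefix_cylinder: "shared_prefix n x = cylinder B (map x [0..<n])"
  by (auto simp: shared_prefix_def cylinder_def)

lemma shared_prefix_open: "x \<in> inf_paths B \<Longrightarrow> openin (path_topology B) (shared_prefix n x)"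
  unfolding path_topology_def shared_prefix_cylinder
  by (rule topology_generated_by_Basis) (use prefix_fin_path in blast)

lemma locally_determined_sets:
  assumes "U \<subseteq> inf_paths B" "\<And>x. x \<in> U \<Longrightarrow> \<exists>n. shared_prefix n x \<subseteq> U"
  shows "U \<in> sets \<mu>"
proof -
  obtain n where n: "\<And>x. x \<in> U \<Longrightarrow> shared_prefix (n x) x \<subseteq> U" using assms(2) by metis
  have "U = (\<Union>x\<in>U. shared_prefix (n x) x)"
    using n assms(1) by (auto simp: shared_prefix_def)
  moreover have "openin (path_topology B) (\<Union>x\<in>U. shared_prefix (n x) x)"
    using shared_prefix_open assms(1) by (intro openin_Union) auto
  ultimately show ?thesis using open_sets by metis
qed

lemma shared_prefix_sets: "x \<in> inf_paths B \<Longrightarrow> shared_prefix n x \<in> sets \<mu>"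
  using shared_prefix_open open_sets by blast

lemma measure_shared_prefix:
  assumes x: "x \<in> inf_paths B" and n: "n \<ge> 1"
  shows "measure \<mu> (shared_prefix n x) = g (src B (Suc n) (x n)) / rad ^ (n - 1)"
proof -
  have "last (map x [0..<n]) = x (n - 1)" using n by (simp add: last_map)
  then show ?thesis unfolding shared_prefix_cylinder
    using measure_cylinder[OF prefix_fin_path[OF x], of n] n inf_pathD(2)[OF x, of "n - 1"] by simp
qed

lemma finite_prefixes: "finite ((\<lambda>x. map x [0..<n]) ` inf_paths B)"
proof (rule finite_subset)
  show "(\<lambda>x. map x [0..<n]) ` inf_paths B \<subseteq> {xs. set xs \<subseteq> (\<Union>i<n. edg B (Suc i)) \<and> length xs = n}"
  proof (intro image_subsetI CollectI conjI subsetI)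
    fix x e assume "x \<in> inf_paths B" "e \<in> set (map x [0..<n])"
    then show "e \<in> (\<Union>i<n. edg B (Suc i))" using inf_pathD(1)[of x] by force
  qed simp
  show "finite {xs. set xs \<subseteq> (\<Union>i<n. edg B (Suc i)) \<and> length xs = n}"
    by (rule finite_lists_length_eq) (use finite_edg in auto)
qed

lemma cylinder_sets: "x \<in> inf_paths B \<Longrightarrow> cylinder B (map x [0..<n]) \<in> sets \<mu>"
  using shared_prefix_sets by (simp add: shared_prefix_cylinder)

section \<open>The eigenvector and the radius of the class\<close>

lemma g_nonneg: "v < N \<Longrightarrow> g v \<ge> 0"
  using vector by (simp add: distinguished_vector_def)

lemma g_pos_iff: "v < N \<Longrightarrow> g v > 0 \<longleftrightarrow> has_access (transpose_mat F) (same_class (transpose_mat F) `` {v}) \<alpha>"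
  using vector by (simp add: distinguished_vector_def)

lemma g_pos: "a \<in> \<alpha> \<Longrightarrow> g a > 0"
  using g_pos_iff[of a] class_sub class_eq[of a] by (auto simp: has_access_def)

definition g_bound :: real where "g_bound = (\<Sum>v<N. g v)"

lemma g_le: "v < N \<Longrightarrow> g v \<le> g_bound"
  unfolding g_bound_def by (rule member_le_sum) (use g_nonneg in auto)

lemma g_bound_pos: "g_bound > 0"
proof -
  obtain a where "a \<in> \<alpha>" using class_ne by blast
  then show ?thesis using g_pos[of a] g_le[of a] class_sub by fastforce
qed

text \<open>Division by 0 yields 0 here, so with radius 0 the formula would give measure 0 to each
  of the finitely many cylinders of length 2, which cover the space. At length 1 the exponent is 0
  and nothing would follow.\<close>

lemma radius_nonzero: "rad \<noteq> 0"
proof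
  assume z: "rad = 0"
  let ?I = "(\<lambda>x. map x [0..<2]) ` inf_paths B"
  have "inf_paths B = (\<Union>p\<in>?I. cylinder B p)" 
    by (auto simp: cylinder_def) 
  moreover have "measure \<mu> (\<Union>p\<in>?I. cylinder B p) \<le> (\<Sum>p\<in>?I. measure \<mu> (cylinder B p))"
    by (rule finite_measure_subadditive_finite[OF finite_prefixes]) (use cylinder_sets in auto)
  moreover have "(\<Sum>p\<in>?I. measure \<mu> (cylinder B p)) = 0"
  proof (rule sum.neutral, rule ballI)
    fix p assume "p \<in> ?I"
    then obtain x where x: "x \<in> inf_paths B" "p = map x [0..<2]" by blast
    show "measure \<mu> (cylinder B p) = 0"
      unfolding x(2) shared_prefix_cylinder[symmetric] using measure_shared_prefix[OF x(1), of 2] z by simp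
  qed
  ultimately show False using prob_space space_mu by simp
qed

lemma radius_pos: "rad > 0"
  using radius_nonzero class_radius_nonneg by simp

text \<open>A closed walk of length \<open>k\<close> at \<open>a\<close> is appended again and
  again. Each stage keeps the edges already fixed, so the stages converge to a path returning to
  \<open>a\<close> every \<open>k\<close> levels.\<close>

lemma recurrent_path:
  assumes a: "a \<in> \<alpha>" and k: "k \<ge> 1" "(a, a) \<in> G ^^ k"
  shows "\<exists>x\<in>inf_paths B. \<forall>j. src B (Suc (1 + j * k)) (x (1 + j * k)) = a"
proof -
  have "\<exists>X. \<forall>j. (X j \<in> inf_paths B \<and> src B (Suc (1 + j * k)) (X j (1 + j * k)) = a) \<and>
     (\<forall>i<1 + j * k. X (Suc j) i = X j i)"
  proof (rule dependent_nat_choice)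
    have "a \<in> vtx B 1" using a class_sub vtx_eq[of 1] by auto
    then show "\<exists>x. x \<in> inf_paths B \<and> src B (Suc (1 + 0 * k)) (x (1 + 0 * k)) = a"
      using ex_path_through[of a 1] by auto
  next
    fix x j assume x: "x \<in> inf_paths B \<and> src B (Suc (1 + j * k)) (x (1 + j * k)) = a"
    then obtain y where y: "y \<in> inf_paths B" "\<forall>i<1 + j * k. y i = x i"
       "src B (Suc (1 + j * k + k)) (y (1 + j * k + k)) = a"
      using extend_relpow[of x "1 + j * k" a k] k(2) by auto
    have "1 + j * k + k = 1 + Suc j * k" by simp
    with y show "\<exists>y. (y \<in> inf_paths B \<and> src B (Suc (1 + Suc j * k)) (y (1 + Suc j * k)) = a) \<and>
        (\<forall>i<1 + j * k. y i = x i)" by metis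
  qed
  then obtain X where X: "\<And>j. X j \<in> inf_paths B" "\<And>j. src B (Suc (1 + j * k)) (X j (1 + j * k)) = a"
     "\<And>j i. i < 1 + j * k \<Longrightarrow> X (Suc j) i = X j i" by blast
  have stable: "X l i = X j i" if "j \<le> l" "i < 1 + j * k" for i j l
    using that(1)
  proof (induction l rule: dec_induct)
    case (step l)
    have "i < 1 + l * k" using that(2) mult_le_mono1[OF step(1), of k] by linarith
    then show ?case using X(3) step.IH by simp
  qed simp
  have ge: "i < 1 + i * k" for i using mult_le_mono2[OF k(1), of i] by linarith
  \<comment> \<open>Stage \<open>i\<close> has already fixed the edge of index \<open>i\<close>, as
    \<open>i < 1 + i * k\<close>.\<close>
  define x where "x = (\<lambda>i. X i i)"
  have xX: "x i = X j i" if "i < 1 + j * k" for i j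
    using stable[of i j i] stable[of j i i] ge[of i] that unfolding x_def by (metis nle_le)
  have "x \<in> inf_paths B"
    unfolding inf_paths_def mem_Collect_eq
  proof (intro allI)
    fix i
    have "x i = X (Suc i) i" "x (Suc i) = X (Suc i) (Suc i)"
      using xX[of i "Suc i"] xX[of "Suc i" "Suc i"] ge[of "Suc i"] by auto
    then show "x i \<in> edg B (Suc i) \<and> rng B (Suc i) (x i) = src B (Suc (Suc i)) (x (Suc i))"
      using inf_pathD(1,2)[OF X(1)] by simp
  qed
  moreover have "src B (Suc (1 + j * k)) (x (1 + j * k)) = a" for j
  proof -
    have "rng B (Suc (j * k)) (x (j * k)) = rng B (Suc (j * k)) (X j (j * k))" using xX[of "j * k" j] by simp
    then show ?thesis
      using inf_pathD(2)[OF X(1), of "j * k" j] inf_pathD(2)[OF \<open>x \<in> inf_paths B\<close>, of "j * k"] X(2)[of j] by simp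
  qed
  ultimately show ?thesis by blast
qed

text \<open>For radius at most 1, each of the infinitely many paths tail equivalent to a path that returns
  to \<open>\<alpha>\<close> forever would be an atom of mass bounded below.\<close>

lemma radius_gt_1: "rad > 1"
proof (rule ccontr)
  assume "\<not> ?thesis"
  then have le1: "rad \<le> 1" by simp
  obtain a where a: "a \<in> \<alpha>" using class_ne by blast
  obtain c where c: "c \<in> \<alpha>" "(a, c) \<in> G" using class_has_edge[OF radius_nonzero a] by blast
  obtain k where k: "k \<ge> 1" "(a, a) \<in> G ^^ k" using class_uniform_relpow[OF a c] a by blast
  from recurrent_path[OF a k] obtain x where x: "x \<in> inf_paths B"
    "\<And>j. src B (Suc (1 + j * k)) (x (1 + j * k)) = a" by blast
  have "infinite {y \<in> inf_paths B. tail_equivalent x y}" using aper x(1) by (auto simp: aperiodic_tail_relation_def)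
  \<comment> \<open>\<open>J\<close> disjoint cylinders of measure at least \<open>g a\<close> would
    have total measure above 1.\<close>
  obtain J :: nat where J: "1 / g a < real J" using reals_Archimedean2 by blast
  obtain Y where Y: "finite Y" "card Y = J" "Y \<subseteq> {y \<in> inf_paths B. tail_equivalent x y}"
    using infinite_arbitrarily_large[OF \<open>infinite {y \<in> inf_paths B. tail_equivalent x y}\<close>] by blast
  have "\<forall>\<^sub>F i in sequentially. \<forall>y\<in>Y. x i = y i"
    using Y(1,3) by (intro eventually_ball_finite) (auto simp: tail_equivalent_def)
  then obtain m0 where m0: "\<And>i y. i \<ge> m0 \<Longrightarrow> y \<in> Y \<Longrightarrow> x i = y i"
    by (auto simp: eventually_sequentially)
  \<comment> \<open>A level at which \<open>x\<close> is at \<open>a\<close> and from which on all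
    chosen paths agree with \<open>x\<close>; they are then told apart by their first
    \<open>m\<close> edges.\<close>
  define m where "m = 1 + m0 * k"
  have m: "m \<ge> m0" "m \<ge> 1" using k(1) by (auto simp: m_def intro: le_SucI)
  have meas: "measure \<mu> (shared_prefix m y) \<ge> g a" if "y \<in> Y" for y
  proof -
    have y: "y \<in> inf_paths B" using that Y(3) by blast
    have s: "src B (Suc m) (y m) = a" using m0[OF m(1) that] x(2)[of m0] by (simp add: m_def)
    have "0 < rad ^ (m - 1)" "rad ^ (m - 1) \<le> 1" using radius_pos le1 by (auto intro: power_le_one)
    then have "g a \<le> g a / rad ^ (m - 1)" using g_pos[OF a] by (simp add: le_divide_eq mult_left_le)
    then show ?thesis using measure_shared_prefix[OF y m(2)] s by simp
  qed
  have "disjoint_family_on (shared_prefix m) Y"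
  proof (unfold disjoint_family_on_def, intro ballI impI)
    fix y y' assume y: "y \<in> Y" "y' \<in> Y" "y \<noteq> y'"
    show "shared_prefix m y \<inter> shared_prefix m y' = {}"
    proof (rule ccontr)
      assume "shared_prefix m y \<inter> shared_prefix m y' \<noteq> {}"
      then have lo: "\<forall>i<m. y i = y' i" by (auto simp: shared_prefix_def)
      have hi: "y i = y' i" if "i \<ge> m" for i using m0[of i y] m0[of i y'] y m(1) that by simp
      have "y = y'" using lo hi by (metis ext not_le)
      then show False using y by simp
    qed
  qed
  then have "(\<Sum>y\<in>Y. measure \<mu> (shared_prefix m y)) = measure \<mu> (\<Union>y\<in>Y. shared_prefix m y)"
    using Y shared_prefix_sets by (intro finite_measure_finite_Union[symmetric]) auto
  also have "\<dots> \<le> 1" by (rule prob_le_1)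
  finally have "(\<Sum>y\<in>Y. measure \<mu> (shared_prefix m y)) \<le> 1" .
  moreover have "real J * g a \<le> (\<Sum>y\<in>Y. measure \<mu> (shared_prefix m y))"
    using sum_bounded_below[of Y "g a" "\<lambda>y. measure \<mu> (shared_prefix m y)"] meas Y(2) by simp
  ultimately show False using J g_pos[OF a] by (simp add: field_simps)
qed

section \<open>The Vershik map is defined almost everywhere\<close>

lemma measure_small_of_bounded_prefixes:
  assumes Q: "Q \<subseteq> inf_paths B" "Q \<in> sets \<mu>" and n: "n \<ge> 1"
    and key: "\<And>m x. m \<ge> n \<Longrightarrow> x \<in> Q \<Longrightarrow> key m x \<le> (H :: nat)"
    and inj: "\<And>m x y. m \<ge> n \<Longrightarrow> x \<in> Q \<Longrightarrow> y \<in> Q \<Longrightarrow> src B (Suc m) (x m) = src B (Suc m) (y m) \<Longrightarrow>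
       key m x = key m y \<Longrightarrow> pos m x = pos m y"
  shows "measure \<mu> Q = 0"
proof -
  \<comment> \<open>End vertex and \<open>key\<close> determine the position and thus the prefix, so
    the paths in \<open>Q\<close> have at most \<open>N * (H + 1)\<close> prefixes of length
    \<open>m\<close>. Each has measure at most \<open>g_bound / rad ^ (m - 1)\<close>, which tends
    to 0.\<close>
  define C where "C = real (N * (H + 1)) * g_bound"
  have bound: "measure \<mu> Q \<le> C * (1 / rad) ^ (m - 1)" if m: "m \<ge> n" for m
  proof -
    have m1: "m \<ge> 1" using m n by simp
    let ?pref = "\<lambda>x. map x [0..<m]" and ?key = "\<lambda>x. (src B (Suc m) (x m), key m x)"
    have fin: "finite (?pref ` Q)" by (rule finite_subset[OF image_mono[OF Q(1)] finite_prefixes])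
    have sub: "?key ` Q \<subseteq> {..<N} \<times> {..H}" using key[OF m] src_less[OF _ m1] Q(1) by auto
    have "?pref ` Q \<subseteq> (\<lambda>k. ?pref (SOME x. x \<in> Q \<and> ?key x = k)) ` (?key ` Q)"
    proof
      fix p assume "p \<in> ?pref ` Q"
      then obtain x where x: "x \<in> Q" "p = ?pref x" by blast
      define y where "y = (SOME y. y \<in> Q \<and> ?key y = ?key x)"
      have y: "y \<in> Q" "?key y = ?key x" unfolding y_def
        using someI[of "\<lambda>y. y \<in> Q \<and> ?key y = ?key x" x] x(1) by auto
      have "y \<in> inf_paths B" "x \<in> inf_paths B" using y(1) x(1) Q(1) by auto
      moreover have s: "src B (Suc m) (y m) = src B (Suc m) (x m)" "key m y = key m x"
        using y(2) by auto
      moreover have "pos m y = pos m x" by (rule inj[OF m y(1) x(1) s])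
      ultimately have "\<forall>i<m. y i = x i" by (intro pos_inj)
      then have "p = ?pref y" using x(2) by simp
      then show "p \<in> (\<lambda>k. ?pref (SOME x. x \<in> Q \<and> ?key x = k)) ` (?key ` Q)"
        unfolding y_def by (rule image_eqI) (rule imageI[OF x(1)])
    qed
    then have "card (?pref ` Q) \<le> card (?key ` Q)"
      by (rule surj_card_le[rotated]) (use finite_subset[OF sub] in simp)
    also have "\<dots> \<le> N * (H + 1)"
      using card_mono[OF _ sub] by (simp add: card_cartesian_product)
    finally have crd: "card (?pref ` Q) \<le> N * (H + 1)" .
    have "measure \<mu> Q \<le> measure \<mu> (\<Union>p\<in>?pref ` Q. cylinder B p)"
    proof (rule finite_measure_mono)
      show "Q \<subseteq> (\<Union>p\<in>?pref ` Q. cylinder B p)" using Q(1) by (auto simp: cylinder_def)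
      show "(\<Union>p\<in>?pref ` Q. cylinder B p) \<in> sets \<mu>"
        using fin cylinder_sets Q(1) by (intro sets.finite_UN) auto
    qed
    also have "\<dots> \<le> (\<Sum>p\<in>?pref ` Q. measure \<mu> (cylinder B p))"
      by (rule finite_measure_subadditive_finite[OF fin]) (use cylinder_sets Q(1) in auto)
    also have "\<dots> \<le> real (card (?pref ` Q)) * (g_bound / rad ^ (m - 1))"
    proof (rule sum_bounded_above)
      fix p assume "p \<in> ?pref ` Q"
      then obtain x where x: "x \<in> inf_paths B" "p = ?pref x" using Q(1) by blast
      show "measure \<mu> (cylinder B p) \<le> g_bound / rad ^ (m - 1)"
        unfolding x(2) shared_prefix_cylinder[symmetric] measure_shared_prefix[OF x(1) m1]
        using g_le[OF src_less[OF x(1) m1]] radius_pos by (intro divide_right_mono) auto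
    qed
    also have "\<dots> \<le> real (N * (H + 1)) * (g_bound / rad ^ (m - 1))"
      using crd g_bound_pos radius_pos by (intro mult_right_mono) (simp_all only: of_nat_le_iff, simp)
    finally show ?thesis by (simp add: C_def power_one_over)
  qed
  have "(\<lambda>j. (1 / rad) ^ j) \<longlonglongrightarrow> 0" using radius_gt_1 by (intro LIMSEQ_power_zero) simp
  then have "(\<lambda>j. C * (1 / rad) ^ j) \<longlonglongrightarrow> C * 0" by (intro tendsto_mult tendsto_const)
  moreover have "\<forall>\<^sub>F j in sequentially. measure \<mu> Q \<le> C * (1 / rad) ^ j"
    unfolding eventually_sequentially
  proof (intro exI[of _ n] allI impI)
    fix j assume "n \<le> j"
    then show "measure \<mu> Q \<le> C * (1 / rad) ^ j" using bound[of "Suc j"] by simp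
  qed
  ultimately have "measure \<mu> Q \<le> C * 0" by (rule tendsto_lowerbound) simp
  then show ?thesis using measure_nonneg[of \<mu> Q] by simp
qed

lemma eventually_edge_sets: "{x \<in> inf_paths B. \<forall>i\<ge>n. P i (x i)} \<in> sets \<mu>"
proof -
  have "{x \<in> inf_paths B. \<not> P i (x i)} \<in> sets \<mu>" for i
    by (rule locally_determined_sets) (auto simp: shared_prefix_def intro!: exI[of _ "Suc i"])
  then have "space \<mu> - (\<Union>i\<in>{n..}. {x \<in> inf_paths B. \<not> P i (x i)}) \<in> sets \<mu>" by (intro sets.Diff) auto
  also have "space \<mu> - (\<Union>i\<in>{n..}. {x \<in> inf_paths B. \<not> P i (x i)}) = {x \<in> inf_paths B. \<forall>i\<ge>n. P i (x i)}"
    by (auto simp: space_mu)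
  finally show ?thesis .
qed

lemma hgt_le_sum: "v < N \<Longrightarrow> hgt n v \<le> (\<Sum>v<N. hgt n v)"
  by (rule member_le_sum) auto

text \<open>The distance of the position to the top stays constant along maximal edges, so it is
  bounded by the heights at level \<open>n\<close>. The subtraction is exact since positions lie
  strictly below heights.\<close>

lemma eventually_max_null: "n \<ge> 1 \<Longrightarrow> measure \<mu> {x \<in> inf_paths B. \<forall>i\<ge>n. max_edge B (Suc i) (x i)} = 0"
proof (rule measure_small_of_bounded_prefixes[where n = n and H = "\<Sum>v<N. hgt n v"
      and key = "\<lambda>m x. hgt m (src B (Suc m) (x m)) - pos m x"])
  let ?Q = "{x \<in> inf_paths B. \<forall>i\<ge>n. max_edge B (Suc i) (x i)}"
  assume n: "n \<ge> 1"
  fix m x assume m: "m \<ge> n" and x: "x \<in> ?Q"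
  then have "pos m x + hgt n (src B (Suc n) (x n)) = pos n x + hgt m (src B (Suc m) (x m))"
    by (intro pos_max_from) auto
  moreover have "hgt n (src B (Suc n) (x n)) \<le> (\<Sum>v<N. hgt n v)"
    using hgt_le_sum src_less[of x n] x n by blast
  ultimately show "hgt m (src B (Suc m) (x m)) - pos m x \<le> (\<Sum>v<N. hgt n v)" by linarith
next
  fix m x y assume x: "x \<in> {x \<in> inf_paths B. \<forall>i\<ge>n. max_edge B (Suc i) (x i)}"
    and y: "y \<in> {x \<in> inf_paths B. \<forall>i\<ge>n. max_edge B (Suc i) (x i)}"
    and s: "src B (Suc m) (x m) = src B (Suc m) (y m)"
    and d: "hgt m (src B (Suc m) (x m)) - pos m x = hgt m (src B (Suc m) (y m)) - pos m y"
  have "pos m x < hgt m (src B (Suc m) (x m))" "pos m y < hgt m (src B (Suc m) (x m))"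
    using pos_less[of x m] pos_less[of y m] x y s by simp_all
  then show "pos m x = pos m y" using d unfolding s by linarith
qed (rule eventually_edge_sets | blast)+

text \<open>Minimal edges contribute nothing to the position, which therefore stays below the
  heights at level \<open>n\<close>.\<close>

lemma eventually_min_null: "n \<ge> 1 \<Longrightarrow> measure \<mu> {x \<in> inf_paths B. \<forall>i\<ge>n. min_edge B (Suc i) (x i)} = 0"
proof (rule measure_small_of_bounded_prefixes[where n = n and H = "\<Sum>v<N. hgt n v" and key = pos])
  let ?Q = "{x \<in> inf_paths B. \<forall>i\<ge>n. min_edge B (Suc i) (x i)}"
  assume n: "n \<ge> 1"
  fix m x assume m: "m \<ge> n" and x: "x \<in> ?Q"
  have "offset n m x = 0" using x by (auto simp: offset_def jump_min)
  then have "pos m x = pos n x" using pos_split[OF m, of x] by simp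
  moreover have "pos n x < hgt n (src B (Suc n) (x n))" using pos_less x by blast
  moreover have "hgt n (src B (Suc n) (x n)) \<le> (\<Sum>v<N. hgt n v)"
    using hgt_le_sum src_less[of x n] x n by blast
  ultimately show "pos m x \<le> (\<Sum>v<N. hgt n v)" by linarith
qed (rule eventually_edge_sets | blast)+

lemma vershik_domain_full:
  shows "vershik_domain B \<in> sets \<mu>" "measure \<mu> (vershik_domain B) = 1"
proof -
  let ?X = "\<lambda>n. {x \<in> inf_paths B. \<forall>i\<ge>n. max_edge B (Suc i) (x i)}"
  let ?Y = "\<lambda>n. {x \<in> inf_paths B. \<forall>i\<ge>n. min_edge B (Suc i) (x i)}"
  \<comment> \<open>The null sets are available from level 1 on; as they grow with the level,
    nothing is lost by starting there.\<close>
  let ?Z = "(\<Union>n. ?X (Suc n)) \<union> (\<Union>n. ?Y (Suc n))"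
  have dom: "vershik_domain B = space \<mu> - ?Z"
  proof (rule subset_antisym; rule subsetI)
    fix x assume "x \<in> vershik_domain B"
    then show "x \<in> space \<mu> - ?Z" unfolding vershik_domain_eq space_mu by blast
  next
    fix x assume x: "x \<in> space \<mu> - ?Z"
    have "\<exists>i\<ge>n. \<not> max_edge B (Suc i) (x i)" "\<exists>i\<ge>n. \<not> min_edge B (Suc i) (x i)" for n
      using x Suc_leD unfolding space_mu by blast+
    then show "x \<in> vershik_domain B" using x by (auto simp: vershik_domain_eq space_mu)
  qed
  have XY: "?X n \<in> sets \<mu>" "?Y n \<in> sets \<mu>" for n by (rule eventually_edge_sets)+
  have Z: "?Z \<in> sets \<mu>" using XY by blast
  have "1 \<le> Suc n" for n by simp
  note null = eventually_max_null[OF this] eventually_min_null[OF this]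
  have "?X (Suc n) \<in> null_sets \<mu>" for n
    by (rule null_setsI) (simp_all only: XY emeasure_eq_measure null ennreal_0)
  moreover have "?Y (Suc n) \<in> null_sets \<mu>" for n
    by (rule null_setsI) (simp_all only: XY emeasure_eq_measure null ennreal_0)
  ultimately have "?Z \<in> null_sets \<mu>" by (intro null_sets.Un null_sets_UN)
  then have mZ: "measure \<mu> ?Z = 0" by (rule measure_eq_0_null_sets)
  show "vershik_domain B \<in> sets \<mu>" unfolding dom using Z by (rule sets.compl_sets)
  show "measure \<mu> (vershik_domain B) = 1" unfolding dom prob_compl[OF Z] mZ by simp
qed

text \<open>Each pair of segments from \<open>a\<close> back to \<open>a\<close> doubles the height.
  Since displacements are at least heights, this makes them arbitrarily large.\<close>

lemma hgt_unbounded: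
  assumes a: "a \<in> \<alpha>" and K: "K \<ge> 1" "\<And>n. n \<ge> 1 \<Longrightarrow> \<exists>x\<in>inf_paths B. \<exists>z\<in>inf_paths B. 
     src B (Suc n) (x n) = a \<and> src B (Suc n) (z n) = a \<and>
    src B (Suc (n + K)) (x (n + K)) = a \<and> (\<forall>i\<ge>n + K. x i = z i) \<and> (\<exists>i. n \<le> i \<and> i < n + K \<and> x i \<noteq> z i)"
  shows "2 ^ j \<le> hgt (1 + j * K) a"
proof (induction j)
  case 0
  have "a \<in> vtx B 1" using a class_sub vtx_eq[of 1] by auto
  then obtain x where "x \<in> inf_paths B" "src B (Suc 1) (x 1) = a" using ex_path_through[of a 1] by blast
  then show ?case using pos_less[of x 1] by (simp del: hgt.simps)
next
  case (Suc j)
  obtain x z where xz: "x \<in> inf_paths B" "z \<in> inf_paths B" 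
    "src B (Suc (1 + j * K)) (x (1 + j * K)) = a" "src B (Suc (1 + j * K)) (z (1 + j * K)) = a"
    "src B (Suc (1 + j * K + K)) (x (1 + j * K + K)) = a" "\<forall>i\<ge>1 + j * K + K. x i = z i"
    "\<exists>i. 1 + j * K \<le> i \<and> i < 1 + j * K + K \<and> x i \<noteq> z i"
    using K(2)[OF le_add1[of 1 "j * K"]] by blast
  have "2 * hgt (1 + j * K) a \<le> hgt (1 + j * K + K) a"
    using hgt_double[OF xz(1,2) le_add1 _ xz(6,7)] unfolding xz(3-5) by blast
  moreover have "1 + Suc j * K = 1 + j * K + K" by simp
  ultimately show ?case using Suc by (simp only: power_Suc)
qed

end

section \<open>Overlap of a cylinder with its translates\<close>

context distinguished_system begin

lemma measure_inter_domain:
  assumes A: "A \<in> sets \<mu>"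
  shows "measure \<mu> (A \<inter> vershik_domain B) = measure \<mu> A"
proof (rule antisym)
  note dom = vershik_domain_full
  have "measure \<mu> (space \<mu> - vershik_domain B) = 0" using prob_compl[OF dom(1)] dom(2) by simp
  moreover have "measure \<mu> A \<le> measure \<mu> ((A \<inter> vershik_domain B) \<union> (space \<mu> - vershik_domain B))"
    using A dom(1) sets.sets_into_space[OF A] by (intro finite_measure_mono) auto
  moreover have "\<dots> \<le> measure \<mu> (A \<inter> vershik_domain B) + measure \<mu> (space \<mu> - vershik_domain B)"
    using A dom(1) by (intro measure_Un_le) auto
  ultimately show "measure \<mu> A \<le> measure \<mu> (A \<inter> vershik_domain B)" by linarith
  show "measure \<mu> (A \<inter> vershik_domain B) \<le> measure \<mu> A"
    using A by (intro finite_measure_mono) auto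
qed

text \<open>\<open>T\<close> is relatively open in the domain, and the set \<open>U\<close> is an
  open set whose trace on the domain is \<open>T\<close>.\<close>

lemma locally_determined_in_domain_sets:
  assumes T: "T \<subseteq> vershik_domain B" and loc: "\<And>x. x \<in> T \<Longrightarrow> \<exists>n. shared_prefix n x \<inter> vershik_domain B \<subseteq> T"
  shows "T \<in> sets \<mu>"
proof -
  define U where "U = {x \<in> inf_paths B. \<exists>n. shared_prefix n x \<inter> vershik_domain B \<subseteq> T}"
  have "U \<in> sets \<mu>"
  proof (rule locally_determined_sets)
    fix x assume "x \<in> U"
    then obtain n where n: "shared_prefix n x \<inter> vershik_domain B \<subseteq> T" by (auto simp: U_def)
    have "shared_prefix n x \<subseteq> U"
    proof
      fix y assume y: "y \<in> shared_prefix n x"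
      then have "shared_prefix n y = shared_prefix n x" by (auto simp: shared_prefix_def)
      moreover have "y \<in> inf_paths B" using y by (simp add: shared_prefix_def)
      ultimately show "y \<in> U" using n unfolding U_def by blast
    qed
    then show "\<exists>n. shared_prefix n x \<subseteq> U" by blast
  qed (auto simp: U_def)
  moreover have "T = U \<inter> vershik_domain B"
  proof
    show "T \<subseteq> U \<inter> vershik_domain B" using T loc vershik_domain_nonmax(1) by (auto simp: U_def)
    show "U \<inter> vershik_domain B \<subseteq> T"
      unfolding U_def by (auto simp: shared_prefix_def)
  qed
  ultimately show ?thesis using vershik_domain_full(1) by simp
qed

lemma overlap_sets:
  assumes x0: "x0 \<in> inf_paths B"
  shows "(vershik B ^^ D) -` (shared_prefix m x0 \<inter> vershik_domain B) \<inter> vershik_domain B \<inter>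
     (shared_prefix m x0 \<inter> vershik_domain B) \<in> sets \<mu>" (is "?T \<in> _")
proof (rule locally_determined_in_domain_sets)
  fix x assume x: "x \<in> ?T"
  then obtain n' where n': "\<forall>y\<in>vershik_domain B. (\<forall>i<n'. y i = x i) \<longrightarrow>
      (\<forall>i<m. (vershik B ^^ D) y i = (vershik B ^^ D) x i)"
    using vershik_pow_local[of x m D] by blast
  have "shared_prefix (max n' m) x \<inter> vershik_domain B \<subseteq> ?T"
  proof
    fix y assume y: "y \<in> shared_prefix (max n' m) x \<inter> vershik_domain B"
    then have "\<forall>i<m. (vershik B ^^ D) y i = (vershik B ^^ D) x i" using n' by (auto simp: shared_prefix_def)
    moreover have "(vershik B ^^ D) y \<in> vershik_domain B" using vershik_pow_in_domain y by blast
    ultimately show "y \<in> ?T"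
      using x y vershik_domain_nonmax(1) by (auto simp: shared_prefix_def)
  qed
  then show "\<exists>n. shared_prefix n x \<inter> vershik_domain B \<subseteq> ?T" by blast
qed blast

text \<open>Almost every path in the cylinder is in a vertex of \<open>\<alpha>\<close> at level \<open>n\<close>. From there it is continued
  to \<open>a\<close> in \<open>k\<close> steps and then through the first of the two segments; moving all these paths to the
  second segment is a single power of the Vershik map, and the continuation costs a factor that
  does not depend on the cylinder.\<close>

lemma displacement_overlap:
  assumes a: "a \<in> \<alpha>" and k: "\<forall>v\<in>\<alpha>. \<forall>w\<in>\<alpha>. (v, w) \<in> G ^^ k"
    and K: "K \<ge> 1" "\<And>n. n \<ge> 1 \<Longrightarrow> \<exists>x\<in>inf_paths B. \<exists>z\<in>inf_paths B. 
     src B (Suc n) (x n) = a \<and> src B (Suc n) (z n) = a \<and>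
    src B (Suc (n + K)) (x (n + K)) = a \<and> (\<forall>i\<ge>n + K. x i = z i) \<and> (\<exists>i. n \<le> i \<and> i < n + K \<and> x i \<noteq> z i)"
    and x0: "x0 \<in> inf_paths B" "src B (Suc m) (x0 m) = a" "m \<ge> 1"
  shows "\<exists>D\<ge>D0. g a / (g_bound * rad ^ (k + K)) * measure \<mu> (shared_prefix m x0) \<le>
    measure \<mu> ((vershik B ^^ D) -` (shared_prefix m x0 \<inter> vershik_domain B) \<inter> vershik_domain B \<inter>
     (shared_prefix m x0 \<inter> vershik_domain B))"
proof -
  \<comment> \<open>\<open>n'\<close> is a level where the height of \<open>a\<close> is at least
    \<open>2 ^ j\<close>, hence above \<open>D0\<close>. It exceeds \<open>j\<close>, so going back
    \<open>k\<close> levels to \<open>n\<close> still leaves all \<open>m\<close> edges of the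
    cylinder before \<open>n\<close>.\<close>
  define j where "j = m + k + D0"
  define n' where "n' = 1 + j * K"
  define n where "n = n' - k"
  have "j * 1 \<le> j * K" using K(1) by (rule mult_le_mono2)
  then have jn: "j < n'" unfolding n'_def by linarith
  then have nk: "n + k = n'" "m \<le> n" "1 \<le> n" "1 \<le> n'" using x0(3) by (auto simp: n_def j_def)
  have "\<exists>x\<in>inf_paths B. \<exists>z\<in>inf_paths B. 
     src B (Suc n') (x n') = a \<and> src B (Suc n') (z n') = a \<and>
    src B (Suc (n' + K)) (x (n' + K)) = a \<and> (\<forall>i\<ge>n' + K. x i = z i) \<and>
     (\<exists>i. n' \<le> i \<and> i < n' + K \<and> x i \<noteq> z i) \<and> offset n' (n' + K) x \<le> offset n' (n' + K) z"
  proof -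
    from K(2)[OF nk(4)] obtain x z where xz: "x \<in> inf_paths B" "z \<in> inf_paths B" "src B (Suc n') (x n') = a"
      "src B (Suc n') (z n') = a" "src B (Suc (n' + K)) (x (n' + K)) = a" "\<forall>i\<ge>n' + K. x i = z i"
      "\<exists>i. n' \<le> i \<and> i < n' + K \<and> x i \<noteq> z i" by blast
    show ?thesis
    proof (cases "offset n' (n' + K) x \<le> offset n' (n' + K) z")
      case True
      then show ?thesis using xz by blast
    next
      case False
      have "src B (Suc (n' + K)) (z (n' + K)) = a" using xz(5,6) by simp
      moreover have "\<forall>i\<ge>n' + K. z i = x i" using xz(6) by simp
      moreover have "\<exists>i. n' \<le> i \<and> i < n' + K \<and> z i \<noteq> x i" using xz(7) by metis
      moreover have "offset n' (n' + K) z \<le> offset n' (n' + K) x" using False by simp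
      ultimately show ?thesis using xz(1-4) by blast
    qed
  qed
  then obtain x z where x: "x \<in> inf_paths B" "src B (Suc n') (x n') = a" "src B (Suc (n' + K)) (x (n' + K)) = a"
    and z: "z \<in> inf_paths B" "src B (Suc n') (z n') = a" and tl: "\<forall>i\<ge>n' + K. x i = z i"
    and ne: "\<exists>i. n' \<le> i \<and> i < n' + K \<and> x i \<noteq> z i" and le: "offset n' (n' + K) x \<le> offset n' (n' + K) z"
    by blast
  define D where "D = offset n' (n' + K) z - offset n' (n' + K) x"
  have gap: "offset n' (n' + K) x + hgt n' a \<le> offset n' (n' + K) z"
    using offset_gap[OF x(1) z(1) le_add1 _ tl ne le] x(2) z(2) by simp
  have "2 ^ j \<le> hgt n' a" unfolding n'_def by (rule hgt_unbounded[OF a K])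
  moreover have "D0 \<le> j" "j < 2 ^ j" by (simp_all add: j_def)
  ultimately have D: "D \<ge> D0" "offset n' (n' + K) z = offset n' (n' + K) x + D"
    using gap le unfolding D_def by linarith+
  let ?E = "shared_prefix m x0"
  let ?T = "(vershik B ^^ D) -` (?E \<inter> vershik_domain B) \<inter> vershik_domain B \<inter> (?E \<inter> vershik_domain B)"
  let ?pref = "\<lambda>y. map y [0..<n]"
  define c where "c = g a / (g_bound * rad ^ (k + K))"
  have c: "c \<ge> 0" unfolding c_def using g_pos[OF a] g_bound_pos radius_pos by simp
  have E_src: "src B (Suc m) (y m) = a" if "y \<in> ?E" for y
  proof -
    have "y \<in> inf_paths B" "y (m - 1) = x0 (m - 1)" using that x0(3) by (auto simp: shared_prefix_def)
    then show ?thesis using inf_pathD(2)[of y "m - 1"] inf_pathD(2)[OF x0(1), of "m - 1"] x0(2,3) by simp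
  qed
  have finP: "finite (?pref ` ?E)"
    by (rule finite_subset[OF image_mono finite_prefixes]) (auto simp: shared_prefix_def)
  \<comment> \<open>Only prefixes of positive measure are certain to end in \<open>\<alpha>\<close>:
    their end vertex is reachable from \<open>a\<close> and has a positive eigenvector entry, hence
    access to \<open>\<alpha>\<close>.\<close>
  define I where "I = {p \<in> ?pref ` ?E. measure \<mu> (cylinder B p) > 0}"
  have finI: "finite I" unfolding I_def using finP by simp
  have "\<exists>w. w \<in> inf_paths B \<and> w \<in> ?E \<and> ?pref w = p \<and> (\<forall>i\<ge>n'. w i = x i)" if p: "p \<in> I" for p
  proof -
    obtain y where y: "y \<in> ?E" "p = ?pref y" "measure \<mu> (cylinder B (?pref y)) > 0" using p by (auto simp: I_def)
    have yi: "y \<in> inf_paths B" using y(1) by (simp add: shared_prefix_def)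
    let ?v = "src B (Suc n) (y n)"
    have "g ?v > 0"
      using y(3) measure_shared_prefix[OF yi nk(3)] radius_pos
      by (simp add: shared_prefix_cylinder[symmetric] zero_less_divide_iff)
    then have acc: "has_access (transpose_mat F) (same_class (transpose_mat F) `` {?v}) \<alpha>"
      using g_pos_iff src_less[OF yi nk(3)] by blast
    have "(a, ?v) \<in> G\<^sup>*" using path_reach[OF yi x0(3) nk(2)] E_src[OF y(1)] by simp
    then have "?v \<in> \<alpha>" using has_access_class[OF a src_less[OF yi nk(3)] _ acc] by blast
    then obtain y1 where y1: "y1 \<in> inf_paths B" "\<forall>i<n. y1 i = y i" "src B (Suc n') (y1 n') = a"
      using extend_relpow[OF yi nk(3), of a k] k a nk(1) by auto
    let ?w = "\<lambda>i. if i < n' then y1 i else x i"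
    have w: "?w \<in> inf_paths B" by (rule splice_in_inf_paths[OF y1(1) x(1)]) (simp add: y1 x)
    have "\<forall>i<n. ?w i = y i" using y1(2) nk(1) by auto
    then have "?pref ?w = p" "?w \<in> ?E" using y(1,2) w nk(2) by (auto simp: shared_prefix_def)
    then show ?thesis using w by (intro exI[of _ ?w]) auto
  qed
  then obtain W where W: "\<And>p. p \<in> I \<Longrightarrow> W p \<in> inf_paths B" "\<And>p. p \<in> I \<Longrightarrow> W p \<in> ?E"
    "\<And>p. p \<in> I \<Longrightarrow> ?pref (W p) = p" "\<And>p i. p \<in> I \<Longrightarrow> i \<ge> n' \<Longrightarrow> W p i = x i" by metis
  let ?C = "\<lambda>p. shared_prefix (n' + K) (W p)"
  have inT: "(\<Union>p\<in>I. ?C p) \<inter> vershik_domain B \<subseteq> ?T"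
  proof
    fix y assume "y \<in> (\<Union>p\<in>I. ?C p) \<inter> vershik_domain B"
    then obtain p where p: "p \<in> I" "y \<in> ?C p" and yd: "y \<in> vershik_domain B" by blast
    have yi: "y \<in> inf_paths B" and yW: "\<And>i. i < n' + K \<Longrightarrow> y i = W p i" using p(2) by (auto simp: shared_prefix_def)
    have yx: "y i = x i" if "n' \<le> i" "i < n' + K" for i using yW W(4)[OF p(1)] that by simp
    have sy: "src B (Suc n') (y n') = a" using yx[of n'] K(1) x(2) by simp
    have sK: "src B (Suc (n' + K)) (y (n' + K)) = a"
      using inf_pathD(2)[OF yi, of "n' + K - 1"] inf_pathD(2)[OF x(1), of "n' + K - 1"] yx[of "n' + K - 1"] K(1) x(3) by simp
    \<comment> \<open>Two splices, one at each end of the segment, replace the segment of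
      \<open>x\<close> in \<open>y\<close> by that of \<open>z\<close>. The edges before and after
      it are untouched, so the position rises by exactly \<open>D\<close>.\<close>
    let ?u = "\<lambda>i. if i < n' then y i else z i"
    have u: "?u \<in> inf_paths B" by (rule splice_in_inf_paths[OF yi z(1)]) (simp add: sy z)
    let ?y' = "\<lambda>i. if i < n' + K then ?u i else y i"
    have y': "?y' \<in> inf_paths B"
      by (rule splice_in_inf_paths[OF u yi]) (use sK x(3) tl in simp)
    have "pos (n' + K) y = pos n' y + offset n' (n' + K) x"
      using pos_split[of n' "n' + K" y] offset_cong[of n' "n' + K" y x] yx by simp
    moreover have "pos (n' + K) ?y' = pos n' ?y' + offset n' (n' + K) z"
      using pos_split[of n' "n' + K" ?y'] offset_cong[of n' "n' + K" ?y' z] by simp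
    moreover have "pos n' ?y' = pos n' y" unfolding pos_def by simp
    ultimately have "pos (n' + K) ?y' = pos (n' + K) y + D" using D(2) by linarith
    then have "(vershik B ^^ D) y = ?y'"
      by (intro vershik_iterate_eq[OF yi y']) auto
    moreover have yE: "y \<in> ?E" using W(2)[OF p(1)] yW yi nk by (auto simp: shared_prefix_def)
    then have "?y' \<in> ?E" using y' nk by (auto simp: shared_prefix_def)
    ultimately show "y \<in> ?T" using yd yE vershik_pow_in_domain[OF yd, of D] by simp
  qed
  have disj: "disjoint_family_on ?C I"
  proof (unfold disjoint_family_on_def, intro ballI impI)
    fix p q assume pq: "p \<in> I" "q \<in> I" "p \<noteq> q"
    show "?C p \<inter> ?C q = {}"
    proof (rule ccontr)
      assume "?C p \<inter> ?C q \<noteq> {}"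
      then have "\<forall>i<n' + K. W p i = W q i" by (auto simp: shared_prefix_def)
      then have "?pref (W p) = ?pref (W q)" using nk(1) by simp
      then show False using W(3) pq by simp
    qed
  qed
  have Csets: "?C p \<in> sets \<mu>" if "p \<in> I" for p using W(1)[OF that] shared_prefix_sets by blast
  \<comment> \<open>The numerator falls from at most \<open>g_bound\<close> to \<open>g a\<close>
    and the exponent grows by \<open>k + K\<close>; \<open>c\<close> is this worst ratio.\<close>
  have each: "c * measure \<mu> (cylinder B p) \<le> measure \<mu> (?C p)" if p: "p \<in> I" for p
  proof -
    have "src B (Suc (n' + K)) (W p (n' + K)) = a" using W(4)[OF p] x(3) by simp
    then have "measure \<mu> (?C p) = g a / rad ^ (n' + K - 1)"
      using measure_shared_prefix[OF W(1)[OF p], of "n' + K"] nk(4) by simp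
    moreover have "measure \<mu> (cylinder B p) \<le> g_bound / rad ^ (n - 1)"
      using measure_shared_prefix[OF W(1)[OF p] nk(3)] W(3)[OF p] g_le[OF src_less[OF W(1)[OF p] nk(3)]]
        radius_pos by (simp add: shared_prefix_cylinder divide_right_mono)
    then have "c * measure \<mu> (cylinder B p) \<le> c * (g_bound / rad ^ (n - 1))"
      using c by (rule mult_left_mono)
    moreover have "n' + K - 1 = (k + K) + (n - 1)" using nk by simp
    then have "c * (g_bound / rad ^ (n - 1)) = g a / rad ^ (n' + K - 1)"
      unfolding c_def using g_bound_pos radius_pos by (simp add: power_add)
    ultimately show ?thesis by simp
  qed
  have "measure \<mu> ?E \<le> measure \<mu> (\<Union>p\<in>?pref ` ?E. cylinder B p)"
  proof (rule finite_measure_mono)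
    show "?E \<subseteq> (\<Union>p\<in>?pref ` ?E. cylinder B p)" by (auto simp: cylinder_def shared_prefix_def)
    show "(\<Union>p\<in>?pref ` ?E. cylinder B p) \<in> sets \<mu>"
      by (rule sets.finite_UN[OF finP]) (auto simp: shared_prefix_def intro: cylinder_sets)
  qed
  also have "\<dots> \<le> (\<Sum>p\<in>?pref ` ?E. measure \<mu> (cylinder B p))"
    by (rule finite_measure_subadditive_finite[OF finP]) (auto simp: shared_prefix_def intro: cylinder_sets)
  also have "\<dots> = (\<Sum>p\<in>I. measure \<mu> (cylinder B p))"
  proof (rule sum.mono_neutral_right[OF finP])
    show "\<forall>p\<in>?pref ` ?E - I. measure \<mu> (cylinder B p) = 0"
      using measure_nonneg[of \<mu>] by (auto simp: I_def not_less intro: antisym)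
  qed (auto simp: I_def)
  finally have "c * measure \<mu> ?E \<le> (\<Sum>p\<in>I. c * measure \<mu> (cylinder B p))"
    using c by (simp add: sum_distrib_left[symmetric] mult_left_mono)
  also have "\<dots> \<le> (\<Sum>p\<in>I. measure \<mu> (?C p))" by (rule sum_mono) (rule each)
  also have "\<dots> = measure \<mu> (\<Union>p\<in>I. ?C p)"
    using finI Csets disj by (intro finite_measure_finite_Union[symmetric]) auto
  also have "\<dots> = measure \<mu> ((\<Union>p\<in>I. ?C p) \<inter> vershik_domain B)"
    using finI Csets by (intro measure_inter_domain[symmetric] sets.finite_UN) auto
  also have "\<dots> \<le> measure \<mu> ?T" by (rule finite_measure_mono[OF inT overlap_sets[OF x0(1)]])
  finally show ?thesis using D(1) unfolding c_def by blast
qed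

theorem vershik_not_strongly_mixing:
  "\<not> strongly_mixing (restrict_space \<mu> (vershik_domain B)) (vershik B)"
proof
  let ?dom = "vershik_domain B"
  let ?\<rho> = "restrict_space \<mu> ?dom"
  assume mix: "strongly_mixing ?\<rho> (vershik B)"
  have dom: "?dom \<inter> space \<mu> \<in> sets \<mu>" using vershik_domain_full(1) by (rule sets.Int) simp
  have space: "space ?\<rho> = ?dom"
    using sets.sets_into_space[OF vershik_domain_full(1)] by (auto simp: space_restrict_space)
  obtain a where a: "a \<in> \<alpha>" using class_ne by blast
  obtain b where b: "b \<in> \<alpha>" "(a, b) \<in> G" using class_has_edge[OF radius_nonzero a] by blast
  obtain k where k: "\<forall>v\<in>\<alpha>. \<forall>w\<in>\<alpha>. (v, w) \<in> G ^^ k" using class_uniform_relpow[OF a b] by blast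
  obtain K where K: "K \<ge> 1" "\<And>n. n \<ge> 1 \<Longrightarrow> \<exists>x\<in>inf_paths B. \<exists>z\<in>inf_paths B. 
     src B (Suc n) (x n) = a \<and> src B (Suc n) (z n) = a \<and>
    src B (Suc (n + K)) (x (n + K)) = a \<and> (\<forall>i\<ge>n + K. x i = z i) \<and> (\<exists>i. n \<le> i \<and> i < n + K \<and> x i \<noteq> z i)"
    using two_segments[OF radius_gt_1 a] by blast
  define c where "c = g a / (g_bound * rad ^ (k + K))"
  have c: "c > 0" unfolding c_def using g_pos[OF a] g_bound_pos radius_pos by simp
  \<comment> \<open>The cylinders of length \<open>i + 1\<close> ending in \<open>a\<close> have
    measure \<open>g a * (1 / rad) ^ i\<close>, which tends to 0, whereas \<open>c\<close> does not
    depend on \<open>i\<close>.\<close>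
  have large: "c \<le> g a * (1 / rad) ^ i" for i
  proof -
    define m where "m = Suc i"
    have m1: "m \<ge> 1" by (simp add: m_def)
    have "a \<in> vtx B m" using a class_sub vtx_eq[OF m1] by auto
    then obtain x0 where x0: "x0 \<in> inf_paths B" "src B (Suc m) (x0 m) = a" using ex_path_through by blast
    let ?E = "shared_prefix m x0"
    let ?S = "?E \<inter> ?dom"
    define e where "e = measure \<mu> ?E"
    have e: "e = g a * (1 / rad) ^ i"
      unfolding e_def using measure_shared_prefix[OF x0(1) m1] x0(2) by (simp add: m_def power_one_over)
    then have "e > 0" using g_pos[OF a] radius_pos by simp
    have "?S \<in> sets ?\<rho>"
      using shared_prefix_sets[OF x0(1)] dom by (auto simp: sets_restrict_space)
    then have "(\<lambda>n. measure ?\<rho> ((vershik B ^^ n) -` ?S \<inter> space ?\<rho> \<inter> ?S)) \<longlonglongrightarrow> measure ?\<rho> ?S * measure ?\<rho> ?S"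
      using mix unfolding strongly_mixing_def by blast
    moreover have "measure ?\<rho> A = measure \<mu> A" if "A \<subseteq> ?dom" for A
      using measure_restrict_space[OF dom that] .
    ultimately have lim: "(\<lambda>n. measure \<mu> ((vershik B ^^ n) -` ?S \<inter> ?dom \<inter> ?S)) \<longlonglongrightarrow> e * e"
      unfolding space e_def measure_inter_domain[OF shared_prefix_sets[OF x0(1)], symmetric]
      by (simp add: le_infI2)
    \<comment> \<open>Mixing makes the overlaps tend to \<open>e * e\<close>, while beyond every
      \<open>D0\<close> there is a displacement with overlap at least \<open>c * e\<close>.\<close>
    have "c * e \<le> e * e"
    proof (rule ccontr)
      assume "\<not> ?thesis"
      then have "\<forall>\<^sub>F n in sequentially. measure \<mu> ((vershik B ^^ n) -` ?S \<inter> ?dom \<inter> ?S) < c * e"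
        using lim by (intro order_tendstoD(2)) auto
      then obtain D0 where "\<And>n. n \<ge> D0 \<Longrightarrow> measure \<mu> ((vershik B ^^ n) -` ?S \<inter> ?dom \<inter> ?S) < c * e"
        by (auto simp: eventually_sequentially)
      moreover obtain D where "D \<ge> D0" "c * e \<le> measure \<mu> ((vershik B ^^ D) -` ?S \<inter> ?dom \<inter> ?S)"
        using displacement_overlap[OF a k K x0 m1, of D0] unfolding c_def e_def by blast
      ultimately show False by (meson linorder_not_le)
    qed
    then have "c \<le> e" using \<open>e > 0\<close> by simp
    then show ?thesis unfolding e .
  qed
  have "(\<lambda>i. (1 / rad) ^ i) \<longlonglongrightarrow> 0" using radius_gt_1 by (intro LIMSEQ_power_zero) simp
  then have "(\<lambda>i. g a * (1 / rad) ^ i) \<longlonglongrightarrow> g a * 0" by (intro tendsto_mult tendsto_const)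
  then have "c \<le> g a * 0" using large by (intro LIMSEQ_le_const) auto
  then show False using c by simp
qed

end

theorem corollary6p2:
  fixes B :: "(nat, 'e) bratteli"
    and N :: nat and F :: "nat mat" and \<alpha> :: "nat set"
    and \<mu> :: "(nat \<Rightarrow> 'e) measure"
    and \<sigma> :: "'a :: finite \<Rightarrow> 'a list"
    and \<nu> :: "(int \<Rightarrow> 'a) measure"
  shows
    "(stationary_ordered B N F \<and> no_isolated_points (path_topology B) \<and>
      aperiodic_tail_relation B \<and> condition_P F \<and>
      distinguished F \<alpha> \<and> distinguished_measure B F \<alpha> \<mu> \<longrightarrow>
        \<not> strongly_mixing (restrict_space \<mu> (vershik_domain B)) (vershik B))
     \<and>
     (substitution \<sigma> \<and> aperiodic_subst \<sigma> \<and>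
      (\<forall>a. filterlim (\<lambda>n. length ((subst_ext \<sigma> ^^ n) [a])) at_top sequentially) \<and>
      prob_space \<nu> \<and> sets \<nu> = sets (borel_of_top (subst_topology \<sigma>)) \<and>
      preserves_measure \<nu> left_shift \<and> ergodic \<nu> left_shift \<longrightarrow>
        \<not> strongly_mixing \<nu> left_shift)"
proof (intro conjI impI)
  assume h: "stationary_ordered B N F \<and> no_isolated_points (path_topology B) \<and>
      aperiodic_tail_relation B \<and> condition_P F \<and>
      distinguished F \<alpha> \<and> distinguished_measure B F \<alpha> \<mu>"
  then have diagram: "ordered_diagram B" "stationary_diagram B N F" "condition_P F"
      "\<alpha> \<in> comm_classes (transpose_mat F)" "aperiodic_tail_relation B"
    by (simp_all add: stationary_ordered_def distinguished_def)
  have "distinguished_measure B F \<alpha> \<mu>" using h by simp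
  then have meas: "prob_space \<mu>" "sets \<mu> = sets (borel_of_top (path_topology B))"
    and ex: "\<exists>\<xi>. distinguished_vector B F \<alpha> \<xi> \<and>
      (\<forall>p. fin_path B p \<and> p \<noteq> [] \<longrightarrow>
         measure \<mu> (cylinder B p) = vec_index \<xi> (rng B (length p) (last p)) / class_radius F \<alpha> ^ (length p - 1))"
    by (simp_all only: distinguished_measure_def)
  from ex obtain \<xi> where \<xi>: "distinguished_vector B F \<alpha> \<xi>"
    "\<forall>p. fin_path B p \<and> p \<noteq> [] \<longrightarrow>
       measure \<mu> (cylinder B p) = vec_index \<xi> (rng B (length p) (last p)) / class_radius F \<alpha> ^ (length p - 1)"
    by (elim exE conjE)
  interpret distinguished_system B N F \<alpha> \<mu> \<xi>
    by (intro distinguished_system.intro stationary_bratteli.intro ordered_bratteli.intro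
          stationary_bratteli_axioms.intro distinguished_system_axioms.intro)
       (use diagram meas \<xi> in blast)+
  show "\<not> strongly_mixing (restrict_space \<mu> (vershik_domain B)) (vershik B)"
    by (rule vershik_not_strongly_mixing)
next
  assume h: "substitution \<sigma> \<and> aperiodic_subst \<sigma> \<and>
      (\<forall>a. filterlim (\<lambda>n. length ((subst_ext \<sigma> ^^ n) [a])) at_top sequentially) \<and>
      prob_space \<nu> \<and> sets \<nu> = sets (borel_of_top (subst_topology \<sigma>)) \<and>
      preserves_measure \<nu> left_shift \<and> ergodic \<nu> left_shift"
  interpret shift_invariant_measure \<sigma> \<nu> by (rule shift_invariant_measure.intro) (use h in simp_all)
  show "\<not> strongly_mixing \<nu> left_shift" by (rule not_strongly_mixing)
qed

end
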